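(* Let $M$ be a Riemannian manifold of dimension $n$ equipped with a vector field $\zeta$, a function $\beta\in C(M)$ and a conformal Killing vector field $\tau$, and let $\alpha=\frac{2}{n}\mathrm{div}(\tau)-1$. Then the first order differential calculus $(\Omega^1,\mathrm{d})$ on $C(M)$ defined by $\zeta$ extends to a first order differential calculus $(\Omega^1(C(M)\rtimes_\tau\mathbb{R}),\mathrm{d})$ on the algebra $C(M)\rtimes_\tau\mathbb{R}$, with further relations \[ [\omega,t]=\lambda(\bar{\mathcal L}_\tau-\mathrm{id})\omega-\lambda^2\,\tfrac{n-2}{4}\,(\bar{\mathrm d}\alpha,\omega)\,\theta'-\tfrac{\lambda^2}{2}(\bar{\mathcal L}_\tau\zeta^*,\omega)\,\theta',\] \[ [\theta',t]=\alpha\lambda\theta',\qquad [f,\mathrm{d}t]=\lambda\,\mathrm{d}f,\qquad [\mathrm{d}t,t]=\beta\lambda\theta'-\lambda\,\mathrm{d}t\] for all $\omega\in\bar\Omega^1(M)$ and $f\in C(M)$.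
   Context: $C(M)$ is the algebra of smooth functions on $M$, $\bar\Omega^1=\bar\Omega^1(M)$ the classical 1-forms, $\bar{\mathrm d}$ the classical exterior derivative, $\bar g$ the metric, $(\ ,\ )$ the inverse metric on 1-forms, $\bar\nabla$ the Levi-Civita connection, $\bar\Delta_{LB}$ the Laplace-Beltrami operator, $\bar{\mathcal L}_\tau$ the Lie derivative, and $\zeta^*=\bar g(\zeta)$ the 1-form corresponding to $\zeta$. $\lambda$ is a constant (the deformation parameter; everything is complexified if $\lambda$ is complex). A first order differential calculus on an algebra $A$ is an $A$-bimodule $\Omega^1$ together with a linear map $\mathrm d:A\to\Omega^1$ obeying $\mathrm d(ab)=(\mathrm da)b+a\,\mathrm db$ (that $\Omega^1$ is spanned by elements $a\,\mathrm db$ is not part of the assertion). Calculus on $C(M)$ defined by $\zeta$: put $\bar\Delta f=\bar\Delta_{LB}f+\zeta(f)$. Then $\Omega^1=\bar\Omega^1\oplus C(M)\theta'$, with left action the usual one, $\theta'$ commuting with functions, right action $\omega\bullet f=\omega f+\lambda(\omega,\bar{\mathrm d}f)\theta'$ for $\omega\in\bar\Omega^1$ (i.e. $[\omega,f]=\lambda(\omega,\bar{\mathrm d}f)\theta'$, $[\theta',f]=0$), and $\mathrm df=\bar{\mathrm d}f+\frac{\lambda}{2}(\bar\Delta f)\theta'$. The algebra $C(M)\rtimes_\tau\mathbb{R}$ is generated by $C(M)$ and an element $t$ with relations $[f,t]=\lambda\tau(f)$, $f\in C(M)$; its elements are uniquely of the normal ordered form $\sum_n f_nt^n$ (finite sums,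 $f_n\in C(M)$). The extended calculus is generated by $\Omega^1$ and one additional generator $\mathrm dt$ (elements being uniquely written with coefficients in $C(M)$ on the left and powers of $t$ on the right of $\bar\Omega^1,\theta',\mathrm dt$). Brackets denote commutators in the bimodule structure. With these conventions the conformal Killing condition is $\bar{\mathcal L}_\tau\bar g=(1+\alpha)\bar g$. *)

theory Defs
  imports "HOL-Analysis.Analysis" "HOL-Algebra.Module"
begin

section \<open>Smooth manifolds and tensor fields in charts\<close>

text \<open>
  The manifold is a whole type, of dimension \<open>CARD('n)\<close>, with a (not necessarily maximal) smooth
  atlas. The field of scalars is \<open>'k :: real_normed_field\<close>: this covers the real case
  and, with \<open>'k = complex\<close>, the complexified one (functions, forms and vector fields then have
  complex components; charts and metric are always real).
\<close>

fun Ck_on :: "nat \<Rightarrow> 'a::real_normed_vector set \<Rightarrow> ('a \<Rightarrow> 'b::real_normed_vector) \<Rightarrow> bool" where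
  "Ck_on 0 S f \<longleftrightarrow> continuous_on S f"
| "Ck_on (Suc k) S f \<longleftrightarrow>
     (\<forall>x\<in>S. f differentiable (at x)) \<and> (\<forall>v. Ck_on k S (\<lambda>x. frechet_derivative f (at x) v))"

text \<open>Only used for open \<open>S\<close>.\<close>

definition smooth_on :: "'a::real_normed_vector set \<Rightarrow> ('a \<Rightarrow> 'b::real_normed_vector) \<Rightarrow> bool" where
  "smooth_on S f \<longleftrightarrow> (\<forall>k. Ck_on k S f)"

type_synonym ('m, 'n) chart = "'m set \<times> ('m \<Rightarrow> real ^ 'n)"

definition smooth_atlas :: "('m::topological_space, 'n::finite) chart set \<Rightarrow> bool" where
  "smooth_atlas A \<longleftrightarrow>
     (\<Union>(U, \<phi>)\<in>A. U) = UNIV \<and>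
     (\<forall>(U, \<phi>)\<in>A. open U \<and> open (\<phi> ` U) \<and> homeomorphism U (\<phi> ` U) \<phi> (inv_into U \<phi>)) \<and>
     (\<forall>(U, \<phi>)\<in>A. \<forall>(V, \<psi>)\<in>A. smooth_on (\<phi> ` (U \<inter> V)) (\<psi> \<circ> inv_into U \<phi>))"

definition smooth_in :: "('m, 'n::finite) chart \<Rightarrow> ('m \<Rightarrow> 'b::real_normed_vector) \<Rightarrow> bool" where
  "smooth_in c f \<longleftrightarrow> smooth_on (snd c ` fst c) (f \<circ> inv_into (fst c) (snd c))"

definition smooth_fun :: "('m, 'n::finite) chart set \<Rightarrow> ('m \<Rightarrow> 'b::real_normed_vector) \<Rightarrow> bool" where
  "smooth_fun A f \<longleftrightarrow> (\<forall>c\<in>A. smooth_in c f)"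

text \<open>The partial derivative \<open>\<partial>f/\<partial>x\<^sup>i\<close> at \<open>p\<close>, for the coordinates \<open>x\<close> of the chart \<open>c\<close>.\<close>

definition pd :: "('m, 'n::finite) chart \<Rightarrow> 'n \<Rightarrow> ('m \<Rightarrow> 'b::real_normed_vector) \<Rightarrow> 'm \<Rightarrow> 'b" where
  "pd c i f p = frechet_derivative (f \<circ> inv_into (fst c) (snd c)) (at (snd c p)) (axis i 1)"

text \<open>\<open>jac c d p $ j $ i\<close> is \<open>\<partial>y\<^sup>j/\<partial>x\<^sup>i\<close>, with \<open>x\<close>, \<open>y\<close> the coordinates of \<open>c\<close>, \<open>d\<close>.\<close>

definition jac :: "('m, 'n::finite) chart \<Rightarrow> ('m, 'n) chart \<Rightarrow> 'm \<Rightarrow> real ^ 'n ^ 'n" where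
  "jac c d p = (\<chi> j i. pd c i (\<lambda>q. snd d q $ j) p)"

text \<open>
  A vector field or 1-form is the family of its components in all charts of the atlas, subject to
  the usual transformation law. Components are \<open>0\<close> where a chart is not defined, so that equality
  of fields is equality of functions.
\<close>

type_synonym ('m, 'n, 'k) field = "('m, 'n) chart \<Rightarrow> 'm \<Rightarrow> 'k ^ 'n"

definition vector_field ::
  "('m, 'n::finite) chart set \<Rightarrow> ('m, 'n, 'k::real_normed_field) field \<Rightarrow> bool" where
  "vector_field A X \<longleftrightarrow>
     (\<forall>c p. c \<notin> A \<or> p \<notin> fst c \<longrightarrow> X c p = 0) \<and>
     (\<forall>c\<in>A. \<forall>i. smooth_in c (\<lambda>p. X c p $ i)) \<and>
     (\<forall>c\<in>A. \<forall>d\<in>A. \<forall>p\<in>fst c \<inter> fst d. \<forall>j. X d p $ j = (\<Sum>i\<in>UNIV. jac c d p $ j $ i *\<^sub>R X c p $ i))"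

definition one_form ::
  "('m, 'n::finite) chart set \<Rightarrow> ('m, 'n, 'k::real_normed_field) field \<Rightarrow> bool" where
  "one_form A \<omega> \<longleftrightarrow>
     (\<forall>c p. c \<notin> A \<or> p \<notin> fst c \<longrightarrow> \<omega> c p = 0) \<and>
     (\<forall>c\<in>A. \<forall>i. smooth_in c (\<lambda>p. \<omega> c p $ i)) \<and>
     (\<forall>c\<in>A. \<forall>d\<in>A. \<forall>p\<in>fst c \<inter> fst d. \<forall>i. \<omega> c p $ i = (\<Sum>j\<in>UNIV. jac c d p $ j $ i *\<^sub>R \<omega> d p $ j))"

type_synonym ('m, 'n) metric = "('m, 'n) chart \<Rightarrow> 'm \<Rightarrow> real ^ 'n ^ 'n"

definition riemannian_metric :: "('m, 'n::finite) chart set \<Rightarrow> ('m, 'n) metric \<Rightarrow> bool" where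
  "riemannian_metric A g \<longleftrightarrow>
     (\<forall>c\<in>A. \<forall>p\<in>fst c. transpose (g c p) = g c p \<and> (\<forall>v. v \<noteq> 0 \<longrightarrow> v \<bullet> (g c p *v v) > 0)) \<and>
     (\<forall>c\<in>A. \<forall>i j. smooth_in c (\<lambda>p. g c p $ i $ j)) \<and>
     (\<forall>c\<in>A. \<forall>d\<in>A. \<forall>p\<in>fst c \<inter> fst d. g c p = transpose (jac c d p) ** g d p ** jac c d p)"

text \<open>
  Scalars built from tensor fields are evaluated at \<open>p\<close> in some chart around \<open>p\<close>; the value
  does not depend on this choice.
\<close>

definition chart_at :: "('m, 'n) chart set \<Rightarrow> 'm \<Rightarrow> ('m, 'n) chart" where
  "chart_at A p = (SOME c. c \<in> A \<and> p \<in> fst c)"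

definition apply_field :: "('m, 'n::finite) chart set \<Rightarrow> ('m, 'n, 'k::real_normed_field) field \<Rightarrow>
    ('m \<Rightarrow> 'k) \<Rightarrow> 'm \<Rightarrow> 'k" where
  "apply_field A X f p = (let c = chart_at A p in \<Sum>i\<in>UNIV. X c p $ i * pd c i f p)"

definition ext_d :: "('m, 'n::finite) chart set \<Rightarrow> ('m \<Rightarrow> 'k::real_normed_field) \<Rightarrow> ('m, 'n, 'k) field" where
  "ext_d A f c p = (if c \<in> A \<and> p \<in> fst c then (\<chi> i. pd c i f p) else 0)"

definition inv_metric :: "('m, 'n::finite) chart set \<Rightarrow> ('m, 'n) metric \<Rightarrow>
    ('m, 'n, 'k::real_normed_field) field \<Rightarrow> ('m, 'n, 'k) field \<Rightarrow> 'm \<Rightarrow> 'k" where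
  "inv_metric A g \<omega> \<eta> p = (let c = chart_at A p in
     \<Sum>i\<in>UNIV. \<Sum>j\<in>UNIV. matrix_inv (g c p) $ i $ j *\<^sub>R (\<omega> c p $ i * \<eta> c p $ j))"

definition flat :: "('m, 'n::finite) metric \<Rightarrow> ('m, 'n, 'k::real_normed_field) field \<Rightarrow> ('m, 'n, 'k) field" where
  "flat g X c p = (\<chi> i. \<Sum>j\<in>UNIV. g c p $ i $ j *\<^sub>R X c p $ j)"

definition sharp :: "('m, 'n::finite) metric \<Rightarrow> ('m, 'n, 'k::real_normed_field) field \<Rightarrow> ('m, 'n, 'k) field" where
  "sharp g \<omega> c p = (\<chi> i. \<Sum>j\<in>UNIV. matrix_inv (g c p) $ i $ j *\<^sub>R \<omega> c p $ j)"

text \<open>The Christoffel symbol \<open>\<Gamma>\<^sup>k\<^bsub>ij\<^esub>\<close> of the Levi-Civita connection.\<close>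

definition christoffel :: "('m, 'n::finite) metric \<Rightarrow> ('m, 'n) chart \<Rightarrow> 'n \<Rightarrow> 'n \<Rightarrow> 'n \<Rightarrow> 'm \<Rightarrow> real" where
  "christoffel g c k i j p = (1 / 2) * (\<Sum>l\<in>UNIV. matrix_inv (g c p) $ k $ l *
     (pd c i (\<lambda>q. g c q $ j $ l) p + pd c j (\<lambda>q. g c q $ i $ l) p - pd c l (\<lambda>q. g c q $ i $ j) p))"

text \<open>\<open>nabla g X c p $ i $ j\<close> is the component \<open>\<nabla>\<^sub>j X\<^sup>i\<close>.\<close>

definition nabla :: "('m, 'n::finite) metric \<Rightarrow> ('m, 'n, 'k::real_normed_field) field \<Rightarrow>
    ('m, 'n) chart \<Rightarrow> 'm \<Rightarrow> 'k ^ 'n ^ 'n" where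
  "nabla g X c p = (\<chi> i j. pd c j (\<lambda>q. X c q $ i) p + (\<Sum>k\<in>UNIV. christoffel g c i j k p *\<^sub>R X c p $ k))"

definition divergence :: "('m, 'n::finite) chart set \<Rightarrow> ('m, 'n) metric \<Rightarrow>
    ('m, 'n, 'k::real_normed_field) field \<Rightarrow> 'm \<Rightarrow> 'k" where
  "divergence A g X p = trace (nabla g X (chart_at A p) p)"

definition laplace_beltrami :: "('m, 'n::finite) chart set \<Rightarrow> ('m, 'n) metric \<Rightarrow>
    ('m \<Rightarrow> 'k::real_normed_field) \<Rightarrow> 'm \<Rightarrow> 'k" where
  "laplace_beltrami A g f = divergence A g (sharp g (ext_d A f))"

definition lie_form :: "('m, 'n::finite, 'k::real_normed_field) field \<Rightarrow> ('m, 'n, 'k) field \<Rightarrow> ('m, 'n, 'k) field" where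
  "lie_form X \<omega> c p = (\<chi> i. \<Sum>j\<in>UNIV.
     X c p $ j * pd c j (\<lambda>q. \<omega> c q $ i) p + \<omega> c p $ j * pd c i (\<lambda>q. X c q $ j) p)"

definition lie_metric :: "('m, 'n::finite, 'k::real_normed_field) field \<Rightarrow> ('m, 'n) metric \<Rightarrow>
    ('m, 'n) chart \<Rightarrow> 'm \<Rightarrow> 'k ^ 'n ^ 'n" where
  "lie_metric X g c p = (\<chi> i j. \<Sum>k\<in>UNIV.
     X c p $ k * of_real (pd c k (\<lambda>q. g c q $ i $ j) p)
     + g c p $ k $ j *\<^sub>R pd c i (\<lambda>q. X c q $ k) p
     + g c p $ i $ k *\<^sub>R pd c j (\<lambda>q. X c q $ k) p)"

text \<open>
  The conformal factor \<open>\<phi>\<close> is written \<open>1 + \<alpha>\<close> in the main statement; taking traces in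
  \<open>L\<^sub>X g = \<phi> g\<close> shows that it is necessarily \<open>2/n div X\<close>.
\<close>

definition conformal_killing :: "('m, 'n::finite) chart set \<Rightarrow> ('m, 'n) metric \<Rightarrow>
    ('m, 'n, 'k::real_normed_field) field \<Rightarrow> bool" where
  "conformal_killing A g X \<longleftrightarrow> vector_field A X \<and>
     (\<exists>\<phi>. smooth_fun A \<phi> \<and>
       (\<forall>c\<in>A. \<forall>p\<in>fst c. \<forall>i j. lie_metric X g c p $ i $ j = \<phi> p * of_real (g c p $ i $ j)))"


section \<open>First order differential calculi\<close>

text \<open>
  Algebras and bimodules over a ground ring \<open>K\<close> are represented by \<open>K\<close>-module records; the fields
  \<open>mult\<close> and \<open>one\<close> of the record of a bimodule are irrelevant.
\<close>

record ('k, 'a, 'w) bimod = "('k, 'w) module" +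
  lact :: "'a \<Rightarrow> 'w \<Rightarrow> 'w"
  ract :: "'w \<Rightarrow> 'a \<Rightarrow> 'w"

locale assoc_algebra = V: module K A + R: ring A
  for K :: "('k, 'z) ring_scheme" and A :: "('k, 'a, 'y) module_scheme" +
  assumes smult_mult_left: "\<lbrakk>r \<in> carrier K; a \<in> carrier A; b \<in> carrier A\<rbrakk> \<Longrightarrow>
      (r \<odot>\<^bsub>A\<^esub> a) \<otimes>\<^bsub>A\<^esub> b = r \<odot>\<^bsub>A\<^esub> (a \<otimes>\<^bsub>A\<^esub> b)"
    and smult_mult_right: "\<lbrakk>r \<in> carrier K; a \<in> carrier A; b \<in> carrier A\<rbrakk> \<Longrightarrow>
      a \<otimes>\<^bsub>A\<^esub> (r \<odot>\<^bsub>A\<^esub> b) = r \<odot>\<^bsub>A\<^esub> (a \<otimes>\<^bsub>A\<^esub> b)"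

locale bimodule = A: assoc_algebra K A + W: module K W
  for K :: "('k, 'z) ring_scheme" and A :: "('k, 'a, 'y) module_scheme"
    and W :: "('k, 'a, 'w, 'x) bimod_scheme" +
  assumes lact_closed: "\<lbrakk>a \<in> carrier A; w \<in> carrier W\<rbrakk> \<Longrightarrow> lact W a w \<in> carrier W"
    and ract_closed: "\<lbrakk>a \<in> carrier A; w \<in> carrier W\<rbrakk> \<Longrightarrow> ract W w a \<in> carrier W"
    and lact_add: "\<lbrakk>a \<in> carrier A; w \<in> carrier W; v \<in> carrier W\<rbrakk> \<Longrightarrow>
      lact W a (w \<oplus>\<^bsub>W\<^esub> v) = lact W a w \<oplus>\<^bsub>W\<^esub> lact W a v"
    and add_lact: "\<lbrakk>a \<in> carrier A; b \<in> carrier A; w \<in> carrier W\<rbrakk> \<Longrightarrow>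
      lact W (a \<oplus>\<^bsub>A\<^esub> b) w = lact W a w \<oplus>\<^bsub>W\<^esub> lact W b w"
    and ract_add: "\<lbrakk>a \<in> carrier A; w \<in> carrier W; v \<in> carrier W\<rbrakk> \<Longrightarrow>
      ract W (w \<oplus>\<^bsub>W\<^esub> v) a = ract W w a \<oplus>\<^bsub>W\<^esub> ract W v a"
    and add_ract: "\<lbrakk>a \<in> carrier A; b \<in> carrier A; w \<in> carrier W\<rbrakk> \<Longrightarrow>
      ract W w (a \<oplus>\<^bsub>A\<^esub> b) = ract W w a \<oplus>\<^bsub>W\<^esub> ract W w b"
    and one_lact: "w \<in> carrier W \<Longrightarrow> lact W \<one>\<^bsub>A\<^esub> w = w"
    and one_ract: "w \<in> carrier W \<Longrightarrow> ract W w \<one>\<^bsub>A\<^esub> = w"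
    and lact_assoc: "\<lbrakk>a \<in> carrier A; b \<in> carrier A; w \<in> carrier W\<rbrakk> \<Longrightarrow>
      lact W (a \<otimes>\<^bsub>A\<^esub> b) w = lact W a (lact W b w)"
    and ract_assoc: "\<lbrakk>a \<in> carrier A; b \<in> carrier A; w \<in> carrier W\<rbrakk> \<Longrightarrow>
      ract W w (a \<otimes>\<^bsub>A\<^esub> b) = ract W (ract W w a) b"
    and lact_ract: "\<lbrakk>a \<in> carrier A; b \<in> carrier A; w \<in> carrier W\<rbrakk> \<Longrightarrow>
      ract W (lact W a w) b = lact W a (ract W w b)"
    and smult_lact: "\<lbrakk>r \<in> carrier K; a \<in> carrier A; w \<in> carrier W\<rbrakk> \<Longrightarrow>
      lact W (r \<odot>\<^bsub>A\<^esub> a) w = r \<odot>\<^bsub>W\<^esub> lact W a w"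
    and lact_smult: "\<lbrakk>r \<in> carrier K; a \<in> carrier A; w \<in> carrier W\<rbrakk> \<Longrightarrow>
      lact W a (r \<odot>\<^bsub>W\<^esub> w) = r \<odot>\<^bsub>W\<^esub> lact W a w"
    and smult_ract: "\<lbrakk>r \<in> carrier K; a \<in> carrier A; w \<in> carrier W\<rbrakk> \<Longrightarrow>
      ract W (r \<odot>\<^bsub>W\<^esub> w) a = r \<odot>\<^bsub>W\<^esub> ract W w a"
    and ract_smult: "\<lbrakk>r \<in> carrier K; a \<in> carrier A; w \<in> carrier W\<rbrakk> \<Longrightarrow>
      ract W w (r \<odot>\<^bsub>A\<^esub> a) = r \<odot>\<^bsub>W\<^esub> ract W w a"

locale fodc = bimodule K A W
  for K :: "('k, 'z) ring_scheme" and A :: "('k, 'a, 'y) module_scheme"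
    and W :: "('k, 'a, 'w, 'x) bimod_scheme" and d :: "'a \<Rightarrow> 'w" +
  assumes d_closed: "a \<in> carrier A \<Longrightarrow> d a \<in> carrier W"
    and d_add: "\<lbrakk>a \<in> carrier A; b \<in> carrier A\<rbrakk> \<Longrightarrow> d (a \<oplus>\<^bsub>A\<^esub> b) = d a \<oplus>\<^bsub>W\<^esub> d b"
    and d_smult: "\<lbrakk>r \<in> carrier K; a \<in> carrier A\<rbrakk> \<Longrightarrow> d (r \<odot>\<^bsub>A\<^esub> a) = r \<odot>\<^bsub>W\<^esub> d a"
    and d_mult: "\<lbrakk>a \<in> carrier A; b \<in> carrier A\<rbrakk> \<Longrightarrow>
      d (a \<otimes>\<^bsub>A\<^esub> b) = ract W (d a) b \<oplus>\<^bsub>W\<^esub> lact W a (d b)"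

text \<open>A calculus \<open>(W, d)\<close> on \<open>A\<close> extends to a calculus \<open>(W', d')\<close> on \<open>A'\<close>, along injections
  \<open>i\<close> of algebras and \<open>j\<close> of bimodules.\<close>

locale fodc_extension = base: fodc K A W d + ext: fodc K A' W' d'
  for K :: "('k, 'z) ring_scheme"
    and A :: "('k, 'a, 'y) module_scheme" and W :: "('k, 'a, 'w, 'x) bimod_scheme" and d :: "'a \<Rightarrow> 'w"
    and A' :: "('k, 'b, 'u) module_scheme" and W' :: "('k, 'b, 'v, 't) bimod_scheme" and d' :: "'b \<Rightarrow> 'v"
    and i :: "'a \<Rightarrow> 'b" and j :: "'w \<Rightarrow> 'v" +
  assumes i_hom: "i \<in> ring_hom A A'"
    and i_smult: "\<lbrakk>r \<in> carrier K; a \<in> carrier A\<rbrakk> \<Longrightarrow> i (r \<odot>\<^bsub>A\<^esub> a) = r \<odot>\<^bsub>A'\<^esub> i a"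
    and i_inj: "inj_on i (carrier A)"
    and j_closed: "w \<in> carrier W \<Longrightarrow> j w \<in> carrier W'"
    and j_add: "\<lbrakk>w \<in> carrier W; v \<in> carrier W\<rbrakk> \<Longrightarrow> j (w \<oplus>\<^bsub>W\<^esub> v) = j w \<oplus>\<^bsub>W'\<^esub> j v"
    and j_smult: "\<lbrakk>r \<in> carrier K; w \<in> carrier W\<rbrakk> \<Longrightarrow> j (r \<odot>\<^bsub>W\<^esub> w) = r \<odot>\<^bsub>W'\<^esub> j w"
    and j_lact: "\<lbrakk>a \<in> carrier A; w \<in> carrier W\<rbrakk> \<Longrightarrow> j (lact W a w) = lact W' (i a) (j w)"
    and j_ract: "\<lbrakk>a \<in> carrier A; w \<in> carrier W\<rbrakk> \<Longrightarrow> j (ract W w a) = ract W' (j w) (i a)"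
    and j_inj: "inj_on j (carrier W)"
    and j_d: "a \<in> carrier A \<Longrightarrow> j (d a) = d' (i a)"

text \<open>The commutators \<open>[w, a]\<close> and \<open>[a, w]\<close> of a bimodule element and an algebra element.\<close>

definition comm_wa :: "('k, 'a, 'w, 'x) bimod_scheme \<Rightarrow> 'w \<Rightarrow> 'a \<Rightarrow> 'w" where
  "comm_wa W w a = ract W w a \<ominus>\<^bsub>W\<^esub> lact W a w"

definition comm_aw :: "('k, 'a, 'w, 'x) bimod_scheme \<Rightarrow> 'a \<Rightarrow> 'w \<Rightarrow> 'w" where
  "comm_aw W a w = lact W a w \<ominus>\<^bsub>W\<^esub> ract W w a"


section \<open>The algebras and calculi at hand\<close>

definition scalars :: "'k::field ring" where
  "scalars = \<lparr>carrier = UNIV, mult = (*), one = 1, zero = 0, add = (+)\<rparr>"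

definition function_algebra :: "('m, 'n::finite) chart set \<Rightarrow> ('k::real_normed_field, 'm \<Rightarrow> 'k) module" where
  "function_algebra A = \<lparr>carrier = {f. smooth_fun A f},
     mult = (\<lambda>f h p. f p * h p), one = (\<lambda>_. 1), zero = (\<lambda>_. 0), add = (\<lambda>f h p. f p + h p),
     smult = (\<lambda>r f p. r * f p)\<rparr>"

text \<open>The pair \<open>(\<omega>, a)\<close> stands for \<open>\<omega> + a \<theta>'\<close>. The bimodule depends only on the metric and on
  the deformation parameter \<open>l\<close>; the vector field \<open>\<zeta>\<close> enters in the differential.\<close>

definition calculus :: "('m, 'n::finite) chart set \<Rightarrow> ('m, 'n) metric \<Rightarrow> 'k::real_normed_field \<Rightarrow>
    ('k, 'm \<Rightarrow> 'k, ('m, 'n, 'k) field \<times> ('m \<Rightarrow> 'k)) bimod" where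
  "calculus A g l = \<lparr>carrier = {(\<omega>, a). one_form A \<omega> \<and> smooth_fun A a},
     mult = undefined, one = undefined,
     zero = ((\<lambda>c p. 0), (\<lambda>p. 0)),
     add = (\<lambda>(\<omega>, a) (\<eta>, b). ((\<lambda>c p. \<omega> c p + \<eta> c p), (\<lambda>p. a p + b p))),
     smult = (\<lambda>r (\<omega>, a). ((\<lambda>c p. r *s \<omega> c p), (\<lambda>p. r * a p))),
     lact = (\<lambda>f (\<omega>, a). ((\<lambda>c p. f p *s \<omega> c p), (\<lambda>p. f p * a p))),
     ract = (\<lambda>(\<omega>, a) f. ((\<lambda>c p. f p *s \<omega> c p), (\<lambda>p. f p * a p + l * inv_metric A g \<omega> (ext_d A f) p)))\<rparr>"

definition calculus_d :: "('m, 'n::finite) chart set \<Rightarrow> ('m, 'n) metric \<Rightarrow> 'k::real_normed_field \<Rightarrow>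
    ('m, 'n, 'k) field \<Rightarrow> ('m \<Rightarrow> 'k) \<Rightarrow> ('m, 'n, 'k) field \<times> ('m \<Rightarrow> 'k)" where
  "calculus_d A g l \<zeta> f =
     (ext_d A f, (\<lambda>p. l / 2 * (laplace_beltrami A g f p + apply_field A \<zeta> f p)))"

text \<open>
  The sequence \<open>a\<close> stands for the normal ordered element \<open>\<Sum>n. a\<^sub>n t\<^sup>n\<close>. By \<open>[f, t] = l \<tau>(f)\<close> we have
  \<open>t (f t\<^sup>n) = f t\<^sup>n\<^sup>+\<^sup>1 - l \<tau>(f) t\<^sup>n\<close>, so left multiplication by \<open>t\<close> is the operator \<open>left_t\<close>, and this
  determines all products \<open>(\<Sum>m. a\<^sub>m t\<^sup>m) b\<close>.
\<close>

definition left_t :: "('m, 'n::finite) chart set \<Rightarrow> ('m, 'n, 'k::real_normed_field) field \<Rightarrow> 'k \<Rightarrow>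
    (nat \<Rightarrow> 'm \<Rightarrow> 'k) \<Rightarrow> nat \<Rightarrow> 'm \<Rightarrow> 'k" where
  "left_t A \<tau> l b n p = (case n of 0 \<Rightarrow> 0 | Suc k \<Rightarrow> b k p) - l * apply_field A \<tau> (b n) p"

definition crossed_product :: "('m, 'n::finite) chart set \<Rightarrow> ('m, 'n, 'k::real_normed_field) field \<Rightarrow> 'k \<Rightarrow>
    ('k, nat \<Rightarrow> 'm \<Rightarrow> 'k) module" where
  "crossed_product A \<tau> l = \<lparr>carrier = {a. (\<forall>n. smooth_fun A (a n)) \<and> finite {n. a n \<noteq> (\<lambda>_. 0)}},
     mult = (\<lambda>a b n p. \<Sum>m\<in>{m. a m \<noteq> (\<lambda>_. 0)}. a m p * (left_t A \<tau> l ^^ m) b n p),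
     one = (\<lambda>n p. if n = 0 then 1 else 0),
     zero = (\<lambda>n p. 0),
     add = (\<lambda>a b n p. a n p + b n p),
     smult = (\<lambda>r a n p. r * a n p)\<rparr>"

definition incl :: "('m \<Rightarrow> 'k::zero) \<Rightarrow> nat \<Rightarrow> 'm \<Rightarrow> 'k" where
  "incl f n = (if n = 0 then f else (\<lambda>_. 0))"

definition gen_t :: "nat \<Rightarrow> 'm \<Rightarrow> 'k::zero_neq_one" where
  "gen_t n p = (if n = 1 then 1 else 0)"

end

theory Submission
  imports Defs "HOL-Library.Function_Algebras"
begin

text \<open>
  The proof has an algebraic and a geometric half.

  Algebra. Let \<open>d\<close> be a first order calculus with 1-forms \<open>Om\<close> on a commutative algebra \<open>S\<close>, and
  \<open>\<delta>\<close> a derivation of \<open>S\<close>. Adjoin \<open>t\<close> with \<open>[f, t] = \<delta> f\<close>, and prescribe \<open>[w, t] = D w\<close> on 1-forms,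
  \<open>[f, dt] = l df\<close> and \<open>[dt, t] = e - l dt\<close> with \<open>e\<close> a 1-form commuting with functions. Since \<open>[\<cdot>, t]\<close> is a
  derivation, \<open>D\<close> must satisfy Leibniz rules over \<open>\<delta>\<close> for both actions of \<open>S\<close>; and applying \<open>d\<close> to
  \<open>[f, t] = \<delta> f\<close> forces \<open>D (d f) + l df = d (\<delta> f)\<close>. These conditions, the axioms of the locale
  \<open>calculus_derivation\<close>, are also sufficient. On \<open>N = Om \<oplus> S dt\<close> the relation \<open>dt f = f dt - l df\<close>
  defines a right action (associative by the Leibniz rule of \<open>d\<close>), and \<open>[\<cdot>, t]\<close> extends to \<open>N\<close>
  (\<open>D_raN\<close>). Polynomials in \<open>t\<close> with coefficients in \<open>N\<close> on the left then form a bimodule over the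
  skew polynomials \<open>S[t; \<delta>]\<close>, where \<open>t\<close> acts from the left by \<open>v t\<^sup>n \<mapsto> v t\<^sup>n\<^sup>+\<^sup>1 - D v t\<^sup>n\<close>
  (\<open>act_act\<close>, \<open>ract_ract\<close>, \<open>act_ract\<close>). The differential is determined by its values on \<open>f\<close> and \<open>t\<close>;
  its Leibniz rule (\<open>dW_mult\<close>) follows by induction on degrees, and the only case with content is
  the product \<open>t f\<close>, which is the condition above once more.

  Geometry. For \<open>\<delta> = l \<tau>\<close> and the commutators of the theorem, the right Leibniz rule for \<open>D\<close>
  amounts to the fact that the inverse metric has weight \<open>-(1 + \<alpha>)\<close> under \<open>\<tau>\<close>
  (\<open>apply_field_inv_metric\<close>), and the condition on \<open>D (d f)\<close> to

    \<open>\<Delta> (\<tau> f) = \<tau> (\<Delta> f) + (1 + \<alpha>) \<Delta> f - (n - 2)/2 (d\<alpha>, df) - (L\<^sub>\<tau> \<zeta>*, df)\<close>,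
    where \<open>\<Delta> = \<Delta>\<^sub>L\<^sub>B + \<zeta>\<close>.

  The part of this for \<open>\<zeta>\<close> is the weight of the inverse metric applied to \<open>(\<zeta>*, df) = \<zeta> f\<close>. For
  \<open>\<Delta>\<^sub>L\<^sub>B\<close>, the weight gives \<open>[\<tau>, grad f] = grad (\<tau> f) - (1 + \<alpha>) grad f\<close>. Taking divergences and using
  \<open>div [\<tau>, X] = \<tau> (div X) - X (div \<tau>)\<close> and \<open>div \<tau> = n (1 + \<alpha>)/2\<close> yields the claim
  (\<open>laplace_beltrami_conformal\<close>).

  Fields are families of components, so these identities are proved in one chart, as identities
  between matrices and directional derivatives. That the operators involved do not depend on the
  chart, and hence produce smooth functions and forms, rests on the chain rule and on the symmetry
  of second derivatives.
\<close>

section \<open>Smooth functions on open sets\<close>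

text \<open>
  Since \<open>S\<close> is open, derivatives at its points only see the values on \<open>S\<close>.
\<close>

lemma Ck_on_cong:
  assumes "open S" "\<And>x. x \<in> S \<Longrightarrow> f x = h x"
  shows "Ck_on k S f \<longleftrightarrow> Ck_on k S h"
proof -
  have *: "Ck_on k S h'" if "Ck_on k S f'" "\<And>x. x \<in> S \<Longrightarrow> f' x = h' x" for f' h'
    using that
  proof (induction k arbitrary: f' h')
    case 0
    then show ?case using continuous_on_cong by fastforce
  next
    case (Suc k)
    have 1: "h' differentiable (at x)" if "x \<in> S" for x
    proof -
      have "f' differentiable (at x)" using Suc that by simp
      then show ?thesis unfolding differentiable_def
        using has_derivative_transform_within_open[OF _ assms(1) that] Suc(3) by metis
    qed
    have 2: "frechet_derivative f' (at x) = frechet_derivative h' (at x)" if "x \<in> S" for x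
      using frechet_derivative_transform_within_open[OF _ assms(1) that, of f' h'] Suc that by simp
    show ?case unfolding Ck_on.simps
    proof (intro conjI ballI allI 1)
      fix v show "Ck_on k S (\<lambda>x. frechet_derivative h' (at x) v)"
        by (rule Suc.IH[of "\<lambda>x. frechet_derivative f' (at x) v"]) (use Suc 2 in auto)
    qed
  qed
  show ?thesis using *[of f h] *[of h f] assms(2) by metis
qed

lemma Ck_on_SucD: "Ck_on (Suc k) S f \<Longrightarrow> Ck_on k S f"
proof (induction k arbitrary: f)
  case 0
  then show ?case
    by (auto intro!: differentiable_imp_continuous_on
        simp: differentiable_on_def differentiable_at_withinI)
qed auto

lemma Ck_on_const: "Ck_on k S (\<lambda>x. a)"
proof (induction k arbitrary: a)
  case (Suc k)
  then show ?case by simp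
qed simp

text \<open>
  Any explicit derivative may be used in place of \<open>frechet_derivative\<close>, so the product, chain and quotient
  rules give the closure properties below by induction on the order.
\<close>

lemma Ck_on_SucI:
  assumes "open S" "\<And>x. x \<in> S \<Longrightarrow> (f has_derivative f' x) (at x)" "\<And>v. Ck_on k S (\<lambda>x. f' x v)"
  shows "Ck_on (Suc k) S f"
proof -
  have "frechet_derivative f (at x) = f' x" if "x \<in> S" for x
    using frechet_derivative_at[OF assms(2)[OF that]] by simp
  then show ?thesis
    using assms Ck_on_cong[OF assms(1), of "\<lambda>x. frechet_derivative f (at x) v" "\<lambda>x. f' x v" k for v]
    by (auto simp: differentiable_def)
qed

lemma Ck_on_SucE:
  assumes "Ck_on (Suc k) S f" "x \<in> S"
  shows "(f has_derivative frechet_derivative f (at x)) (at x)"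
  using assms by (simp add: frechet_derivative_works)

lemma Ck_on_add:
  assumes "open S" "Ck_on k S f" "Ck_on k S h"
  shows "Ck_on k S (\<lambda>x. f x + h x)"
  using assms(2,3)
proof (induction k arbitrary: f h)
  case (Suc k)
  show ?case
    by (rule Ck_on_SucI[OF assms(1) has_derivative_add[OF Ck_on_SucE[OF Suc(2)] Ck_on_SucE[OF Suc(3)]]])
      (use Suc in auto)
qed (auto intro: continuous_intros)

lemma Ck_on_mult:
  fixes f h :: "_ \<Rightarrow> 'b::real_normed_algebra"
  assumes "open S" "Ck_on k S f" "Ck_on k S h"
  shows "Ck_on k S (\<lambda>x. f x * h x)"
  using assms(2,3)
proof (induction k arbitrary: f h)
  case (Suc k)
  show ?case
    by (rule Ck_on_SucI[OF assms(1) has_derivative_mult[OF Ck_on_SucE[OF Suc(2)] Ck_on_SucE[OF Suc(3)]]])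
      (use Suc Ck_on_SucD[OF Suc(2)] Ck_on_SucD[OF Suc(3)] in
        \<open>auto intro!: Ck_on_add[OF assms(1)] Suc.IH\<close>)
qed (auto intro: continuous_intros)

lemma Ck_on_bounded_linear:
  assumes "open S" "bounded_linear F" "Ck_on k S f"
  shows "Ck_on k S (\<lambda>x. F (f x))"
  using assms(3)
proof (induction k arbitrary: f)
  case 0
  then show ?case using bounded_linear.continuous_on[OF assms(2)] by simp
next
  case (Suc k)
  show ?case
    by (rule Ck_on_SucI[OF assms(1) bounded_linear.has_derivative[OF assms(2) Ck_on_SucE[OF Suc(2)]]])
      (use Suc in auto)
qed

lemma Ck_on_scaleR:
  assumes "open S" "Ck_on k S r" "Ck_on k S f"
  shows "Ck_on k S (\<lambda>x. r x *\<^sub>R f x)"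
  using assms(2,3)
proof (induction k arbitrary: r f)
  case (Suc k)
  show ?case
    by (rule Ck_on_SucI[OF assms(1) has_derivative_scaleR[OF Ck_on_SucE[OF Suc(2)] Ck_on_SucE[OF Suc(3)]]])
      (use Suc Ck_on_SucD[OF Suc(2)] Ck_on_SucD[OF Suc(3)] in
        \<open>auto intro!: Ck_on_add[OF assms(1)] Suc.IH\<close>)
qed (auto intro: continuous_intros)

lemma Ck_on_sum:
  assumes "open S" "\<And>i. i \<in> I \<Longrightarrow> Ck_on k S (f i)"
  shows "Ck_on k S (\<lambda>x. \<Sum>i\<in>I. f i x)"
  using assms(2)
  by (induction I rule: infinite_finite_induct) (auto intro: Ck_on_const Ck_on_add[OF assms(1)])

lemma Ck_on_inverse:
  fixes f :: "_ \<Rightarrow> 'b::real_normed_field"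
  assumes "open S" "Ck_on k S f" "\<And>x. x \<in> S \<Longrightarrow> f x \<noteq> 0"
  shows "Ck_on k S (\<lambda>x. inverse (f x))"
  using assms(2)
proof (induction k)
  case 0
  then show ?case using assms(3) by (auto intro: continuous_intros)
next
  case (Suc k)
  have m: "Ck_on k S (\<lambda>x. - (inverse (f x) * frechet_derivative f (at x) v * inverse (f x)))" for v
    by (intro Ck_on_bounded_linear[OF assms(1) bounded_linear_minus[OF bounded_linear_ident]]
        Ck_on_mult[OF assms(1)]) (use Suc Ck_on_SucD in auto)
  show ?case
    by (rule Ck_on_SucI[OF assms(1) Deriv.has_derivative_inverse[OF assms(3) Ck_on_SucE[OF Suc(2)]] m]) auto
qed

lemma smooth_on_cong:
  "open S \<Longrightarrow> (\<And>x. x \<in> S \<Longrightarrow> f x = h x) \<Longrightarrow> smooth_on S f \<longleftrightarrow> smooth_on S h"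
  unfolding smooth_on_def using Ck_on_cong by metis

lemma smooth_on_differentiable: "smooth_on S f \<Longrightarrow> x \<in> S \<Longrightarrow> f differentiable (at x)"
  unfolding smooth_on_def using Ck_on.simps(2) by blast

lemma smooth_on_frechet_derivative:
  "smooth_on S f \<Longrightarrow> smooth_on S (\<lambda>x. frechet_derivative f (at x) v)"
  unfolding smooth_on_def using Ck_on.simps(2) by blast

lemma Ck_on_subset: "Ck_on k S f \<Longrightarrow> T \<subseteq> S \<Longrightarrow> Ck_on k T f"
  by (induction k arbitrary: f) (auto intro: continuous_on_subset)

lemma smooth_on_subset: "smooth_on S f \<Longrightarrow> T \<subseteq> S \<Longrightarrow> smooth_on T f"
  unfolding smooth_on_def using Ck_on_subset by blast

section \<open>Symmetry of second derivatives\<close>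

text \<open>
  The difference \<open>f (\<cdot> + s w) - f (\<cdot>)\<close> changes along the segment from \<open>x\<close> to \<open>x + s v\<close> at the rate \<open>s\<close> times a
  difference of derivatives in direction \<open>v\<close>, and the latter is \<open>s G w + o(s)\<close>. The mean value inequality
  turns this into an expansion of the second difference.
\<close>

lemma second_difference_bound:
  fixes f :: "'a::real_normed_vector \<Rightarrow> 'b::real_normed_vector"
  assumes S: "open S" "x \<in> S" and f: "\<And>y. y \<in> S \<Longrightarrow> (f has_derivative f' y) (at y)"
    and G: "((\<lambda>y. f' y v) has_derivative G) (at x)" and e: "e > 0"
  shows "\<exists>d>0. \<forall>s. 0 < s \<and> s < d \<longrightarrow>
    norm (f (x + s *\<^sub>R v + s *\<^sub>R w) - f (x + s *\<^sub>R v) - f (x + s *\<^sub>R w) + f x - s\<^sup>2 *\<^sub>R G w) \<le> e * s\<^sup>2"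
proof -
  interpret G: bounded_linear G using G by (rule has_derivative_bounded_linear)
  \<comment> \<open>All displacements below have norm at most \<open>s K\<close>; the summand \<open>1\<close> makes \<open>K\<close> positive.\<close>
  define K where "K = 2 * norm v + norm w + 1"
  have K: "K > 0" by (simp add: K_def add_nonneg_pos)
  obtain r where r: "r > 0" "ball x r \<subseteq> S" using S openE by blast
  obtain d1 where d1: "d1 > 0" "\<And>y. norm (y - x) < d1 \<Longrightarrow>
      norm (f' y v - f' x v - G (y - x)) \<le> (e / K) * norm (y - x)"
    using G[unfolded has_derivative_at_alt] e K by (metis divide_pos_pos)
  have ballS: "x + u \<in> S" if "norm u < r" for u
    using subsetD[OF r(2), of "x + u"] that by (simp add: dist_norm)
  define d where "d = min r d1 / K"
  have "d > 0" using r d1 K by (simp add: d_def)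
  moreover have "norm (f (x + s *\<^sub>R v + s *\<^sub>R w) - f (x + s *\<^sub>R v) - f (x + s *\<^sub>R w) + f x - s\<^sup>2 *\<^sub>R G w) \<le> e * s\<^sup>2"
    if s: "0 < s" "s < d" for s
  proof -
    have sK: "s * K < r" "s * K < d1" using s K by (auto simp: d_def field_simps min_def split: if_splits)
    define h where "h t = f (x + (t * s) *\<^sub>R v + s *\<^sub>R w) - f (x + (t * s) *\<^sub>R v) - (t * s\<^sup>2) *\<^sub>R G w" for t :: real
    define h' where "h' t = s *\<^sub>R (f' (x + (t * s) *\<^sub>R v + s *\<^sub>R w) v - f' (x + (t * s) *\<^sub>R v) v - s *\<^sub>R G w)" for t :: real
    have nb1: "norm ((t * s) *\<^sub>R v) \<le> s * norm v" if "t \<in> {0..1}" for t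
      using that s by (simp add: abs_mult mult_right_mono mult_left_le_one_le)
    have nb2: "norm ((t * s) *\<^sub>R v + s *\<^sub>R w) \<le> s * norm v + s * norm w" if "t \<in> {0..1}" for t
      using norm_triangle_ineq[of "(t * s) *\<^sub>R v" "s *\<^sub>R w"] nb1[OF that] s by simp
    have inS: "x + (t * s) *\<^sub>R v + s *\<^sub>R w \<in> S" "x + (t * s) *\<^sub>R v \<in> S" if "t \<in> {0..1}" for t
    proof -
      have "s * norm v + s * norm w \<le> s * K" "s * norm v \<le> s * K"
        using s by (auto simp: K_def algebra_simps)
      then have "norm ((t * s) *\<^sub>R v + s *\<^sub>R w) < r" "norm ((t * s) *\<^sub>R v) < r"
        using nb1[OF that] nb2[OF that] sK by linarith+
      then show "x + (t * s) *\<^sub>R v + s *\<^sub>R w \<in> S" "x + (t * s) *\<^sub>R v \<in> S"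
        using ballS by (simp_all only: add.assoc)
    qed
    have der: "(h has_derivative (\<lambda>u. u *\<^sub>R h' t)) (at t within {0..1})" if t: "t \<in> {0..1}" for t
    proof -
      have l1: "f' (x + (t * s) *\<^sub>R v + s *\<^sub>R w) ((u * s) *\<^sub>R v) = (u * s) *\<^sub>R f' (x + (t * s) *\<^sub>R v + s *\<^sub>R w) v" for u
        using linear_simps(5)[OF has_derivative_bounded_linear[OF f[OF inS(1)[OF t]]]] .
      have l2: "f' (x + (t * s) *\<^sub>R v) ((u * s) *\<^sub>R v) = (u * s) *\<^sub>R f' (x + (t * s) *\<^sub>R v) v" for u
        using linear_simps(5)[OF has_derivative_bounded_linear[OF f[OF inS(2)[OF t]]]] .
      have a1: "((\<lambda>t. x + (t * s) *\<^sub>R v + s *\<^sub>R w) has_derivative (\<lambda>u. (u * s) *\<^sub>R v)) (at t within {0..1})"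
        and a2: "((\<lambda>t. x + (t * s) *\<^sub>R v) has_derivative (\<lambda>u. (u * s) *\<^sub>R v)) (at t within {0..1})"
        by (auto intro!: derivative_eq_intros)
      note b1 = has_derivative_compose[OF a1 f[OF inS(1)[OF t]]]
      note b2 = has_derivative_compose[OF a2 f[OF inS(2)[OF t]]]
      have "(h has_derivative (\<lambda>u. f' (x + (t * s) *\<^sub>R v + s *\<^sub>R w) ((u * s) *\<^sub>R v)
           - f' (x + (t * s) *\<^sub>R v) ((u * s) *\<^sub>R v) - (u * s\<^sup>2) *\<^sub>R G w)) (at t within {0..1})"
        unfolding h_def
        by (intro has_derivative_diff b1 b2) (auto intro!: derivative_eq_intros)
      then show ?thesis by (rule back_subst[of "\<lambda>F. (h has_derivative F) (at t within {0..1})"])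
          (auto simp: h'_def l1 l2 scaleR_diff_right power2_eq_square)
    qed
    have bnd: "norm (h' t) \<le> e * s\<^sup>2" if t: "t \<in> {0..1}" for t
    proof -
      let ?a = "(t * s) *\<^sub>R v + s *\<^sub>R w" and ?b = "(t * s) *\<^sub>R v"
      have "s * norm v + s * norm w \<le> s * K" "s * norm v \<le> s * K"
        using s by (auto simp: K_def algebra_simps)
      then have lt: "norm ?a < d1" "norm ?b < d1" using nb1[OF t] nb2[OF t] sK by linarith+
      have A: "norm (f' (x + ?a) v - f' x v - G ?a) \<le> (e / K) * norm ?a"
        and B: "norm (f' (x + ?b) v - f' x v - G ?b) \<le> (e / K) * norm ?b"
        using d1(2)[of "x + ?a"] d1(2)[of "x + ?b"] lt by auto
      have "f' (x + ?a) v - f' (x + ?b) v - s *\<^sub>R G w =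
          (f' (x + ?a) v - f' x v - G ?a) - (f' (x + ?b) v - f' x v - G ?b)"
        by (simp add: G.add G.scaleR)
      then have "norm (f' (x + ?a) v - f' (x + ?b) v - s *\<^sub>R G w) \<le> (e / K) * norm ?a + (e / K) * norm ?b"
        using order_trans[OF norm_triangle_ineq4 add_mono[OF A B]] by metis
      also have "\<dots> = (e / K) * (norm ?a + norm ?b)" by (simp add: distrib_left)
      also have "\<dots> \<le> (e / K) * (s * K)"
        using nb1[OF t] nb2[OF t] e K s
        by (intro mult_left_mono) (auto simp: K_def algebra_simps)
      also have "\<dots> = e * s" using K by simp
      finally have "norm (h' t) \<le> s * (e * s)"
        using s unfolding h'_def by (simp add: add.assoc mult_left_mono)
      then show ?thesis by (simp add: power2_eq_square mult_ac)
    qed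
    have "norm (h 1 - h 0) \<le> (e * s\<^sup>2) * norm (1 - 0 :: real)"
    proof (rule differentiable_bound[OF _ der])
      show "onorm (\<lambda>u. u *\<^sub>R h' t) \<le> e * s\<^sup>2" if "t \<in> {0..1}" for t
        using bnd[OF that] by (intro onorm_le) (metis mult.commute mult_left_mono norm_ge_zero norm_scaleR real_norm_def)
    qed auto
    then show ?thesis by (simp add: h_def algebra_simps)
  qed
  ultimately show ?thesis by blast
qed

text \<open>
  Schwarz's theorem: the second difference is symmetric in \<open>v\<close> and \<open>w\<close>, so its expansions with leading
  terms \<open>s\<^sup>2 G w\<close> and \<open>s\<^sup>2 H v\<close> agree.
\<close>

lemma second_derivative_symmetric:
  fixes f :: "'a::real_normed_vector \<Rightarrow> 'b::real_normed_vector"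
  assumes S: "open S" "x \<in> S" and f: "\<And>y. y \<in> S \<Longrightarrow> (f has_derivative f' y) (at y)"
    and G: "((\<lambda>y. f' y v) has_derivative G) (at x)"
    and H: "((\<lambda>y. f' y w) has_derivative H) (at x)"
  shows "G w = H v"
proof -
  have "norm (G w - H v) \<le> e" if e: "e > 0" for e
  proof -
    have e2: "e / 2 > 0" using e by simp
    obtain d1 where d1: "d1 > 0" "\<And>s. 0 < s \<Longrightarrow> s < d1 \<Longrightarrow>
        norm (f (x + s *\<^sub>R v + s *\<^sub>R w) - f (x + s *\<^sub>R v) - f (x + s *\<^sub>R w) + f x - s\<^sup>2 *\<^sub>R G w) \<le> (e/2) * s\<^sup>2"
      using second_difference_bound[OF S f G e2, of w] by blast
    obtain d2 where d2: "d2 > 0" "\<And>s. 0 < s \<Longrightarrow> s < d2 \<Longrightarrow>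
        norm (f (x + s *\<^sub>R w + s *\<^sub>R v) - f (x + s *\<^sub>R w) - f (x + s *\<^sub>R v) + f x - s\<^sup>2 *\<^sub>R H v) \<le> (e/2) * s\<^sup>2"
      using second_difference_bound[OF S f H e2, of v] by blast
    define s where "s = min d1 d2 / 2"
    have s: "0 < s" "s < d1" "s < d2" using d1(1) d2(1) by (auto simp: s_def)
    let ?D = "f (x + s *\<^sub>R v + s *\<^sub>R w) - f (x + s *\<^sub>R v) - f (x + s *\<^sub>R w) + f x"
    have "norm ((?D - s\<^sup>2 *\<^sub>R H v) - (?D - s\<^sup>2 *\<^sub>R G w)) \<le> (e/2) * s\<^sup>2 + (e/2) * s\<^sup>2"
    proof (rule order_trans[OF norm_triangle_ineq4 add_mono])
      show "norm (?D - s\<^sup>2 *\<^sub>R G w) \<le> (e/2) * s\<^sup>2" by (rule d1(2)[OF s(1,2)])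
      have "f (x + s *\<^sub>R w + s *\<^sub>R v) - f (x + s *\<^sub>R w) - f (x + s *\<^sub>R v) + f x = ?D"
        by (simp only: add.commute add.left_commute diff_diff_eq add.assoc)
      then show "norm (?D - s\<^sup>2 *\<^sub>R H v) \<le> (e/2) * s\<^sup>2" using d2(2)[OF s(1,3)] by metis
    qed
    moreover have "(?D - s\<^sup>2 *\<^sub>R H v) - (?D - s\<^sup>2 *\<^sub>R G w) = s\<^sup>2 *\<^sub>R (G w - H v)"
      by (simp add: algebra_simps)
    ultimately have "s\<^sup>2 * norm (G w - H v) \<le> s\<^sup>2 * e" by (simp add: mult.commute)
    then show ?thesis using s(1) by simp
  qed
  then have "norm (G w - H v) \<le> 0" using dense_ge by blast
  then show ?thesis by simp
qed

section \<open>Calculus in a coordinate chart\<close>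

text \<open>
  The calculus of partial derivatives rests on these two properties of a chart. They are inherited by
  restrictions to open subsets, so that the same rules apply on overlaps of charts.
\<close>

definition coord :: "('m, 'n::finite) chart \<Rightarrow> bool" where
  "coord c \<longleftrightarrow> inj_on (snd c) (fst c) \<and> open (snd c ` fst c)"

lemma smooth_in_cong:
  assumes "coord c" "\<And>q. q \<in> fst c \<Longrightarrow> f q = h q"
  shows "smooth_in c f \<longleftrightarrow> smooth_in c h"
  unfolding smooth_in_def
  by (rule smooth_on_cong) (use assms in \<open>auto simp: coord_def\<close>)

lemma smooth_in_const: "smooth_in c (\<lambda>q. a)"
  using Ck_on_const by (auto simp: smooth_in_def smooth_on_def o_def)

lemma smooth_in_add: "coord c \<Longrightarrow> smooth_in c f \<Longrightarrow> smooth_in c h \<Longrightarrow> smooth_in c (\<lambda>q. f q + h q)"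
  unfolding smooth_in_def smooth_on_def o_def coord_def by (intro allI Ck_on_add) auto

lemma smooth_in_mult:
  fixes f h :: "_ \<Rightarrow> 'b::real_normed_algebra"
  shows "coord c \<Longrightarrow> smooth_in c f \<Longrightarrow> smooth_in c h \<Longrightarrow> smooth_in c (\<lambda>q. f q * h q)"
  unfolding smooth_in_def smooth_on_def o_def coord_def by (intro allI Ck_on_mult) auto

lemma smooth_in_bounded_linear:
  "coord c \<Longrightarrow> bounded_linear F \<Longrightarrow> smooth_in c f \<Longrightarrow> smooth_in c (\<lambda>q. F (f q))"
  using Ck_on_bounded_linear[of "snd c ` fst c" F _ "f \<circ> inv_into (fst c) (snd c)"]
  by (simp add: smooth_in_def smooth_on_def coord_def o_def)

lemma smooth_in_inverse:
  fixes f :: "_ \<Rightarrow> 'b::real_normed_field"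
  assumes "coord c" "smooth_in c f" "\<And>q. q \<in> fst c \<Longrightarrow> f q \<noteq> 0"
  shows "smooth_in c (\<lambda>q. inverse (f q))"
proof -
  have "f (inv_into (fst c) (snd c) x) \<noteq> 0" if "x \<in> snd c ` fst c" for x
    using assms(3) inv_into_into[OF that] by blast
  then show ?thesis
    using Ck_on_inverse[of "snd c ` fst c" _ "f \<circ> inv_into (fst c) (snd c)"] assms(1,2)
    by (simp add: smooth_in_def smooth_on_def coord_def o_def)
qed

lemma smooth_in_minus: "coord c \<Longrightarrow> smooth_in c f \<Longrightarrow> smooth_in c (\<lambda>q. - f q)"
  by (rule smooth_in_bounded_linear[OF _ bounded_linear_minus[OF bounded_linear_ident]])

lemma smooth_in_diff: "coord c \<Longrightarrow> smooth_in c f \<Longrightarrow> smooth_in c h \<Longrightarrow> smooth_in c (\<lambda>q. f q - h q)"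
  using smooth_in_add[of c f "\<lambda>q. - h q"] smooth_in_minus[of c h] by simp

lemma smooth_in_of_real:
  "coord c \<Longrightarrow> smooth_in c f \<Longrightarrow> smooth_in c (\<lambda>q. of_real (f q) :: 'b::{real_normed_algebra_1})"
  by (rule smooth_in_bounded_linear[OF _ bounded_linear_of_real])

lemma smooth_in_sum:
  "coord c \<Longrightarrow> (\<And>i. i \<in> I \<Longrightarrow> smooth_in c (f i)) \<Longrightarrow> smooth_in c (\<lambda>q. \<Sum>i\<in>I. f i q)"
  by (induction I rule: infinite_finite_induct) (auto intro: smooth_in_const smooth_in_add)

lemma smooth_in_prod:
  fixes f :: "_ \<Rightarrow> _ \<Rightarrow> 'b::real_normed_field"
  shows "coord c \<Longrightarrow> (\<And>i. i \<in> I \<Longrightarrow> smooth_in c (f i)) \<Longrightarrow> smooth_in c (\<lambda>q. \<Prod>i\<in>I. f i q)"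
  by (induction I rule: infinite_finite_induct) (auto intro: smooth_in_const smooth_in_mult)

lemmas smooth_in_intros = smooth_in_const smooth_in_add smooth_in_mult smooth_in_minus
  smooth_in_diff smooth_in_of_real smooth_in_sum

lemma smooth_in_has_derivative:
  assumes "coord c" "smooth_in c f" "p \<in> fst c"
  shows "(f \<circ> inv_into (fst c) (snd c) has_derivative
    frechet_derivative (f \<circ> inv_into (fst c) (snd c)) (at (snd c p))) (at (snd c p))"
  using assms smooth_on_differentiable[of "snd c ` fst c" "f \<circ> inv_into (fst c) (snd c)" "snd c p"]
  by (auto simp: frechet_derivative_works smooth_in_def)

lemma pd_eqI:
  assumes "(f \<circ> inv_into (fst c) (snd c) has_derivative F) (at (snd c p))"
  shows "pd c i f p = F (axis i 1)"
  using frechet_derivative_at[OF assms] by (simp add: pd_def)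

lemma pd_cong:
  assumes "coord c" "smooth_in c f" "p \<in> fst c" "\<And>q. q \<in> fst c \<Longrightarrow> f q = h q"
  shows "pd c i f p = pd c i h p"
proof -
  have "(h \<circ> inv_into (fst c) (snd c) has_derivative
    frechet_derivative (f \<circ> inv_into (fst c) (snd c)) (at (snd c p))) (at (snd c p))"
    by (rule has_derivative_transform_within_open[OF smooth_in_has_derivative[OF assms(1-3)], of "snd c ` fst c"])
      (use assms in \<open>auto simp: coord_def\<close>)
  from pd_eqI[OF this] show ?thesis by (simp add: pd_def)
qed

lemma pd_const [simp]: "pd c i (\<lambda>q. a) p = 0"
  by (simp add: pd_def o_def)

lemma pd_add:
  assumes "coord c" "p \<in> fst c" "smooth_in c f" "smooth_in c h"
  shows "pd c i (\<lambda>q. f q + h q) p = pd c i f p + pd c i h p"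
  using pd_eqI[where f="\<lambda>q. f q + h q", unfolded o_def, OF has_derivative_add,
      OF smooth_in_has_derivative[OF assms(1,3,2), unfolded o_def]
      smooth_in_has_derivative[OF assms(1,4,2), unfolded o_def]]
  by (simp add: pd_def o_def)

lemma pd_mult:
  fixes f h :: "_ \<Rightarrow> 'b::real_normed_field"
  assumes "coord c" "p \<in> fst c" "smooth_in c f" "smooth_in c h"
  shows "pd c i (\<lambda>q. f q * h q) p = pd c i f p * h p + f p * pd c i h p"
proof -
  have "inv_into (fst c) (snd c) (snd c p) = p" using assms by (simp add: coord_def)
  then show ?thesis
    using pd_eqI[where f="\<lambda>q. f q * h q", unfolded o_def, OF has_derivative_mult,
        OF smooth_in_has_derivative[OF assms(1,3,2), unfolded o_def]
        smooth_in_has_derivative[OF assms(1,4,2), unfolded o_def]]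
    by (simp add: pd_def o_def)
qed

lemma pd_bounded_linear:
  assumes "coord c" "p \<in> fst c" "smooth_in c f" "bounded_linear F"
  shows "pd c i (\<lambda>q. F (f q)) p = F (pd c i f p)"
  using pd_eqI[where f="\<lambda>q. F (f q)", unfolded o_def, OF bounded_linear.has_derivative[OF assms(4)],
      OF smooth_in_has_derivative[OF assms(1,3,2), unfolded o_def]]
  by (simp add: pd_def o_def)

lemma pd_minus:
  assumes "coord c" "p \<in> fst c" "smooth_in c f"
  shows "pd c i (\<lambda>q. - f q) p = - pd c i f p"
  by (rule pd_bounded_linear[OF assms bounded_linear_minus[OF bounded_linear_ident]])

lemma pd_diff:
  assumes "coord c" "p \<in> fst c" "smooth_in c f" "smooth_in c h"
  shows "pd c i (\<lambda>q. f q - h q) p = pd c i f p - pd c i h p"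
  using pd_add[OF assms(1-3) smooth_in_minus[OF assms(1,4)]] pd_minus[OF assms(1,2,4)] by simp

lemma pd_of_real:
  assumes "coord c" "p \<in> fst c" "smooth_in c f"
  shows "pd c i (\<lambda>q. of_real (f q) :: 'b::real_normed_field) p = of_real (pd c i f p)"
  by (rule pd_bounded_linear[OF assms bounded_linear_of_real])

lemma pd_sum:
  assumes "coord c" "p \<in> fst c" "\<And>j. j \<in> I \<Longrightarrow> smooth_in c (f j)"
  shows "pd c i (\<lambda>q. \<Sum>j\<in>I. f j q) p = (\<Sum>j\<in>I. pd c i (f j) p)"
  using assms(3)
proof (induction I rule: infinite_finite_induct)
  case (insert j I)
  have "smooth_in c (\<lambda>q. \<Sum>j\<in>I. f j q)" by (rule smooth_in_sum[OF assms(1)]) (use insert in auto)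
  then show ?case using insert by (simp add: pd_add[OF assms(1,2)])
qed simp_all

lemma smooth_in_pd:
  assumes "coord c" "smooth_in c f"
  shows "smooth_in c (pd c i f)"
proof -
  have "smooth_on (snd c ` fst c) (\<lambda>x. frechet_derivative (f \<circ> inv_into (fst c) (snd c)) (at x) (axis i 1))"
    using assms(2) smooth_on_frechet_derivative by (auto simp: smooth_in_def)
  then show ?thesis unfolding smooth_in_def
    by (subst smooth_on_cong) (use assms(1) in \<open>auto simp: coord_def pd_def\<close>)
qed

lemma pd_commute:
  assumes "coord c" "smooth_in c f" "p \<in> fst c"
  shows "pd c i (pd c j f) p = pd c j (pd c i f) p"
proof -
  let ?S = "snd c ` fst c" and ?f = "f \<circ> inv_into (fst c) (snd c)"
  have S: "open ?S" "snd c p \<in> ?S" using assms by (auto simp: coord_def)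
  have f: "(?f has_derivative frechet_derivative ?f (at y)) (at y)" if "y \<in> ?S" for y
    using assms(2) smooth_on_differentiable that by (auto simp: smooth_in_def frechet_derivative_works)
  have e: "((\<lambda>y. frechet_derivative ?f (at y) v) has_derivative
      frechet_derivative (\<lambda>y. frechet_derivative ?f (at y) v) (at (snd c p))) (at (snd c p))" for v
    using assms(2) smooth_on_differentiable[OF smooth_on_frechet_derivative S(2), of ?f v]
    by (auto simp: smooth_in_def frechet_derivative_works)
  have pd2: "pd c i (pd c j f) p =
      frechet_derivative (\<lambda>y. frechet_derivative ?f (at y) (axis j 1)) (at (snd c p)) (axis i 1)" for i j
    by (rule pd_eqI[OF has_derivative_transform_within_open[OF e S]])
      (use assms(1) in \<open>auto simp: coord_def pd_def\<close>)
  show ?thesis unfolding pd2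
    by (rule second_derivative_symmetric[OF S f e e])
qed

text \<open>
  Transition functions and their derivatives are smooth on overlaps only; the restricted chart keeps the
  coordinates of \<open>c\<close>.
\<close>

definition overlap :: "('m, 'n) chart \<Rightarrow> ('m, 'n) chart \<Rightarrow> ('m, 'n) chart" where
  "overlap c d = (fst c \<inter> fst d, snd c)"

lemma overlap_simps [simp]: "fst (overlap c d) = fst c \<inter> fst d" "snd (overlap c d) = snd c"
  by (simp_all add: overlap_def)

lemma inv_into_overlap:
  "coord c \<Longrightarrow> x \<in> snd c ` (fst c \<inter> fst d) \<Longrightarrow> inv_into (fst c \<inter> fst d) (snd c) x = inv_into (fst c) (snd c) x"
  by (auto simp: coord_def inj_on_Int)

lemma smooth_in_overlap:
  assumes "coord c" "coord (overlap c d)" "smooth_in c f"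
  shows "smooth_in (overlap c d) f"
proof -
  have "smooth_on (snd c ` (fst c \<inter> fst d)) (f \<circ> inv_into (fst c) (snd c))"
    using assms(3) by (auto simp: smooth_in_def intro: smooth_on_subset)
  then show ?thesis unfolding smooth_in_def overlap_simps
    by (subst smooth_on_cong) (use assms inv_into_overlap[OF assms(1)] in \<open>auto simp: coord_def\<close>)
qed

lemma has_derivative_overlap:
  assumes "coord c" "coord (overlap c d)" "smooth_in (overlap c d) f" "p \<in> fst c \<inter> fst d"
  shows "(f \<circ> inv_into (fst c) (snd c) has_derivative
    frechet_derivative (f \<circ> inv_into (fst c \<inter> fst d) (snd c)) (at (snd c p))) (at (snd c p))"
  by (rule has_derivative_transform_within_open[OF smooth_in_has_derivative[OF assms(2,3), simplified overlap_simps],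
        of _ "snd c ` (fst c \<inter> fst d)"])
    (use assms inv_into_overlap[OF assms(1)] in \<open>auto simp: coord_def\<close>)

lemma pd_overlap:
  assumes "coord c" "coord (overlap c d)" "smooth_in (overlap c d) f" "p \<in> fst c \<inter> fst d"
  shows "pd c i f p = pd (overlap c d) i f p"
  using pd_eqI[OF has_derivative_overlap[OF assms]] by (simp add: pd_def)

lemma smooth_in_pd_overlap:
  assumes "coord c" "coord (overlap c d)" "smooth_in (overlap c d) f"
  shows "smooth_in (overlap c d) (pd c i f)"
  using smooth_in_pd[OF assms(2,3)] smooth_in_cong[OF assms(2), of "pd c i f" "pd (overlap c d) i f"]
    pd_overlap[OF assms] by simp

section \<open>Change of charts\<close>

lemma has_derivative_vec_nthI:
  fixes f :: "'a::real_normed_vector \<Rightarrow> real ^ 'n::finite"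
  assumes "\<And>j. ((\<lambda>x. f x $ j) has_derivative (\<lambda>h. F h $ j)) (at a within S)"
  shows "(f has_derivative F) (at a within S)"
  using assms
  by (auto simp: has_derivative_componentwise_within[of f] Basis_vec_def inner_axis)

locale manifold =
  fixes A :: "('m::topological_space, 'n::finite) chart set"
  assumes atlas: "smooth_atlas A"
begin

lemma atlas_chart:
  assumes "c \<in> A"
  shows "open (fst c)" "open (snd c ` fst c)"
    "homeomorphism (fst c) (snd c ` fst c) (snd c) (inv_into (fst c) (snd c))"
  using atlas assms by (cases c; fastforce simp: smooth_atlas_def)+

lemma coord: "c \<in> A \<Longrightarrow> coord c"
  using atlas_chart(2)[of c] homeomorphism_apply1[OF atlas_chart(3)[of c]]
  by (auto simp: coord_def intro: inj_on_inverseI)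

lemma coord_overlap:
  assumes "c \<in> A" "d \<in> A"
  shows "coord (overlap c d)"
proof -
  note hom = atlas_chart(3)[OF assms(1)] atlas_chart(2)[OF assms(1)] atlas_chart(1)[OF assms(2)]
  have "openin (top_of_set (fst c)) (fst c \<inter> fst d)" using hom(3) by (simp add: openin_open_Int)
  then have "openin (top_of_set (snd c ` fst c)) (snd c ` (fst c \<inter> fst d))"
    using homeomorphism_imp_open_map[OF hom(1)] by blast
  then show ?thesis using hom(2) coord[OF assms(1)] openin_open_eq
    by (auto simp: coord_def inj_on_Int)
qed

lemma chart_at: "chart_at A p \<in> A" "p \<in> fst (chart_at A p)"
proof -
  have "\<exists>c. c \<in> A \<and> p \<in> fst c" using atlas by (force simp: smooth_atlas_def)
  from someI_ex[OF this] show "chart_at A p \<in> A" "p \<in> fst (chart_at A p)"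
    by (simp_all add: chart_at_def)
qed

lemma smooth_in_coordinate:
  assumes "c \<in> A" "d \<in> A"
  shows "smooth_in (overlap c d) (\<lambda>q. snd d q $ j)"
proof -
  have "smooth_on (snd c ` (fst c \<inter> fst d)) (snd d \<circ> inv_into (fst c) (snd c))"
    using atlas assms by (cases c; cases d; fastforce simp: smooth_atlas_def)
  then have "smooth_on (snd c ` (fst c \<inter> fst d)) (\<lambda>x. (snd d (inv_into (fst c) (snd c) x)) $ j)"
    using coord_overlap[OF assms]
    unfolding smooth_on_def coord_def by (auto intro!: Ck_on_bounded_linear[OF _ bounded_linear_vec_nth] simp: o_def)
  then show ?thesis unfolding smooth_in_def overlap_simps
    by (subst smooth_on_cong)
      (use coord_overlap[OF assms] inv_into_overlap[OF coord[OF assms(1)]] coord[OF assms(1)] in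
        \<open>auto simp: coord_def\<close>)
qed

text \<open>
  The chain rule for \<open>f\<close> in the coordinates of \<open>d\<close> after the transition map from \<open>c\<close> to \<open>d\<close>. The
  derivative is given with its existence, because differentiability in \<open>c\<close> is part of the claim.
\<close>

lemma has_derivative_change:
  fixes f :: "'m \<Rightarrow> 'b::real_normed_vector"
  assumes cd: "c \<in> A" "d \<in> A" and p: "p \<in> fst c" "p \<in> fst d" and f: "smooth_in (overlap d c) f"
  shows "\<exists>F. (f \<circ> inv_into (fst c) (snd c) has_derivative F) (at (snd c p)) \<and>
    (\<forall>i. F (axis i 1) = (\<Sum>j\<in>UNIV. jac c d p $ j $ i *\<^sub>R pd d j f p))"
proof -
  let ?ic = "inv_into (fst c) (snd c)" and ?id = "inv_into (fst d) (snd d)"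
  let ?S = "snd c ` (fst c \<inter> fst d)"
  have S: "open ?S" "snd c p \<in> ?S" using coord_overlap[OF cd] p by (auto simp: coord_def)
  have ic: "?ic (snd c p) = p" using coord[OF cd(1)] p by (simp add: coord_def)
  have D1: "((\<lambda>x. snd d (?ic x)) has_derivative (\<lambda>h. \<chi> j. frechet_derivative
      ((\<lambda>q. snd d q $ j) \<circ> inv_into (fst c \<inter> fst d) (snd c)) (at (snd c p)) h)) (at (snd c p))"
    (is "(_ has_derivative ?F) _")
  proof (rule has_derivative_vec_nthI, simp only: vec_lambda_beta)
    fix j
    show "((\<lambda>x. snd d (?ic x) $ j) has_derivative frechet_derivative
      ((\<lambda>q. snd d q $ j) \<circ> inv_into (fst c \<inter> fst d) (snd c)) (at (snd c p))) (at (snd c p))"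
      using has_derivative_overlap[OF coord[OF cd(1)] coord_overlap[OF cd] smooth_in_coordinate[OF cd]] p
      by (simp add: o_def)
  qed
  define G where "G = frechet_derivative (f \<circ> inv_into (fst d \<inter> fst c) (snd d)) (at (snd d p))"
  have D2: "(f \<circ> ?id has_derivative G) (at (snd d (?ic (snd c p))))"
    unfolding G_def ic
    using has_derivative_overlap[OF coord[OF cd(2)] coord_overlap[OF cd(2,1)] f] p by simp
  have "((\<lambda>x. (f \<circ> ?id) (snd d (?ic x))) has_derivative (\<lambda>h. G (?F h))) (at (snd c p))"
    by (rule has_derivative_compose[OF D1 D2])
  then have "(f \<circ> ?ic has_derivative (\<lambda>h. G (?F h))) (at (snd c p))"
    by (rule has_derivative_transform_within_open[OF _ S])
      (use coord[OF cd(1)] coord[OF cd(2)] in \<open>auto simp: coord_def\<close>)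
  note D = this
  have "?F (axis i 1) = (\<Sum>j\<in>UNIV. jac c d p $ j $ i *\<^sub>R axis j 1)" for i
    using pd_overlap[OF coord[OF cd(1)] coord_overlap[OF cd] smooth_in_coordinate[OF cd], of p i] p
    by (simp add: jac_def pd_def vec_eq_iff axis_def if_distrib sum.delta cong: if_cong)
  moreover have "G (\<Sum>j\<in>UNIV. jac c d p $ j $ i *\<^sub>R axis j 1) = (\<Sum>j\<in>UNIV. jac c d p $ j $ i *\<^sub>R G (axis j 1))" for i
    using has_derivative_linear[OF D2] by (simp add: linear_sum linear_scale)
  moreover have "pd d j f p = G (axis j 1)" for j
    using pd_eqI[of f d G p] D2 ic by simp
  ultimately show ?thesis using D by auto
qed

lemma pd_change:
  fixes f :: "'m \<Rightarrow> 'b::real_normed_vector"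
  assumes "c \<in> A" "d \<in> A" "p \<in> fst c" "p \<in> fst d" "smooth_in (overlap d c) f"
  shows "pd c i f p = (\<Sum>j\<in>UNIV. jac c d p $ j $ i *\<^sub>R pd d j f p)"
  using has_derivative_change[OF assms] pd_eqI by metis

lemma pd_coordinate:
  assumes "c \<in> A" "p \<in> fst c"
  shows "pd c i (\<lambda>q. snd c q $ j) p = (if j = i then 1 else 0)"
proof -
  have "((\<lambda>q. snd c q $ j) \<circ> inv_into (fst c) (snd c) has_derivative (\<lambda>h. h $ j)) (at (snd c p))"
    by (rule has_derivative_transform_within_open[of "\<lambda>x. x $ j" _ _ _ "snd c ` fst c"])
      (use coord[OF assms(1)] assms(2) in \<open>auto simp: coord_def f_inv_into_f
        intro!: bounded_linear_imp_has_derivative[OF bounded_linear_vec_nth]\<close>)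
  from pd_eqI[OF this] show ?thesis by (simp add: axis_def)
qed

lemma jac_inverse:
  assumes cd: "c \<in> A" "d \<in> A" and p: "p \<in> fst c" "p \<in> fst d"
  shows "jac d c p ** jac c d p = mat 1"
proof -
  have "pd c i (\<lambda>q. snd c q $ k) p = (\<Sum>j\<in>UNIV. jac c d p $ j $ i *\<^sub>R jac d c p $ k $ j)" for i k
    using pd_change[OF cd p smooth_in_coordinate[OF cd(2,1)]] by (simp add: jac_def)
  then show ?thesis
    using pd_coordinate[OF cd(1) p(1)]
    by (simp add: vec_eq_iff matrix_matrix_mult_def mat_def mult.commute)
qed

lemma smooth_in_jac:
  assumes "c \<in> A" "d \<in> A"
  shows "smooth_in (overlap c d) (\<lambda>q. jac c d q $ j $ i)"
  using smooth_in_pd_overlap[OF coord[OF assms(1)] coord_overlap[OF assms] smooth_in_coordinate[OF assms]]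
  by (simp add: jac_def)

text \<open>
  By the chain rule, a partial derivative in \<open>c\<close> is a combination of partial derivatives in \<open>d\<close> with
  smooth coefficients; this reduces order \<open>k + 1\<close> to order \<open>k\<close>.
\<close>

lemma smooth_in_overlap_swap:
  fixes f :: "'m \<Rightarrow> 'b::real_normed_vector"
  assumes cd: "c \<in> A" "d \<in> A" and f: "smooth_in (overlap d c) f"
  shows "smooth_in (overlap c d) f"
proof -
  let ?S = "snd c ` (fst c \<inter> fst d)" and ?ic = "inv_into (fst c) (snd c)"
  have S: "open ?S" using coord_overlap[OF cd] by (simp add: coord_def)
  have ic: "?ic (snd c q) = q" if "q \<in> fst c" for q using that coord[OF cd(1)] by (simp add: coord_def)
  have "Ck_on k ?S (f \<circ> ?ic)" if "smooth_in (overlap d c) f" for k and f :: "'m \<Rightarrow> 'b"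
    using that
  proof (induction k arbitrary: f)
    case 0
    have "(f \<circ> ?ic) differentiable (at x)" if "x \<in> ?S" for x
      using has_derivative_change[OF cd _ _ 0] that unfolding differentiable_def by blast
    then have "(f \<circ> ?ic) differentiable_on ?S"
      by (simp add: differentiable_on_def differentiable_at_withinI)
    then show ?case using differentiable_imp_continuous_on by (simp only: Ck_on.simps)
  next
    case (Suc k)
    have D: "(f \<circ> ?ic has_derivative (\<lambda>h. \<Sum>i\<in>UNIV. h $ i *\<^sub>R
        (\<Sum>j\<in>UNIV. jac c d (?ic x) $ j $ i *\<^sub>R pd d j f (?ic x)))) (at x)" if x: "x \<in> ?S" for x
    proof -
      obtain q where q: "q \<in> fst c" "q \<in> fst d" "x = snd c q" using x by blast
      obtain F where F: "(f \<circ> ?ic has_derivative F) (at x)"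
        "\<And>i. F (axis i 1) = (\<Sum>j\<in>UNIV. jac c d q $ j $ i *\<^sub>R pd d j f q)"
        using has_derivative_change[OF cd q(1,2) Suc.prems] q(3) by blast
      have "F h = (\<Sum>i\<in>UNIV. h $ i *\<^sub>R F (axis i 1))" for h
      proof -
        have "F h = F (\<Sum>i\<in>UNIV. h $ i *\<^sub>R axis i 1)"
          by (simp add: basis_expansion[where 'a=real, unfolded scalar_mult_eq_scaleR])
        also have "\<dots> = (\<Sum>i\<in>UNIV. h $ i *\<^sub>R F (axis i 1))"
          using has_derivative_linear[OF F(1)] by (simp add: linear_sum linear_scale)
        finally show ?thesis .
      qed
      then have "F = (\<lambda>h. \<Sum>i\<in>UNIV. h $ i *\<^sub>R (\<Sum>j\<in>UNIV. jac c d (?ic x) $ j $ i *\<^sub>R pd d j f (?ic x)))"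
        using ic[OF q(1)] q(3) F(2) by auto
      then show ?thesis using F(1) by simp
    qed
    have jac: "Ck_on k ?S (\<lambda>x. jac c d (?ic x) $ j $ i)" for i j
    proof -
      have "smooth_on ?S (\<lambda>x. jac c d (?ic x) $ j $ i)"
        using smooth_in_jac[OF cd, of j i] unfolding smooth_in_def overlap_simps
        by (subst smooth_on_cong[OF S]) (use inv_into_overlap[OF coord[OF cd(1)]] in auto)
      then show ?thesis by (simp add: smooth_on_def)
    qed
    have "Ck_on k ?S (\<lambda>x. \<Sum>i\<in>UNIV. h $ i *\<^sub>R (\<Sum>j\<in>UNIV. jac c d (?ic x) $ j $ i *\<^sub>R pd d j f (?ic x)))" for h
    proof (intro Ck_on_sum[OF S] Ck_on_bounded_linear[OF S bounded_linear_scaleR_right] Ck_on_scaleR[OF S] jac)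
      fix j
      have "smooth_in (overlap d c) (pd d j f)"
        by (rule smooth_in_pd_overlap[OF coord[OF cd(2)] coord_overlap[OF cd(2,1)] Suc.prems])
      from Suc.IH[OF this] show "Ck_on k ?S (\<lambda>x. pd d j f (?ic x))" by (simp add: o_def)
    qed
    then show ?case by (intro Ck_on_SucI[OF S D]) auto
  qed
  from this[OF f] have "smooth_on ?S (f \<circ> ?ic)" by (simp add: smooth_on_def)
  then show ?thesis unfolding smooth_in_def overlap_simps
    by (subst smooth_on_cong[OF S]) (use inv_into_overlap[OF coord[OF cd(1)]] in auto)
qed

lemma pd_jac_symmetric:
  assumes "c \<in> A" "d \<in> A" "p \<in> fst c \<inter> fst d"
  shows "pd (overlap c d) k (\<lambda>q. jac c d q $ j $ i) p = pd (overlap c d) i (\<lambda>q. jac c d q $ j $ k) p"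
proof -
  have "pd (overlap c d) k (\<lambda>q. jac c d q $ j $ i) p = pd (overlap c d) k (pd (overlap c d) i (\<lambda>q. snd d q $ j)) p" for i k
    using pd_overlap[OF coord[OF assms(1)] coord_overlap[OF assms(1,2)] smooth_in_coordinate[OF assms(1,2)]]
    by (intro pd_cong[OF coord_overlap[OF assms(1,2)] smooth_in_jac[OF assms(1,2)]]) (use assms(3) in \<open>auto simp: jac_def\<close>)
  then show ?thesis
    using pd_commute[OF coord_overlap[OF assms(1,2)] smooth_in_coordinate[OF assms(1,2)]] assms(3) by simp
qed

end

section \<open>Matrix calculus in a chart\<close>

text \<open>
  Charts and metrics are real, fields have components in \<open>'k\<close>. Real matrices are moved to \<open>'k\<close>, so that
  all identities live in one commutative ring.
\<close>

definition kmat :: "real ^ 'n::finite ^ 'n \<Rightarrow> 'k::real_normed_field ^ 'n ^ 'n" where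
  "kmat M = (\<chi> i j. of_real (M $ i $ j))"

lemma kmat_mult: "kmat (M ** N) = kmat M ** kmat N"
  by (simp add: kmat_def matrix_matrix_mult_def)

lemma kmat_transpose: "kmat (transpose M) = transpose (kmat M)"
  by (simp add: kmat_def transpose_def)

lemma kmat_one: "kmat (mat 1) = mat 1"
  by (simp add: kmat_def mat_def vec_eq_iff)

definition dot :: "'k::comm_ring_1 ^ 'n::finite \<Rightarrow> 'k ^ 'n \<Rightarrow> 'k" where
  "dot u v = (\<Sum>i\<in>UNIV. u $ i * v $ i)"

lemma dot_commute: "dot u v = dot v u"
  by (simp add: dot_def mult.commute)

lemma dot_add_left: "dot (u + v) w = dot u w + dot v w"
  and dot_add_right: "dot w (u + v) = dot w u + dot w v"
  and dot_diff_left: "dot (u - v) w = dot u w - dot v w"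
  and dot_diff_right: "dot w (u - v) = dot w u - dot w v"
  by (simp_all add: dot_def algebra_simps sum.distrib sum_subtractf)

lemma dot_scale_right: "dot u (a *s v) = a * dot u v"
  by (simp add: dot_def sum_distrib_left algebra_simps)

lemma dot_matrix: "dot (M *v u) v = dot u (transpose M *v v)"
  unfolding dot_def matrix_vector_mult_def transpose_def
  by (simp add: sum_distrib_left sum_distrib_right mult_ac) (rule sum.swap)

lemma mat_vector: "mat a *v u = a *s (u :: 'k::comm_ring_1 ^ 'n::finite)"
  by (simp add: matrix_vector_mult_def mat_def vec_eq_iff if_distrib sum.delta cong: if_cong)
    (simp add: if_distribR sum.delta cong: if_cong)

lemma mat_commute: "mat a ** M = M ** (mat a :: 'k::comm_ring_1 ^ 'n::finite ^ 'n)"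
  by (simp add: matrix_matrix_mult_def mat_def vec_eq_iff if_distrib if_distribR sum.delta mult.commute cong: if_cong)

lemma trace_mat_mult: "trace (mat a ** M) = a * trace (M :: 'k::comm_ring_1 ^ 'n::finite ^ 'n)"
  by (simp add: trace_def matrix_matrix_mult_def mat_def if_distrib if_distribR sum.delta sum_distrib_left cong: if_cong)

lemma matrix_diff_rdistrib: "(M - N) ** L = M ** L - N ** (L :: 'k::comm_ring_1 ^ 'n::finite ^ 'n)"
  and matrix_diff_ldistrib: "L ** (M - N) = L ** M - L ** N"
  by (simp_all add: matrix_matrix_mult_def vec_eq_iff algebra_simps sum_subtractf)

lemma matrix_add_rdistrib': "(M + N) ** L = M ** L + N ** (L :: 'k::comm_ring_1 ^ 'n::finite ^ 'n)"
  by (simp add: matrix_matrix_mult_def vec_eq_iff algebra_simps sum.distrib)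

lemma matrix_mult_zero: "M ** 0 = 0" "0 ** M = (0 :: 'k::comm_ring_1 ^ 'n::finite ^ 'n)"
  by (simp_all add: matrix_matrix_mult_def vec_eq_iff)

definition smoothV :: "('m, 'n::finite) chart \<Rightarrow> ('m \<Rightarrow> 'k::real_normed_field ^ 'n) \<Rightarrow> bool" where
  "smoothV c u \<longleftrightarrow> (\<forall>i. smooth_in c (\<lambda>q. u q $ i))"

definition smoothM :: "('m, 'n::finite) chart \<Rightarrow> ('m \<Rightarrow> 'k::real_normed_field ^ 'n ^ 'n) \<Rightarrow> bool" where
  "smoothM c M \<longleftrightarrow> (\<forall>i j. smooth_in c (\<lambda>q. M q $ i $ j))"

text \<open>
  Derivatives along a fixed vector \<open>t\<close> at \<open>p\<close>, of functions, vectors and matrices. They obey the product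
  rule for all matrix products, which keeps the computations free of indices.
\<close>

definition dird :: "('m, 'n::finite) chart \<Rightarrow> 'k::real_normed_field ^ 'n \<Rightarrow> ('m \<Rightarrow> 'k) \<Rightarrow> 'm \<Rightarrow> 'k" where
  "dird c t f p = (\<Sum>k\<in>UNIV. t $ k * pd c k f p)"

definition dirV :: "('m, 'n::finite) chart \<Rightarrow> 'k::real_normed_field ^ 'n \<Rightarrow> ('m \<Rightarrow> 'k ^ 'n) \<Rightarrow> 'm \<Rightarrow> 'k ^ 'n" where
  "dirV c t u p = (\<chi> i. dird c t (\<lambda>q. u q $ i) p)"

definition dirM :: "('m, 'n::finite) chart \<Rightarrow> 'k::real_normed_field ^ 'n \<Rightarrow> ('m \<Rightarrow> 'k ^ 'n ^ 'n) \<Rightarrow> 'm \<Rightarrow> 'k ^ 'n ^ 'n" where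
  "dirM c t M p = (\<chi> i j. dird c t (\<lambda>q. M q $ i $ j) p)"

definition jacV :: "('m, 'n::finite) chart \<Rightarrow> ('m \<Rightarrow> 'k::real_normed_field ^ 'n) \<Rightarrow> 'm \<Rightarrow> 'k ^ 'n ^ 'n" where
  "jacV c u p = (\<chi> i j. pd c j (\<lambda>q. u q $ i) p)"

definition dV :: "('m, 'n::finite) chart \<Rightarrow> ('m \<Rightarrow> 'k::real_normed_field) \<Rightarrow> 'm \<Rightarrow> 'k ^ 'n" where
  "dV c f p = (\<chi> i. pd c i f p)"

lemma jacV_vector: "jacV c u p *v t = dirV c t u p"
  by (simp add: jacV_def dirV_def dird_def matrix_vector_mult_def mult.commute)

lemma dird_eq_dot: "dird c t f p = dot t (dV c f p)"
  by (simp add: dird_def dV_def dot_def)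

lemma dird_axis: "dird c (axis k 1) f p = pd c k f p"
  by (simp add: dird_def axis_def if_distrib if_distribR sum.delta cong: if_cong)

context
  fixes c :: "('m, 'n::finite) chart" and p :: 'm
  assumes c: "coord c"
begin

lemma smoothV_mult:
  assumes "smoothM c M" "smoothV c u"
  shows "smoothV c (\<lambda>q. M q *v u q)"
  using assms unfolding smoothV_def smoothM_def matrix_vector_mult_def
  by (simp add: smooth_in_intros c)

lemma smoothM_mult:
  assumes "smoothM c M" "smoothM c N"
  shows "smoothM c (\<lambda>q. M q ** N q)"
  using assms unfolding smoothM_def matrix_matrix_mult_def
  by (simp add: smooth_in_intros c)

lemma smoothM_transpose: "smoothM c M \<Longrightarrow> smoothM c (\<lambda>q. transpose (M q))"
  by (simp add: smoothM_def transpose_def)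

lemma smooth_in_dot:
  "smoothV c u \<Longrightarrow> smoothV c v \<Longrightarrow> smooth_in c (\<lambda>q. dot (u q) (v q))"
  unfolding smoothV_def dot_def by (simp add: smooth_in_intros c)

lemma smooth_in_trace: "smoothM c M \<Longrightarrow> smooth_in c (\<lambda>q. trace (M q))"
  unfolding smoothM_def trace_def by (simp add: smooth_in_intros c)

lemma smoothV_dV: "smooth_in c f \<Longrightarrow> smoothV c (dV c f)"
  by (simp add: smoothV_def dV_def smooth_in_pd c)

lemma smooth_in_dird:
  assumes "smoothV c t" "smooth_in c f"
  shows "smooth_in c (\<lambda>q. dird c (t q) f q)"
  using assms unfolding dird_def smoothV_def by (simp add: smooth_in_intros smooth_in_pd c)

lemma smoothV_dirV:
  assumes "smoothV c t" "smoothV c u"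
  shows "smoothV c (\<lambda>q. dirV c (t q) u q)"
  using assms smooth_in_dird[OF assms(1)] unfolding dirV_def smoothV_def by simp

lemma smoothM_dirM:
  assumes "smoothV c t" "smoothM c M"
  shows "smoothM c (\<lambda>q. dirM c (t q) M q)"
  using assms smooth_in_dird[OF assms(1)] unfolding dirM_def smoothM_def by simp

lemma smoothM_jacV: "smoothV c u \<Longrightarrow> smoothM c (jacV c u)"
  by (simp add: smoothM_def smoothV_def jacV_def smooth_in_pd c)

lemma smoothV_add: "smoothV c u \<Longrightarrow> smoothV c v \<Longrightarrow> smoothV c (\<lambda>q. u q + v q)"
  by (simp add: smoothV_def smooth_in_intros c)

lemma smoothV_diff: "smoothV c u \<Longrightarrow> smoothV c v \<Longrightarrow> smoothV c (\<lambda>q. u q - v q)"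
  by (simp add: smoothV_def smooth_in_intros c)

context
  assumes p: "p \<in> fst c"
begin

lemma dird_mult:
  "smooth_in c f \<Longrightarrow> smooth_in c h \<Longrightarrow> dird c t (\<lambda>q. f q * h q) p = dird c t f p * h p + f p * dird c t h p"
  by (simp add: dird_def pd_mult[OF c p] algebra_simps sum.distrib sum_distrib_left)

lemma dird_sum:
  "(\<And>i. i \<in> I \<Longrightarrow> smooth_in c (f i)) \<Longrightarrow> dird c t (\<lambda>q. \<Sum>i\<in>I. f i q) p = (\<Sum>i\<in>I. dird c t (f i) p)"
  unfolding dird_def by (simp add: pd_sum[OF c p] sum_distrib_left) (rule sum.swap)

lemma dird_cong:
  "smooth_in c f \<Longrightarrow> (\<And>q. q \<in> fst c \<Longrightarrow> f q = h q) \<Longrightarrow> dird c t f p = dird c t h p"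
  unfolding dird_def using pd_cong[OF c _ p, of f h] by simp

lemma dirM_cong:
  "smoothM c M \<Longrightarrow> (\<And>q. q \<in> fst c \<Longrightarrow> M q = N q) \<Longrightarrow> dirM c t M p = dirM c t N p"
  unfolding dirM_def smoothM_def by (auto simp: vec_eq_iff intro!: dird_cong)

lemma dirV_cong:
  "smoothV c M \<Longrightarrow> (\<And>q. q \<in> fst c \<Longrightarrow> M q = N q) \<Longrightarrow> dirV c t M p = dirV c t N p"
  unfolding dirV_def smoothV_def by (auto simp: vec_eq_iff intro!: dird_cong)

lemma jacV_cong:
  "smoothV c M \<Longrightarrow> (\<And>q. q \<in> fst c \<Longrightarrow> M q = N q) \<Longrightarrow> jacV c M p = jacV c N p"
  unfolding jacV_def smoothV_def by (auto simp: vec_eq_iff intro!: pd_cong[OF c _ p])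

lemma dirM_mult:
  assumes "smoothM c M" "smoothM c N"
  shows "dirM c t (\<lambda>q. M q ** N q) p = dirM c t M p ** N p + M p ** dirM c t N p"
  using assms
  by (simp add: vec_eq_iff dirM_def smoothM_def matrix_matrix_mult_def dird_sum dird_mult smooth_in_mult[OF c] sum.distrib)

lemma dirV_mult:
  assumes "smoothM c M" "smoothV c u"
  shows "dirV c t (\<lambda>q. M q *v u q) p = dirM c t M p *v u p + M p *v dirV c t u p"
  using assms
  by (simp add: vec_eq_iff dirM_def dirV_def smoothM_def smoothV_def matrix_vector_mult_def dird_sum dird_mult
      smooth_in_mult[OF c] sum.distrib)

lemma dird_dot:
  assumes "smoothV c u" "smoothV c v"
  shows "dird c t (\<lambda>q. dot (u q) (v q)) p = dot (dirV c t u p) (v p) + dot (u p) (dirV c t v p)"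
  using assms
  by (simp add: dirV_def smoothV_def dot_def dird_sum dird_mult smooth_in_mult[OF c] sum.distrib)

lemma dird_trace:
  assumes "smoothM c M"
  shows "dird c t (\<lambda>q. trace (M q)) p = trace (dirM c t M p)"
  using assms by (simp add: dirM_def smoothM_def trace_def dird_sum)

lemma dirM_const: "dirM c t (\<lambda>q. M) p = 0"
  by (simp add: dirM_def dird_def vec_eq_iff)

lemma dV_dot:
  assumes "smoothV c u" "smoothV c v"
  shows "dV c (\<lambda>q. dot (u q) (v q)) p = transpose (jacV c u p) *v v p + transpose (jacV c v p) *v u p"
  using assms unfolding vec_eq_iff dV_def smoothV_def dot_def jacV_def matrix_vector_mult_def transpose_def
  by (simp add: pd_sum[OF c p] pd_mult[OF c p] smooth_in_mult[OF c] sum.distrib mult.commute)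

lemma jacV_dV:
  assumes "smooth_in c f"
  shows "transpose (jacV c (dV c f) p) = jacV c (dV c f) p"
proof -
  have "pd c i (\<lambda>q. pd c j f q) p = pd c j (\<lambda>q. pd c i f q) p" for i j
    by (rule pd_commute[OF c assms p])
  then show ?thesis by (simp only: jacV_def dV_def transpose_def vec_eq_iff vec_lambda_beta) blast
qed

lemma jacV_scale:
  assumes "smooth_in c f" "smoothV c u"
  shows "trace (jacV c (\<lambda>q. f q *s u q) p) = f p * trace (jacV c u p) + dird c (u p) f p"
  using assms unfolding trace_def jacV_def smoothV_def dird_def
  by (simp add: pd_mult[OF c p] sum.distrib sum_distrib_left mult.commute)

lemma jacV_diff:
  assumes "smoothV c u" "smoothV c v"
  shows "jacV c (\<lambda>q. u q - v q) p = jacV c u p - jacV c v p"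
  using assms by (simp add: vec_eq_iff jacV_def smoothV_def pd_diff[OF c p])

end

end

section \<open>The metric in a chart\<close>

text \<open>
  Cramer's rule writes the entries of the inverse as rational functions of the entries; this yields the
  smoothness of the inverse metric.
\<close>

lemma matrix_inv_eq:
  fixes M :: "real ^ 'n::finite ^ 'n"
  assumes "\<And>v. v \<noteq> 0 \<Longrightarrow> v \<bullet> (M *v v) > 0"
  shows "M ** matrix_inv M = mat 1" "matrix_inv M ** M = mat 1"
    "matrix_inv M $ k $ l = det (\<chi> i j. if j = k then axis l 1 $ i else M $ i $ j) * inverse (det M)" "det M \<noteq> 0"
proof -
  have "\<exists>B. B ** M = mat 1"
    unfolding matrix_left_invertible_ker using assms by (metis inner_zero_right less_irrefl)
  then have inv: "invertible M" by (simp add: invertible_left_inverse)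
  then have "\<exists>A'. M ** A' = mat 1 \<and> A' ** M = mat 1" by (simp add: invertible_def)
  from someI_ex[OF this] show 1: "M ** matrix_inv M = mat 1" "matrix_inv M ** M = mat 1"
    by (simp_all add: matrix_inv_def)
  show det: "det M \<noteq> 0" using inv invertible_det_nz by blast
  have "M *v (matrix_inv M *v axis l 1) = axis l 1"
    by (simp add: matrix_vector_mul_assoc 1)
  from this[unfolded cramer[OF det]] have "(matrix_inv M *v axis l 1) $ k =
     det (\<chi> i j. if j = k then axis l 1 $ i else M $ i $ j) / det M"
    by simp
  then show "matrix_inv M $ k $ l = det (\<chi> i j. if j = k then axis l 1 $ i else M $ i $ j) * inverse (det M)"
    by (simp add: matrix_vector_mult_basis column_def divide_inverse)
qed

lemma smooth_in_det:
  fixes M :: "'m \<Rightarrow> real ^ 'n::finite ^ 'n"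
  assumes "coord c" "\<And>i j. smooth_in c (\<lambda>q. M q $ i $ j)"
  shows "smooth_in c (\<lambda>q. det (M q))"
  unfolding det_def using assms by (intro smooth_in_intros smooth_in_prod) auto

text \<open>
  The metric, its inverse and the Jacobian matrix of a change of charts, over \<open>'k\<close>.
\<close>

definition gk :: "('m, 'n::finite) metric \<Rightarrow> ('m, 'n) chart \<Rightarrow> 'm \<Rightarrow> 'k::real_normed_field ^ 'n ^ 'n" where
  "gk g c p = kmat (g c p)"

definition hk :: "('m, 'n::finite) metric \<Rightarrow> ('m, 'n) chart \<Rightarrow> 'm \<Rightarrow> 'k::real_normed_field ^ 'n ^ 'n" where
  "hk g c p = kmat (matrix_inv (g c p))"

definition jk :: "('m, 'n::finite) chart \<Rightarrow> ('m, 'n) chart \<Rightarrow> 'm \<Rightarrow> 'k::real_normed_field ^ 'n ^ 'n" where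
  "jk c d p = kmat (jac c d p)"

locale riemannian = manifold A for A :: "('m::topological_space, 'n::finite) chart set" +
  fixes g :: "('m, 'n) metric"
  assumes metric: "riemannian_metric A g"
begin

lemma metric_sym: "c \<in> A \<Longrightarrow> p \<in> fst c \<Longrightarrow> transpose (g c p) = g c p"
  and metric_pos: "c \<in> A \<Longrightarrow> p \<in> fst c \<Longrightarrow> v \<noteq> 0 \<Longrightarrow> v \<bullet> (g c p *v v) > 0"
  and metric_smooth: "c \<in> A \<Longrightarrow> smooth_in c (\<lambda>p. g c p $ i $ j)"
  and metric_change: "c \<in> A \<Longrightarrow> d \<in> A \<Longrightarrow> p \<in> fst c \<Longrightarrow> p \<in> fst d \<Longrightarrow>
    g c p = transpose (jac c d p) ** g d p ** jac c d p"
  using metric unfolding riemannian_metric_def by blast+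

lemma gk_transpose: "c \<in> A \<Longrightarrow> p \<in> fst c \<Longrightarrow> transpose (gk g c p) = gk g c p"
  by (simp only: gk_def kmat_transpose[symmetric] metric_sym)

lemma gk_hk:
  assumes "c \<in> A" "p \<in> fst c"
  shows "gk g c p ** hk g c p = mat 1" "hk g c p ** gk g c p = mat 1"
  using matrix_inv_eq(1,2)[OF metric_pos[OF assms]]
  unfolding gk_def hk_def kmat_mult[symmetric] by (simp_all add: kmat_one)

lemma matrix_inverse_unique:
  fixes M :: "'k::comm_ring_1 ^ 'n ^ 'n"
  assumes "M ** N = mat 1" "L ** M = mat 1"
  shows "L = N"
  by (metis assms matrix_mul_assoc matrix_mul_lid matrix_mul_rid)

lemma hk_transpose:
  assumes "c \<in> A" "p \<in> fst c"
  shows "transpose (hk g c p) = hk g c p"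
proof (rule matrix_inverse_unique[OF gk_hk(1)[OF assms]])
  show "transpose (hk g c p) ** gk g c p = mat 1"
    using gk_hk(1)[OF assms] gk_transpose[OF assms] by (metis matrix_transpose_mul transpose_mat)
qed

lemma smoothM_gk: "c \<in> A \<Longrightarrow> smoothM c (gk g c)"
  by (simp add: smoothM_def gk_def kmat_def smooth_in_of_real metric_smooth coord)

lemma smoothM_hk:
  assumes "c \<in> A"
  shows "smoothM c (hk g c)"
proof -
  note g = metric_smooth[OF assms]
  have "smooth_in c (\<lambda>p. matrix_inv (g c p) $ k $ l)" for k l
  proof (subst smooth_in_cong[OF coord[OF assms] matrix_inv_eq(3)[OF metric_pos[OF assms]]])
    show "smooth_in c (\<lambda>q. det (\<chi> i j. if j = k then axis l 1 $ i else g c q $ i $ j) * inverse (det (g c q)))"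
    proof (intro smooth_in_mult smooth_in_inverse smooth_in_det coord[OF assms])
      show "smooth_in c (\<lambda>q. (\<chi> i j. if j = k then axis l 1 $ i else g c q $ i $ j) $ i $ j)" for i j
        using g by (cases "j = k") (simp_all add: smooth_in_const)
    qed (use g matrix_inv_eq(4)[OF metric_pos[OF assms]] in auto)
  qed auto
  then show ?thesis using coord[OF assms] by (auto simp: smoothM_def hk_def kmat_def intro: smooth_in_of_real)
qed

text \<open>
  Differentiate \<open>g h = 1\<close>.
\<close>

lemma dirM_hk:
  assumes "c \<in> A" "p \<in> fst c"
  shows "dirM c t (hk g c) p = - (hk g c p ** dirM c t (gk g c) p ** hk g c p)"
proof -
  let ?g = "gk g c" and ?h = "hk g c"
  note c = coord[OF assms(1)]
  have "dirM c t (\<lambda>q. ?g q ** ?h q) p = dirM c t (\<lambda>q. mat 1) p"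
    by (rule dirM_cong[OF c assms(2) smoothM_mult[OF c smoothM_gk[OF assms(1)] smoothM_hk[OF assms(1)]]])
      (rule gk_hk(1)[OF assms(1)])
  also have "\<dots> = 0" by (rule dirM_const[OF c assms(2)])
  finally have "dirM c t (\<lambda>q. ?g q ** ?h q) p = 0" .
  moreover have "dirM c t (\<lambda>q. ?g q ** ?h q) p = dirM c t ?g p ** ?h p + ?g p ** dirM c t ?h p"
    by (rule dirM_mult[OF c assms(2) smoothM_gk[OF assms(1)] smoothM_hk[OF assms(1)]])
  ultimately have "dirM c t ?g p ** ?h p + ?g p ** dirM c t ?h p = 0" by simp
  then have "?h p ** (dirM c t ?g p ** ?h p) + ?h p ** (?g p ** dirM c t ?h p) = 0"
    by (metis matrix_add_ldistrib matrix_mult_zero(1))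
  then show ?thesis
    by (simp add: matrix_mul_assoc gk_hk[OF assms] add_eq_0_iff)
qed

end

section \<open>Tensor fields under change of charts\<close>

text \<open>
  The divergence \<open>\<partial>\<^sub>i X\<^sup>i + X (log (sqrt (det g)))\<close>; the logarithmic derivative of the determinant is a trace.
\<close>

definition divc :: "('m, 'n::finite) metric \<Rightarrow> ('m, 'n) chart \<Rightarrow> ('m \<Rightarrow> 'k::real_normed_field ^ 'n) \<Rightarrow> 'm \<Rightarrow> 'k" where
  "divc g c X p = trace (jacV c X p) + (1 / 2) * trace (hk g c p ** dirM c (X p) (gk g c) p)"

context manifold
begin

lemma jk_inverse:
  assumes "c \<in> A" "d \<in> A" "p \<in> fst c" "p \<in> fst d"
  shows "jk d c p ** jk c d p = mat 1"
  by (simp only: jk_def kmat_mult[symmetric] jac_inverse[OF assms] kmat_one)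

lemma smoothM_jk: "c \<in> A \<Longrightarrow> d \<in> A \<Longrightarrow> smoothM (overlap c d) (jk c d)"
  by (simp add: smoothM_def jk_def kmat_def smooth_in_of_real coord_overlap smooth_in_jac)

lemma dV_change:
  assumes "c \<in> A" "d \<in> A" "p \<in> fst c" "p \<in> fst d" "smooth_in (overlap d c) f"
  shows "dV c f p = transpose (jk c d p) *v dV d f p"
  by (simp add: dV_def vec_eq_iff pd_change[OF assms] jk_def kmat_def transpose_def matrix_vector_mult_def
      scaleR_conv_of_real)

lemma dird_change:
  assumes "c \<in> A" "d \<in> A" "p \<in> fst c" "p \<in> fst d" "smooth_in (overlap d c) f"
  shows "dird c t f p = dird d (jk c d p *v t) f p"
  by (simp only: dird_eq_dot dV_change[OF assms] dot_matrix)

lemma dirV_change: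
  assumes "c \<in> A" "d \<in> A" "p \<in> fst c" "p \<in> fst d" "smoothV (overlap d c) u"
  shows "dirV c t u p = dirV d (jk c d p *v t) u p"
proof -
  have "dird c t (\<lambda>q. u q $ i) p = dird d (jk c d p *v t) (\<lambda>q. u q $ i) p" for i
    by (rule dird_change[OF assms(1-4)]) (use assms(5) in \<open>simp add: smoothV_def\<close>)
  then show ?thesis by (simp add: dirV_def)
qed

lemma dirM_change:
  assumes "c \<in> A" "d \<in> A" "p \<in> fst c" "p \<in> fst d" "smoothM (overlap d c) u"
  shows "dirM c t u p = dirM d (jk c d p *v t) u p"
proof -
  have "dird c t (\<lambda>q. u q $ i $ j) p = dird d (jk c d p *v t) (\<lambda>q. u q $ i $ j) p" for i j
    by (rule dird_change[OF assms(1-4)]) (use assms(5) in \<open>simp add: smoothM_def\<close>)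
  then show ?thesis by (simp add: dirM_def)
qed

lemma jacV_change:
  assumes "c \<in> A" "d \<in> A" "p \<in> fst c" "p \<in> fst d" "smoothV (overlap d c) u"
  shows "jacV c u p = jacV d u p ** jk c d p"
proof -
  have "pd c i (\<lambda>q. u q $ k) p = (\<Sum>j\<in>UNIV. jac c d p $ j $ i *\<^sub>R pd d j (\<lambda>q. u q $ k) p)" for i k
    by (rule pd_change[OF assms(1-4)]) (use assms(5) in \<open>simp add: smoothV_def\<close>)
  then show ?thesis
    by (simp add: jacV_def vec_eq_iff jk_def kmat_def matrix_matrix_mult_def scaleR_conv_of_real mult.commute)
qed

lemma smoothV_overlap: "c \<in> A \<Longrightarrow> d \<in> A \<Longrightarrow> smoothV c u \<Longrightarrow> smoothV (overlap c d) u"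
  by (simp add: smoothV_def smooth_in_overlap coord coord_overlap)

lemma smoothM_overlap: "c \<in> A \<Longrightarrow> d \<in> A \<Longrightarrow> smoothM c u \<Longrightarrow> smoothM (overlap c d) u"
  by (simp add: smoothM_def smooth_in_overlap coord coord_overlap)

lemma smoothV_swap: "c \<in> A \<Longrightarrow> d \<in> A \<Longrightarrow> smoothV (overlap d c) u \<Longrightarrow> smoothV (overlap c d) u"
  by (simp add: smoothV_def smooth_in_overlap_swap)

lemma smoothM_swap: "c \<in> A \<Longrightarrow> d \<in> A \<Longrightarrow> smoothM (overlap d c) u \<Longrightarrow> smoothM (overlap c d) u"
  by (simp add: smoothM_def smooth_in_overlap_swap)

lemma dirM_overlap:
  assumes "c \<in> A" "d \<in> A" "p \<in> fst c" "p \<in> fst d" "smoothM (overlap c d) u"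
  shows "dirM c t u p = dirM (overlap c d) t u p"
proof -
  have "pd c k (\<lambda>q. u q $ i $ j) p = pd (overlap c d) k (\<lambda>q. u q $ i $ j) p" for i j k
    by (rule pd_overlap[OF coord[OF assms(1)] coord_overlap[OF assms(1,2)]])
      (use assms(3-5) in \<open>simp_all add: smoothM_def\<close>)
  then show ?thesis by (simp add: dirM_def dird_def)
qed

lemma dirV_overlap:
  assumes "c \<in> A" "d \<in> A" "p \<in> fst c" "p \<in> fst d" "smoothV (overlap c d) u"
  shows "dirV c t u p = dirV (overlap c d) t u p"
proof -
  have "pd c k (\<lambda>q. u q $ i) p = pd (overlap c d) k (\<lambda>q. u q $ i) p" for i k
    by (rule pd_overlap[OF coord[OF assms(1)] coord_overlap[OF assms(1,2)]])
      (use assms(3-5) in \<open>simp_all add: smoothV_def\<close>)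
  then show ?thesis by (simp add: dirV_def dird_def)
qed

lemma jacV_overlap:
  assumes "c \<in> A" "d \<in> A" "p \<in> fst c" "p \<in> fst d" "smoothV (overlap c d) u"
  shows "jacV c u p = jacV (overlap c d) u p"
proof -
  have "pd c k (\<lambda>q. u q $ i) p = pd (overlap c d) k (\<lambda>q. u q $ i) p" for i k
    by (rule pd_overlap[OF coord[OF assms(1)] coord_overlap[OF assms(1,2)]])
      (use assms(3-5) in \<open>simp_all add: smoothV_def\<close>)
  then show ?thesis by (simp add: jacV_def)
qed

lemma vector_field_zero: "vector_field A X \<Longrightarrow> c \<notin> A \<or> p \<notin> fst c \<Longrightarrow> X c p = 0"
  and vector_field_smooth: "vector_field A X \<Longrightarrow> c \<in> A \<Longrightarrow> smoothV c (X c)"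
  unfolding vector_field_def smoothV_def by blast+

lemma vector_field_change:
  assumes "vector_field A X" "c \<in> A" "d \<in> A" "p \<in> fst c" "p \<in> fst d"
  shows "X d p = jk c d p *v X c p"
proof -
  have "X d p $ j = (\<Sum>i\<in>UNIV. jac c d p $ j $ i *\<^sub>R X c p $ i)" for j
    using assms unfolding vector_field_def by blast
  then show ?thesis
    by (simp add: vec_eq_iff jk_def kmat_def matrix_vector_mult_def scaleR_conv_of_real)
qed

lemma vector_fieldI:
  assumes "\<And>c p. c \<notin> A \<or> p \<notin> fst c \<Longrightarrow> X c p = 0" "\<And>c. c \<in> A \<Longrightarrow> smoothV c (X c)"
    "\<And>c d p. c \<in> A \<Longrightarrow> d \<in> A \<Longrightarrow> p \<in> fst c \<Longrightarrow> p \<in> fst d \<Longrightarrow> X d p = jk c d p *v X c p"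
  shows "vector_field A X"
proof -
  have "X d p $ j = (\<Sum>i\<in>UNIV. jac c d p $ j $ i *\<^sub>R X c p $ i)"
    if "c \<in> A" "d \<in> A" "p \<in> fst c \<inter> fst d" for c d p j
    using assms(3)[of c d p] that
    by (simp add: jk_def kmat_def matrix_vector_mult_def scaleR_conv_of_real)
  then show ?thesis using assms(1,2) unfolding vector_field_def smoothV_def by blast
qed

lemma one_form_zero: "one_form A \<omega> \<Longrightarrow> c \<notin> A \<or> p \<notin> fst c \<Longrightarrow> \<omega> c p = 0"
  and one_form_smooth: "one_form A \<omega> \<Longrightarrow> c \<in> A \<Longrightarrow> smoothV c (\<omega> c)"
  unfolding one_form_def smoothV_def by blast+

lemma one_form_change:
  assumes "one_form A \<omega>" "c \<in> A" "d \<in> A" "p \<in> fst c" "p \<in> fst d"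
  shows "\<omega> c p = transpose (jk c d p) *v \<omega> d p"
proof -
  have "\<omega> c p $ i = (\<Sum>j\<in>UNIV. jac c d p $ j $ i *\<^sub>R \<omega> d p $ j)" for i
    using assms unfolding one_form_def by blast
  then show ?thesis
    by (simp add: vec_eq_iff jk_def kmat_def matrix_vector_mult_def transpose_def scaleR_conv_of_real)
qed

lemma one_formI:
  assumes "\<And>c p. c \<notin> A \<or> p \<notin> fst c \<Longrightarrow> \<omega> c p = 0" "\<And>c. c \<in> A \<Longrightarrow> smoothV c (\<omega> c)"
    "\<And>c d p. c \<in> A \<Longrightarrow> d \<in> A \<Longrightarrow> p \<in> fst c \<Longrightarrow> p \<in> fst d \<Longrightarrow> \<omega> c p = transpose (jk c d p) *v \<omega> d p"
  shows "one_form A \<omega>"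
proof -
  have "\<omega> c p $ i = (\<Sum>j\<in>UNIV. jac c d p $ j $ i *\<^sub>R \<omega> d p $ j)"
    if "c \<in> A" "d \<in> A" "p \<in> fst c \<inter> fst d" for c d p i
    using assms(3)[of c d p] that
    by (simp add: jk_def kmat_def matrix_vector_mult_def transpose_def scaleR_conv_of_real)
  then show ?thesis using assms(1,2) unfolding one_form_def smoothV_def by blast
qed

text \<open>
  The symmetry of second derivatives of the transition map turns \<open>\<Sum>\<^sub>k (\<partial>\<^sub>j J\<^sub>i\<^sub>k) u\<^sub>k\<close> into the derivative of
  \<open>J\<^sub>i\<^sub>j\<close> along \<open>u\<close>.
\<close>

lemma jacV_jk_mult:
  fixes u :: "'m \<Rightarrow> 'k::real_normed_field ^ 'n"
  assumes "c \<in> A" "d \<in> A" "p \<in> fst c" "p \<in> fst d" "smoothV (overlap c d) u"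
  shows "jacV (overlap c d) (\<lambda>q. jk c d q *v u q) p =
    jk c d p ** jacV (overlap c d) u p + dirM (overlap c d) (u p) (jk c d) p"
proof -
  let ?o = "overlap c d"
  have o: "coord ?o" "p \<in> fst ?o" using coord_overlap[OF assms(1,2)] assms(3,4) by auto
  have sj: "smooth_in ?o (\<lambda>q. jk c d q $ i $ j :: 'k)" for i j
    by (rule smoothM_jk[OF assms(1,2), unfolded smoothM_def, rule_format])
  have su: "smooth_in ?o (\<lambda>q. u q $ i)" for i using assms(5) by (simp add: smoothV_def)
  have sym: "pd ?o k (\<lambda>q. jk c d q $ j $ i) p = (pd ?o i (\<lambda>q. jk c d q $ j $ k) p :: 'k)" for i j k
  proof -
    have "pd ?o i (\<lambda>q. jk c d q $ j $ k) p = (of_real (pd ?o i (\<lambda>q. jac c d q $ j $ k) p) :: 'k)" for i j k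
      unfolding jk_def kmat_def vec_lambda_beta by (rule pd_of_real[OF o smooth_in_jac[OF assms(1,2)]])
    then show ?thesis using pd_jac_symmetric[OF assms(1,2), of p k j i] assms(3,4) by simp
  qed
  show ?thesis
    unfolding vec_eq_iff
  proof (intro allI)
    fix i j
    have "jacV ?o (\<lambda>q. jk c d q *v u q) p $ i $ j = pd ?o j (\<lambda>q. \<Sum>k\<in>UNIV. jk c d q $ i $ k * u q $ k) p"
      by (simp add: jacV_def matrix_vector_mult_def)
    also have "\<dots> = (\<Sum>k\<in>UNIV. pd ?o j (\<lambda>q. jk c d q $ i $ k) p * u p $ k + jk c d p $ i $ k * pd ?o j (\<lambda>q. u q $ k) p)"
      by (simp add: pd_sum[OF o] pd_mult[OF o] smooth_in_mult[OF o(1)] sj su)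
    also have "\<dots> = (\<Sum>k\<in>UNIV. jk c d p $ i $ k * pd ?o j (\<lambda>q. u q $ k) p) + (\<Sum>k\<in>UNIV. u p $ k * pd ?o k (\<lambda>q. jk c d q $ i $ j) p)"
      by (simp add: sum.distrib sym[of j i] mult.commute)
    finally show "jacV ?o (\<lambda>q. jk c d q *v u q) p $ i $ j =
      (jk c d p ** jacV ?o u p + dirM ?o (u p) (jk c d) p) $ i $ j"
      by (simp add: matrix_matrix_mult_def jacV_def dirM_def dird_def)
  qed
qed

lemma jacV_vector_field:
  assumes X: "vector_field A X" and cd: "c \<in> A" "d \<in> A" "p \<in> fst c" "p \<in> fst d"
  shows "jacV d (X d) p = (jk c d p ** jacV c (X c) p + dirM (overlap c d) (X c p) (jk c d) p) ** jk d c p"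
proof -
  let ?o = "overlap c d"
  have o: "coord ?o" "p \<in> fst ?o" using coord_overlap[OF cd(1,2)] cd(3,4) by auto
  have s: "smoothV ?o (X c)" "smoothV (overlap d c) (X d)"
    by (simp_all add: smoothV_overlap vector_field_smooth[OF X] cd)
  have "jacV d (X d) p = jacV c (X d) p ** jk d c p"
    by (rule jacV_change[OF cd(2,1,4,3)]) (rule smoothV_swap[OF cd(1,2) s(2)])
  also have "jacV c (X d) p = jacV ?o (X d) p"
    by (rule jacV_overlap[OF cd]) (rule smoothV_swap[OF cd(1,2) s(2)])
  also have "\<dots> = jacV ?o (\<lambda>q. jk c d q *v X c q) p"
    by (rule jacV_cong[OF o smoothV_swap[OF cd(1,2) s(2)]])
      (use vector_field_change[OF X cd(1,2)] in auto)
  also have "\<dots> = jk c d p ** jacV ?o (X c) p + dirM ?o (X c p) (jk c d) p"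
    by (rule jacV_jk_mult[OF cd s(1)])
  also have "jacV ?o (X c) p = jacV c (X c) p"
    by (rule jacV_overlap[OF cd s(1), symmetric])
  finally show ?thesis .
qed

lemma dirM_transpose: "dirM c t (\<lambda>q. transpose (M q)) p = transpose (dirM c t M p)"
  by (simp add: dirM_def transpose_def)

lemma lie_form_eq: "lie_form X \<omega> c p = dirV c (X c p) (\<omega> c) p + transpose (jacV c (X c) p) *v \<omega> c p"
  by (simp add: lie_form_def dirV_def dird_def jacV_def transpose_def matrix_vector_mult_def vec_eq_iff sum.distrib mult.commute)

text \<open>
  The derivative of the Jacobian along \<open>X\<close> arises from the transformation law of \<open>\<omega>\<close> and from that of \<open>X\<close>,
  and the two occurrences cancel.
\<close>

lemma one_form_lie_form:
  assumes X: "vector_field A X" and w: "one_form A \<omega>"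
  shows "one_form A (lie_form X \<omega>)"
proof (rule one_formI)
  show "lie_form X \<omega> c p = 0" if "c \<notin> A \<or> p \<notin> fst c" for c p
    using vector_field_zero[OF X that] one_form_zero[OF w that] by (simp add: lie_form_def vec_eq_iff)
  show "smoothV c (lie_form X \<omega> c)" if c: "c \<in> A" for c
    unfolding lie_form_eq
    by (intro smoothV_add smoothV_dirV smoothV_mult smoothM_transpose smoothM_jacV coord[OF c]
        vector_field_smooth[OF X c] one_form_smooth[OF w c])
  show "lie_form X \<omega> c p = transpose (jk c d p) *v lie_form X \<omega> d p"
    if cd: "c \<in> A" "d \<in> A" "p \<in> fst c" "p \<in> fst d" for c d p
  proof -
    let ?o = "overlap c d" and ?J = "jk c d" and ?t = "X c p"
    have o: "coord ?o" "p \<in> fst ?o" using coord_overlap[OF cd(1,2)] cd(3,4) by auto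
    have s: "smoothV ?o (\<omega> c)" "smoothV (overlap d c) (\<omega> d)" "smoothM ?o (\<lambda>q. transpose (?J q))"
      by (simp_all add: smoothV_overlap one_form_smooth[OF w] cd smoothM_transpose[OF o(1)] smoothM_jk)
    note s2 = smoothV_swap[OF cd(1,2) s(2)]
    let ?dJ = "dirM ?o ?t ?J p"
    have "dirV c ?t (\<omega> c) p = dirV ?o ?t (\<omega> c) p" by (rule dirV_overlap[OF cd s(1)])
    also have "\<dots> = dirV ?o ?t (\<lambda>q. transpose (?J q) *v \<omega> d q) p"
      by (rule dirV_cong[OF o s(1)]) (use one_form_change[OF w cd(1,2)] in auto)
    also have "\<dots> = transpose ?dJ *v \<omega> d p + transpose (?J p) *v dirV ?o ?t (\<omega> d) p"
      by (subst dirV_mult[OF o s(3) s2]) (simp only: dirM_transpose)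
    also have "dirV ?o ?t (\<omega> d) p = dirV c ?t (\<omega> d) p" by (rule dirV_overlap[OF cd s2, symmetric])
    also have "dirV c ?t (\<omega> d) p = dirV d (X d p) (\<omega> d) p"
      by (subst dirV_change[OF cd s(2)]) (simp only: vector_field_change[OF X cd])
    finally have 1: "dirV c ?t (\<omega> c) p = transpose ?dJ *v \<omega> d p + transpose (?J p) *v dirV d (X d p) (\<omega> d) p" .
    have "transpose (?J p) *v (transpose (jacV d (X d) p) *v \<omega> d p) = transpose (jacV d (X d) p ** ?J p) *v \<omega> d p"
      by (simp only: matrix_transpose_mul matrix_vector_mul_assoc)
    also have "jacV d (X d) p ** ?J p = ?J p ** jacV c (X c) p + ?dJ"
      unfolding jacV_vector_field[OF X cd]
      by (simp only: matrix_mul_assoc[symmetric] jk_inverse[OF cd] matrix_mul_rid)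
    also have "transpose (?J p ** jacV c (X c) p + ?dJ) *v \<omega> d p =
        transpose (jacV c (X c) p) *v (transpose (?J p) *v \<omega> d p) + transpose ?dJ *v \<omega> d p"
    proof -
      have "transpose (?J p ** jacV c (X c) p + ?dJ) = transpose (jacV c (X c) p) ** transpose (?J p) + transpose ?dJ"
        by (subst matrix_transpose_mul[symmetric]) (simp add: transpose_def vec_eq_iff)
      then show ?thesis by (simp only: matrix_vector_mult_add_rdistrib matrix_vector_mul_assoc)
    qed
    also have "transpose (?J p) *v \<omega> d p = \<omega> c p" by (rule one_form_change[OF w cd, symmetric])
    finally have 2: "transpose (?J p) *v (transpose (jacV d (X d) p) *v \<omega> d p) =
      transpose (jacV c (X c) p) *v \<omega> c p + transpose ?dJ *v \<omega> d p" .
    show ?thesis unfolding lie_form_eq matrix_vector_right_distrib 1 2 by (simp only: add_ac)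
  qed
qed

lemma smooth_funD: "smooth_fun A f \<Longrightarrow> c \<in> A \<Longrightarrow> smooth_in c f"
  by (simp add: smooth_fun_def)

lemma ext_d_eq: "c \<in> A \<Longrightarrow> p \<in> fst c \<Longrightarrow> ext_d A f c p = dV c f p"
  by (simp add: ext_d_def dV_def)

lemma smoothV_cong: "coord c \<Longrightarrow> (\<And>q. q \<in> fst c \<Longrightarrow> u q = v q) \<Longrightarrow> smoothV c u \<longleftrightarrow> smoothV c v"
  unfolding smoothV_def using smooth_in_cong[of c "\<lambda>q. u q $ i" "\<lambda>q. v q $ i" for i] by simp

lemma one_form_ext_d:
  assumes f: "smooth_fun A f"
  shows "one_form A (ext_d A f)"
proof (rule one_formI)
  show "smoothV c (ext_d A f c)" if c: "c \<in> A" for c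
    using smoothV_cong[OF coord[OF c], of "ext_d A f c" "dV c f"] ext_d_eq[OF c, of _ f]
      smoothV_dV[OF coord[OF c] smooth_funD[OF f c]] by blast
  show "ext_d A f c p = transpose (jk c d p) *v ext_d A f d p"
    if cd: "c \<in> A" "d \<in> A" "p \<in> fst c" "p \<in> fst d" for c d p
    unfolding ext_d_eq[OF cd(1,3)] ext_d_eq[OF cd(2,4)]
    by (rule dV_change[OF cd]) (rule smooth_in_overlap[OF coord[OF cd(2)] coord_overlap[OF cd(2,1)] smooth_funD[OF f cd(2)]])
qed (auto simp: ext_d_def)

lemma apply_field_eq:
  assumes X: "vector_field A X" and f: "smooth_fun A f" and c: "c \<in> A" "p \<in> fst c"
  shows "apply_field A X f p = dird c (X c p) f p"
proof -
  let ?d = "chart_at A p"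
  have "apply_field A X f p = dird ?d (X ?d p) f p"
    by (simp add: apply_field_def dird_def Let_def)
  also have "\<dots> = dird c (X c p) f p"
    by (subst dird_change[OF chart_at(1) c(1) chart_at(2) c(2)])
      (simp_all only: vector_field_change[OF X chart_at(1) c(1) chart_at(2) c(2), symmetric]
        smooth_in_overlap[OF coord[OF c(1)] coord_overlap[OF c(1) chart_at(1)] smooth_funD[OF f c(1)]])
  finally show ?thesis .
qed

lemma smooth_fun_apply_field:
  assumes X: "vector_field A X" and f: "smooth_fun A f"
  shows "smooth_fun A (apply_field A X f)"
  unfolding smooth_fun_def
proof
  fix c assume c: "c \<in> A"
  show "smooth_in c (apply_field A X f)"
    by (subst smooth_in_cong[OF coord[OF c] apply_field_eq[OF X f c]])
      (auto intro: smooth_in_dird coord[OF c] vector_field_smooth[OF X c] smooth_funD[OF f c])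
qed

end

section \<open>The divergence in charts\<close>

lemma transpose_eqD:
  assumes "transpose M = M"
  shows "M $ i $ j = M $ j $ i"
proof -
  have "transpose M $ i $ j = M $ j $ i" by (simp add: transpose_def)
  then show ?thesis by (simp only: assms)
qed

lemma trace_transpose: "trace (transpose M) = trace M"
  by (simp add: trace_def transpose_def)

context riemannian
begin

lemma gk_change:
  assumes "c \<in> A" "d \<in> A" "p \<in> fst c" "p \<in> fst d"
  shows "gk g c p = transpose (jk c d p) ** gk g d p ** jk c d p"
  unfolding gk_def jk_def
  by (subst metric_change[OF assms]) (simp only: kmat_mult kmat_transpose)

lemma hk_change:
  assumes "c \<in> A" "d \<in> A" "p \<in> fst c" "p \<in> fst d"
  shows "hk g d p = jk c d p ** hk g c p ** transpose (jk c d p)"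
proof (rule matrix_inverse_unique[OF gk_hk(1)[OF assms(2,4)], symmetric])
  let ?J = "jk c d p" and ?K = "jk d c p"
  have "?J ** hk g c p ** transpose ?J ** gk g d p =
      ?J ** hk g c p ** (transpose ?J ** gk g d p ** ?J) ** ?K"
    by (simp only: matrix_mul_assoc[symmetric] jk_inverse[OF assms(2,1,4,3)] matrix_mul_rid)
  also have "\<dots> = mat 1"
    unfolding gk_change[OF assms, symmetric]
    by (simp only: matrix_mul_assoc[symmetric] gk_hk[OF assms(1,3)] matrix_mul_lid jk_inverse[OF assms(2,1,4,3)])
  finally show "?J ** hk g c p ** transpose ?J ** gk g d p = mat 1" .
qed

text \<open>
  Passing from \<open>c\<close> to \<open>d\<close>, the trace of the first derivatives gains \<open>tr (J\<^sup>-\<^sup>1 \<partial>\<^sub>X J)\<close> and the logarithmic derivative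
  of the volume loses it.
\<close>

lemma divc_change:
  assumes X: "vector_field A X" and cd: "c \<in> A" "d \<in> A" "p \<in> fst c" "p \<in> fst d"
  shows "divc g c (X c) p = divc g d (X d) p"
proof -
  let ?o = "overlap c d" and ?J = "jk c d" and ?K = "jk d c p" and ?t = "X c p"
  let ?hc = "hk g c p" and ?hd = "hk g d p" and ?gd = "gk g d p"
  have o: "coord ?o" "p \<in> fst ?o" using coord_overlap[OF cd(1,2)] cd(3,4) by auto
  have s1: "smoothM ?o (gk g c)" by (rule smoothM_overlap[OF cd(1,2) smoothM_gk[OF cd(1)]])
  have s2: "smoothM (overlap d c) (gk g d)" by (rule smoothM_overlap[OF cd(2,1) smoothM_gk[OF cd(2)]])
  have s3: "smoothM ?o (gk g d)" by (rule smoothM_swap[OF cd(1,2) s2])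
  have s4: "smoothM ?o ?J" by (rule smoothM_jk[OF cd(1,2)])
  have s5: "smoothM ?o (\<lambda>q. transpose (?J q))" by (rule smoothM_transpose[OF o(1) s4])
  let ?dJ = "dirM ?o ?t ?J p" and ?dg = "dirM d (X d p) (gk g d) p"
  have "dirM c ?t (gk g c) p = dirM ?o ?t (gk g c) p" by (rule dirM_overlap[OF cd s1])
  also have "\<dots> = dirM ?o ?t (\<lambda>q. transpose (?J q) ** gk g d q ** ?J q) p"
    by (rule dirM_cong[OF o s1]) (rule gk_change[OF cd(1,2)], auto)
  also have "\<dots> = dirM ?o ?t (\<lambda>q. transpose (?J q) ** gk g d q) p ** ?J p + transpose (?J p) ** ?gd ** ?dJ"
    by (rule dirM_mult[OF o smoothM_mult[OF o(1) s5 s3] s4])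
  also have "dirM ?o ?t (\<lambda>q. transpose (?J q) ** gk g d q) p =
      transpose ?dJ ** ?gd + transpose (?J p) ** dirM ?o ?t (gk g d) p"
    by (subst dirM_mult[OF o s5 s3]) (simp only: dirM_transpose)
  also have "dirM ?o ?t (gk g d) p = dirM c ?t (gk g d) p" by (rule dirM_overlap[OF cd s3, symmetric])
  also have "\<dots> = ?dg"
    by (subst dirM_change[OF cd s2]) (simp only: vector_field_change[OF X cd])
  finally have dg: "dirM c ?t (gk g c) p =
    (transpose ?dJ ** ?gd + transpose (?J p) ** ?dg) ** ?J p + transpose (?J p) ** ?gd ** ?dJ" .
  \<comment> \<open>Since \<open>?hd = ?J ** ?hc ** transpose ?J\<close>, the Jacobian can be moved out of traces with \<open>?hc\<close>.\<close>
  have hJ: "?hc ** transpose (?J p) ** ?gd = ?K"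
  proof -
    have "?K ** (?hd ** ?gd) = ?K ** (?J p ** ?hc ** transpose (?J p)) ** ?gd"
      by (simp only: hk_change[OF cd] matrix_mul_assoc)
    then have "?K = ?hc ** transpose (?J p) ** ?gd"
      by (simp only: gk_hk[OF cd(2,4)] matrix_mul_rid)
        (simp only: matrix_mul_assoc jk_inverse[OF cd] matrix_mul_lid)
    then show ?thesis by (rule sym)
  qed
  have Jh: "?gd ** ?J p ** ?hc = transpose ?K"
    unfolding hJ[symmetric] matrix_transpose_mul
    by (simp only: transpose_transpose gk_transpose[OF cd(2,4)] hk_transpose[OF cd(1,3)] matrix_mul_assoc)
  have t1: "trace (?hc ** (transpose ?dJ ** ?gd ** ?J p)) = trace (?K ** ?dJ)"
  proof -
    have "trace (?hc ** (transpose ?dJ ** ?gd ** ?J p)) = trace (transpose ?dJ ** ?gd ** ?J p ** ?hc)"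
      by (rule trace_mul_sym)
    also have "\<dots> = trace (transpose ?dJ ** (?gd ** ?J p ** ?hc))" by (simp only: matrix_mul_assoc)
    also have "\<dots> = trace (transpose (?K ** ?dJ))" by (simp only: Jh matrix_transpose_mul)
    finally show ?thesis by (simp only: trace_transpose)
  qed
  have t2: "trace (?hc ** (transpose (?J p) ** ?dg ** ?J p)) = trace (?hd ** ?dg)"
  proof -
    have "trace (?hc ** (transpose (?J p) ** ?dg ** ?J p)) = trace ((?hc ** transpose (?J p) ** ?dg) ** ?J p)"
      by (simp only: matrix_mul_assoc)
    also have "\<dots> = trace (?J p ** (?hc ** transpose (?J p) ** ?dg))" by (rule trace_mul_sym)
    finally show ?thesis by (simp only: hk_change[OF cd] matrix_mul_assoc)
  qed
  have t3: "trace (?hc ** (transpose (?J p) ** ?gd ** ?dJ)) = trace (?K ** ?dJ)"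
    by (simp only: matrix_mul_assoc hJ)
  have "trace (?hc ** dirM c ?t (gk g c) p) = 2 * trace (?K ** ?dJ) + trace (?hd ** ?dg)"
    unfolding dg matrix_add_rdistrib' matrix_add_ldistrib trace_add t1 t2 t3 by simp
  moreover have "trace (jacV d (X d) p) = trace (jacV c (X c) p) + trace (?K ** ?dJ)"
    unfolding jacV_vector_field[OF X cd]
    by (subst trace_mul_sym)
      (simp only: matrix_add_ldistrib trace_add matrix_mul_assoc jk_inverse[OF cd] matrix_mul_lid)
  ultimately show ?thesis by (simp add: divc_def algebra_simps)
qed

text \<open>
  In the contraction \<open>\<Gamma>\<^sup>i\<^sub>i\<^sub>k\<close> two of the three derivatives of the metric cancel, by the symmetry of the
  metric and of its inverse.
\<close>

lemma trace_nabla: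
  fixes X :: "('m, 'n, 'k::real_normed_field) field"
  assumes X: "vector_field A X" and c: "c \<in> A" "p \<in> fst c"
  shows "trace (nabla g X c p) = divc g c (X c) p"
proof -
  define h where "h i j = (hk g c p $ i $ j :: 'k)" for i j
  define D where "D k i j = pd c k (\<lambda>q. gk g c q $ i $ j :: 'k) p" for k i j
  define x where "x k = X c p $ k" for k
  have hs: "h i j = h j i" for i j
    unfolding h_def by (rule transpose_eqD[OF hk_transpose[OF c]])
  have gs: "gk g c q $ i $ j = (gk g c q $ j $ i :: 'k)" if "q \<in> fst c" for i j q
    by (rule transpose_eqD[OF gk_transpose[OF c(1) that]])
  have sg: "smooth_in c (\<lambda>q. gk g c q $ i $ j :: 'k)" for i j
    by (rule smoothM_gk[OF c(1), unfolded smoothM_def, rule_format])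
  have Ds: "D k i j = D k j i" for i j k
    unfolding D_def by (rule pd_cong[OF coord[OF c(1)] sg c(2)]) (rule gs)
  have D: "of_real (pd c k (\<lambda>q. g c q $ i $ j) p) = D k i j" for i j k
    unfolding D_def gk_def kmat_def vec_lambda_beta
    by (rule pd_of_real[OF coord[OF c(1)] c(2) metric_smooth[OF c(1)], symmetric])
  have chr: "christoffel g c i i k p *\<^sub>R X c p $ k =
      (1/2) * (\<Sum>l\<in>UNIV. (h i l * D i k l - h l i * D l k i + h i l * D k i l) * x k)" for i k
    by (simp add: christoffel_def scaleR_conv_of_real D x_def sum_distrib_right sum_distrib_left hs[of _ i] Ds[of _ k i])
      (simp add: h_def hk_def kmat_def algebra_simps)
  have "(\<Sum>i\<in>UNIV. \<Sum>k\<in>UNIV. christoffel g c i i k p *\<^sub>R X c p $ k) =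
    (1/2) * (\<Sum>i\<in>UNIV. \<Sum>k\<in>UNIV. \<Sum>l\<in>UNIV. (h i l * D i k l - h l i * D l k i + h i l * D k i l) * x k)"
    by (simp only: chr sum_distrib_left)
  also have "(\<Sum>i\<in>UNIV. \<Sum>k\<in>UNIV. \<Sum>l\<in>UNIV. (h i l * D i k l - h l i * D l k i + h i l * D k i l) * x k) =
    (\<Sum>k\<in>UNIV. \<Sum>i\<in>UNIV. \<Sum>l\<in>UNIV. (h i l * D i k l - h l i * D l k i + h i l * D k i l) * x k)"
    by (rule sum.swap)
  also have "\<dots> = (\<Sum>k\<in>UNIV. ((\<Sum>i\<in>UNIV. \<Sum>l\<in>UNIV. h i l * D i k l) - (\<Sum>i\<in>UNIV. \<Sum>l\<in>UNIV. h l i * D l k i)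
      + (\<Sum>i\<in>UNIV. \<Sum>l\<in>UNIV. h i l * D k i l)) * x k)"
    by (simp add: algebra_simps sum.distrib sum_subtractf sum_distrib_right sum_distrib_left)
  also have "\<dots> = (\<Sum>k\<in>UNIV. (\<Sum>i\<in>UNIV. \<Sum>l\<in>UNIV. h i l * D k i l) * x k)"
    by (subst (2) sum.swap) simp
  also have "\<dots> = (\<Sum>i\<in>UNIV. \<Sum>l\<in>UNIV. \<Sum>k\<in>UNIV. h i l * (x k * D k l i))"
  proof -
    have "(\<Sum>k\<in>UNIV. (\<Sum>i\<in>UNIV. \<Sum>l\<in>UNIV. h i l * D k i l) * x k) =
        (\<Sum>k\<in>UNIV. \<Sum>i\<in>UNIV. \<Sum>l\<in>UNIV. h i l * (x k * D k i l))"
      by (simp add: sum_distrib_right sum_distrib_left mult_ac)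
    also have "\<dots> = (\<Sum>i\<in>UNIV. \<Sum>k\<in>UNIV. \<Sum>l\<in>UNIV. h i l * (x k * D k i l))"
      by (rule sum.swap)
    also have "\<dots> = (\<Sum>i\<in>UNIV. \<Sum>l\<in>UNIV. \<Sum>k\<in>UNIV. h i l * (x k * D k i l))"
      by (intro sum.cong refl sum.swap)
    also have "\<dots> = (\<Sum>i\<in>UNIV. \<Sum>l\<in>UNIV. \<Sum>k\<in>UNIV. h i l * (x k * D k l i))"
      by (intro sum.cong refl) (simp only: Ds[of _ i l for i l])
    finally show ?thesis .
  qed
  also have "\<dots> = trace (hk g c p ** dirM c (X c p) (gk g c) p)"
    by (simp add: trace_def matrix_matrix_mult_def dirM_def dird_def h_def D_def x_def sum_distrib_left)
  finally have "(\<Sum>i\<in>UNIV. \<Sum>k\<in>UNIV. christoffel g c i i k p *\<^sub>R X c p $ k) =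
    (1/2) * trace (hk g c p ** dirM c (X c p) (gk g c) p)" .
  then show ?thesis
    by (simp add: divc_def trace_def nabla_def jacV_def sum.distrib)
qed

lemma divergence_eq:
  assumes X: "vector_field A X" and c: "c \<in> A" "p \<in> fst c"
  shows "divergence A g X p = divc g c (X c) p"
  unfolding divergence_def trace_nabla[OF X chart_at]
  by (rule divc_change[OF X chart_at(1) c(1) chart_at(2) c(2)])

lemma smooth_in_divc:
  assumes "c \<in> A" "smoothV c u"
  shows "smooth_in c (divc g c u)"
  unfolding divc_def
  by (intro smooth_in_intros smooth_in_trace smoothM_jacV smoothM_mult smoothM_dirM smoothM_gk smoothM_hk assms coord)

section \<open>The inverse metric and the Laplace-Beltrami operator\<close>

lemma inv_metric_eq:
  assumes w: "one_form A \<omega>" and e: "one_form A \<eta>" and c: "c \<in> A" "p \<in> fst c"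
  shows "inv_metric A g \<omega> \<eta> p = dot (\<omega> c p) (hk g c p *v \<eta> c p)"
proof -
  let ?d = "chart_at A p"
  note cd = chart_at(1)[of p] c(1) chart_at(2)[of p] c(2)
  have "inv_metric A g \<omega> \<eta> p = dot (\<omega> ?d p) (hk g ?d p *v \<eta> ?d p)"
    by (simp add: inv_metric_def Let_def dot_def matrix_vector_mult_def hk_def kmat_def scaleR_conv_of_real
        sum_distrib_left mult_ac)
  also have "\<dots> = dot (\<omega> c p) (hk g c p *v \<eta> c p)"
    unfolding one_form_change[OF w cd] one_form_change[OF e cd] hk_change[OF cd]
    by (simp only: dot_matrix matrix_transpose_mul transpose_transpose matrix_vector_mul_assoc matrix_mul_assoc)
  finally show ?thesis .
qed

lemma smooth_fun_inv_metric:
  assumes w: "one_form A \<omega>" and e: "one_form A \<eta>"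
  shows "smooth_fun A (inv_metric A g \<omega> \<eta>)"
  unfolding smooth_fun_def
proof
  fix c assume c: "c \<in> A"
  show "smooth_in c (inv_metric A g \<omega> \<eta>)"
    by (subst smooth_in_cong[OF coord[OF c] inv_metric_eq[OF w e c]])
      (assumption, intro smooth_in_dot smoothV_mult smoothM_hk coord c one_form_smooth[OF w c] one_form_smooth[OF e c])
qed

lemma flat_eq: "flat g X c p = gk g c p *v X c p"
  by (simp add: flat_def gk_def kmat_def matrix_vector_mult_def scaleR_conv_of_real)

lemma sharp_eq: "sharp g \<omega> c p = hk g c p *v \<omega> c p"
  by (simp add: sharp_def hk_def kmat_def matrix_vector_mult_def scaleR_conv_of_real)

lemma one_form_flat:
  assumes X: "vector_field A X"
  shows "one_form A (flat g X)"
proof (rule one_formI)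
  show "flat g X c p = 0" if "c \<notin> A \<or> p \<notin> fst c" for c p
    using vector_field_zero[OF X that] by (simp add: flat_eq)
  show "smoothV c (flat g X c)" if "c \<in> A" for c
    unfolding flat_eq by (intro smoothV_mult smoothM_gk coord that vector_field_smooth[OF X])
  show "flat g X c p = transpose (jk c d p) *v flat g X d p"
    if cd: "c \<in> A" "d \<in> A" "p \<in> fst c" "p \<in> fst d" for c d p
    unfolding flat_eq gk_change[OF cd] vector_field_change[OF X cd]
    by (simp only: matrix_vector_mul_assoc matrix_mul_assoc)
qed

lemma vector_field_sharp:
  assumes w: "one_form A \<omega>"
  shows "vector_field A (sharp g \<omega>)"
proof (rule vector_fieldI)
  show "sharp g \<omega> c p = 0" if "c \<notin> A \<or> p \<notin> fst c" for c p
    using one_form_zero[OF w that] by (simp add: sharp_eq)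
  show "smoothV c (sharp g \<omega> c)" if "c \<in> A" for c
    unfolding sharp_eq by (intro smoothV_mult smoothM_hk coord that one_form_smooth[OF w])
  show "sharp g \<omega> d p = jk c d p *v sharp g \<omega> c p"
    if cd: "c \<in> A" "d \<in> A" "p \<in> fst c" "p \<in> fst d" for c d p
    unfolding sharp_eq hk_change[OF cd] one_form_change[OF w cd]
    by (simp only: matrix_vector_mul_assoc matrix_mul_assoc)
qed

lemma laplace_beltrami_eq:
  assumes f: "smooth_fun A f" and c: "c \<in> A" "p \<in> fst c"
  shows "laplace_beltrami A g f p = divc g c (sharp g (ext_d A f) c) p"
  unfolding laplace_beltrami_def by (rule divergence_eq[OF vector_field_sharp[OF one_form_ext_d[OF f]] c])

lemma smooth_fun_laplace_beltrami:
  assumes f: "smooth_fun A f"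
  shows "smooth_fun A (laplace_beltrami A g f)"
  unfolding smooth_fun_def
proof
  fix c assume c: "c \<in> A"
  show "smooth_in c (laplace_beltrami A g f)"
    by (subst smooth_in_cong[OF coord[OF c] laplace_beltrami_eq[OF f c]])
      (auto intro: smooth_in_divc[OF c] vector_field_smooth[OF vector_field_sharp[OF one_form_ext_d[OF f]] c])
qed

end

section \<open>The divergence of a Lie bracket\<close>

context riemannian
begin

lemma trace_jacV_direction:
  assumes c: "coord c" "p \<in> fst c" and X: "smoothV c X" and T: "smoothV c T"
  shows "trace (jacV c (\<lambda>q. dirV c (T q) X q) p) =
    dird c (T p) (\<lambda>q. trace (jacV c X q)) p + trace (jacV c X p ** jacV c T p)"
proof -
  have sX: "smooth_in c (\<lambda>q. X q $ i)" and sT: "smooth_in c (\<lambda>q. T q $ i)" for i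
    using X T by (simp_all add: smoothV_def)
  have "trace (jacV c (\<lambda>q. dirV c (T q) X q) p) =
    (\<Sum>i\<in>UNIV. pd c i (\<lambda>q. \<Sum>k\<in>UNIV. T q $ k * pd c k (\<lambda>q. X q $ i) q) p)"
    by (simp add: trace_def jacV_def dirV_def dird_def)
  also have "\<dots> = (\<Sum>i\<in>UNIV. \<Sum>k\<in>UNIV. pd c i (\<lambda>q. T q $ k) p * pd c k (\<lambda>q. X q $ i) p
      + T p $ k * pd c i (pd c k (\<lambda>q. X q $ i)) p)"
    by (simp add: pd_sum[OF c] pd_mult[OF c] smooth_in_mult[OF c(1)] smooth_in_pd[OF c(1)] sX sT)
  also have "\<dots> = (\<Sum>i\<in>UNIV. \<Sum>k\<in>UNIV. T p $ k * pd c i (pd c k (\<lambda>q. X q $ i)) p)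
      + (\<Sum>i\<in>UNIV. \<Sum>k\<in>UNIV. pd c i (\<lambda>q. T q $ k) p * pd c k (\<lambda>q. X q $ i) p)"
    by (simp add: sum.distrib)
  also have "(\<Sum>i\<in>UNIV. \<Sum>k\<in>UNIV. T p $ k * pd c i (pd c k (\<lambda>q. X q $ i)) p) =
      (\<Sum>i\<in>UNIV. \<Sum>k\<in>UNIV. T p $ k * pd c k (pd c i (\<lambda>q. X q $ i)) p)"
    by (intro sum.cong refl arg_cong2[where f="(*)"] pd_commute[OF c(1) sX c(2)])
  also have "\<dots> = dird c (T p) (\<lambda>q. trace (jacV c X q)) p"
    unfolding trace_def jacV_def vec_lambda_beta
    by (subst dird_sum[OF c]) (simp_all add: smooth_in_pd[OF c(1) sX] dird_def)
  also have "(\<Sum>i\<in>UNIV. \<Sum>k\<in>UNIV. pd c i (\<lambda>q. T q $ k) p * pd c k (\<lambda>q. X q $ i) p) =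
      trace (jacV c X p ** jacV c T p)"
    by (simp add: trace_def matrix_matrix_mult_def jacV_def mult.commute)
  finally show ?thesis .
qed

text \<open>
  The components of \<open>d (log (sqrt (det g)))\<close>.
\<close>

definition dlog_volume :: "('m, 'n) chart \<Rightarrow> 'm \<Rightarrow> 'k::real_normed_field ^ 'n" where
  "dlog_volume c q = (\<chi> k. (1 / 2) * trace (hk g c q ** dirM c (axis k 1) (gk g c) q))"

lemma divc_dlog_volume: "divc g c X q = trace (jacV c X q) + dot (dlog_volume c q) (X q)"
proof -
  have "trace (hk g c q ** dirM c (X q) (gk g c) q) =
    (\<Sum>i\<in>UNIV. \<Sum>l\<in>UNIV. \<Sum>k\<in>UNIV. X q $ k * (hk g c q $ i $ l * pd c k (\<lambda>q. gk g c q $ l $ i) q))"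
    by (simp add: trace_def matrix_matrix_mult_def dirM_def dird_def sum_distrib_left mult_ac)
  also have "\<dots> = (\<Sum>i\<in>UNIV. \<Sum>k\<in>UNIV. \<Sum>l\<in>UNIV. X q $ k * (hk g c q $ i $ l * pd c k (\<lambda>q. gk g c q $ l $ i) q))"
    by (intro sum.cong refl sum.swap)
  also have "\<dots> = (\<Sum>k\<in>UNIV. \<Sum>i\<in>UNIV. \<Sum>l\<in>UNIV. X q $ k * (hk g c q $ i $ l * pd c k (\<lambda>q. gk g c q $ l $ i) q))"
    by (rule sum.swap)
  also have "\<dots> = 2 * dot (dlog_volume c q) (X q)"
    by (simp add: dot_def dlog_volume_def trace_def matrix_matrix_mult_def dirM_def dird_axis
        sum_distrib_left sum_distrib_right mult_ac)
  finally show ?thesis by (simp add: divc_def)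
qed

lemma smoothV_dlog_volume: "c \<in> A \<Longrightarrow> smoothV c (dlog_volume c)"
  unfolding smoothV_def dlog_volume_def vec_lambda_beta
  by (intro allI smooth_in_intros smooth_in_trace smoothM_mult smoothM_hk smoothM_dirM smoothM_gk coord)
    (simp_all add: smoothV_def smooth_in_const coord)

text \<open>
  This 1-form is closed: its derivatives are \<open>tr (h \<partial>\<^sub>l\<partial>\<^sub>k g) - tr (h \<partial>\<^sub>l g h \<partial>\<^sub>k g)\<close> up to the factor \<open>1/2\<close>, symmetric in
  \<open>k\<close> and \<open>l\<close> because second derivatives commute and the trace is cyclic.
\<close>

lemma jacV_dlog_volume_symmetric:
  fixes p :: 'm
  assumes c: "c \<in> A" "p \<in> fst c"
  shows "transpose (jacV c (dlog_volume c) p) = (jacV c (dlog_volume c) p :: 'k::real_normed_field ^ 'n ^ 'n)"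
proof -
  note co = coord[OF c(1)]
  let ?G = "\<lambda>k q. dirM c (axis k 1) (gk g c) q :: 'k ^ 'n ^ 'n" and ?h = "\<lambda>q. hk g c q :: 'k ^ 'n ^ 'n"
  have sG: "smoothM c (?G k)" for k
    by (rule smoothM_dirM[OF co _ smoothM_gk[OF c(1)]]) (simp add: smoothV_def smooth_in_const)
  have sg: "smooth_in c (\<lambda>q. gk g c q $ i $ j :: 'k)" for i j
    by (rule smoothM_gk[OF c(1), unfolded smoothM_def, rule_format])
  have shG: "smoothM c (\<lambda>q. ?h q ** ?G k q)" for k by (rule smoothM_mult[OF co smoothM_hk[OF c(1)] sG])
  have GG: "dirM c (axis l 1) (?G k) p = dirM c (axis k 1) (?G l) p" for k l
    unfolding dirM_def dird_axis vec_lambda_beta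
    by (simp only: vec_eq_iff vec_lambda_beta) (intro allI pd_commute[OF co sg c(2)])
  have v: "2 * pd c l (\<lambda>q. dlog_volume c q $ k) p =
      - trace (?h p ** ?G l p ** ?h p ** ?G k p) + trace (?h p ** dirM c (axis l 1) (?G k) p)" for k l
  proof -
    have "pd c l (\<lambda>q. dlog_volume c q $ k) p = (1/2) * dird c (axis l 1) (\<lambda>q. trace (?h q ** ?G k q)) p"
      unfolding dlog_volume_def vec_lambda_beta
      by (subst pd_mult[OF co c(2) smooth_in_const smooth_in_trace[OF co shG]]) (simp add: dird_axis)
    also have "dird c (axis l 1) (\<lambda>q. trace (?h q ** ?G k q)) p = trace (dirM c (axis l 1) (\<lambda>q. ?h q ** ?G k q) p)"
      by (rule dird_trace[OF co c(2) shG])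
    also have "dirM c (axis l 1) (\<lambda>q. ?h q ** ?G k q) p =
        dirM c (axis l 1) ?h p ** ?G k p + ?h p ** dirM c (axis l 1) (?G k) p"
      by (rule dirM_mult[OF co c(2) smoothM_hk[OF c(1)] sG])
    also have "dirM c (axis l 1) ?h p = - (?h p ** ?G l p ** ?h p)"
      by (rule dirM_hk[OF c])
    also have "- (?h p ** ?G l p ** ?h p) ** ?G k p = - (?h p ** ?G l p ** ?h p ** ?G k p)"
      by (simp add: matrix_matrix_mult_def vec_eq_iff sum_negf)
    finally show ?thesis
      by (simp add: trace_add) (simp add: trace_def sum_negf sum_subtractf mult.commute)
  qed
  have "2 * pd c l (\<lambda>q. dlog_volume c q $ k) p = 2 * (pd c k (\<lambda>q. dlog_volume c q $ l) p :: 'k)" for k l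
  proof -
    have "trace (?h p ** ?G l p ** ?h p ** ?G k p) = trace ((?h p ** ?G l p) ** (?h p ** ?G k p))"
      by (simp only: matrix_mul_assoc)
    also have "\<dots> = trace ((?h p ** ?G k p) ** (?h p ** ?G l p))" by (rule trace_mul_sym)
    finally show ?thesis unfolding v by (simp only: matrix_mul_assoc GG[of l k])
  qed
  then have "pd c l (\<lambda>q. dlog_volume c q $ k) p = (pd c k (\<lambda>q. dlog_volume c q $ l) p :: 'k)" for k l
    by simp
  then show ?thesis unfolding transpose_def jacV_def vec_eq_iff vec_lambda_beta by blast
qed

text \<open>
  Second derivatives combine to derivatives of the divergences, products of two first derivatives cancel
  by cyclicity of the trace, and the terms with derivatives of \<open>dlog_volume\<close> cancel because it is closed.
\<close>

lemma divc_bracket: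
  assumes c: "c \<in> A" "p \<in> fst c" and X: "smoothV c X" and T: "smoothV c T"
  shows "divc g c (\<lambda>q. dirV c (T q) X q - dirV c (X q) T q) p =
    dird c (T p) (divc g c X) p - dird c (X p) (divc g c T) p"
proof -
  note co = coord[OF c(1)]
  let ?v = "dlog_volume c"
  note sv = smoothV_dlog_volume[OF c(1)]
  have dd: "dird c t (divc g c Y) p = dird c t (\<lambda>q. trace (jacV c Y q)) p
     + (dot (dirV c t ?v p) (Y p) + dot (?v p) (dirV c t Y p))" if Y: "smoothV c Y" for t Y
  proof -
    have "dird c t (\<lambda>q. trace (jacV c Y q) + dot (?v q) (Y q)) p =
      dird c t (\<lambda>q. trace (jacV c Y q)) p + dird c t (\<lambda>q. dot (?v q) (Y q)) p"
      unfolding dird_def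
      by (simp add: pd_add[OF co c(2) smooth_in_trace[OF co smoothM_jacV[OF co Y]] smooth_in_dot[OF co sv Y]]
          sum.distrib algebra_simps)
    then show ?thesis
      unfolding dird_dot[OF co c(2) sv Y] divc_dlog_volume .
  qed
  have sym: "dot (dirV c (T p) ?v p) (X p) = dot (dirV c (X p) ?v p) (T p)"
    unfolding jacV_vector[symmetric]
    by (simp only: dot_matrix jacV_dlog_volume_symmetric[OF c] dot_commute[of "T p"])
  show ?thesis
    unfolding divc_dlog_volume[of c "\<lambda>q. dirV c (T q) X q - dirV c (X q) T q"]
      jacV_diff[OF co c(2) smoothV_dirV[OF co T X] smoothV_dirV[OF co X T]] trace_sub
      trace_jacV_direction[OF co c(2) X T] trace_jacV_direction[OF co c(2) T X] dd[OF X] dd[OF T] sym dot_diff_right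
    by (simp add: trace_mul_sym[of "jacV c X p"])
qed

lemma divc_diff:
  assumes c: "c \<in> A" "p \<in> fst c" and X: "smoothV c X" and T: "smoothV c T"
  shows "divc g c (\<lambda>q. X q - T q) p = divc g c X p - divc g c T p"
  unfolding divc_dlog_volume jacV_diff[OF coord[OF c(1)] c(2) X T] trace_sub dot_diff_right
  by simp

lemma divc_scale:
  assumes c: "c \<in> A" "p \<in> fst c" and X: "smoothV c X" and f: "smooth_in c f"
  shows "divc g c (\<lambda>q. f q *s X q) p = f p * divc g c X p + dird c (X p) f p"
  unfolding divc_dlog_volume jacV_scale[OF coord[OF c(1)] c(2) f X] dot_scale_right
  by (simp add: algebra_simps)

lemma lie_metric_eq: "lie_metric X g c p =
  dirM c (X c p) (gk g c) p + transpose (jacV c (X c) p) ** gk g c p + gk g c p ** jacV c (X c) p"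
  if "c \<in> A" "p \<in> fst c" for X :: "('m, 'n, 'k::real_normed_field) field"
proof -
  have "pd c k (\<lambda>q. gk g c q $ i $ j) p = (of_real (pd c k (\<lambda>q. g c q $ i $ j) p) :: 'k)" for i j k
    unfolding gk_def kmat_def vec_lambda_beta
    by (rule pd_of_real[OF coord[OF that(1)] that(2) metric_smooth[OF that(1)]])
  then show ?thesis
    by (simp add: vec_eq_iff lie_metric_def dirM_def dird_def transpose_def matrix_matrix_mult_def jacV_def
       sum.distrib) (simp add: gk_def kmat_def scaleR_conv_of_real mult.commute)
qed

lemma dird_sharp:
  assumes f: "smooth_fun A f" and w: "one_form A \<omega>" and c: "c \<in> A" "p \<in> fst c"
  shows "dird c (sharp g \<omega> c p) f p = inv_metric A g (ext_d A f) \<omega> p"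
  unfolding inv_metric_eq[OF one_form_ext_d[OF f] w c]
  by (simp add: dird_eq_dot sharp_eq ext_d_eq[OF c] dot_commute)

end

section \<open>Conformal Killing fields\<close>

locale conformal = riemannian A g for A :: "('m::topological_space, 'n::finite) chart set" and g +
  fixes \<tau> :: "('m, 'n, 'k::real_normed_field) field" and \<phi> :: "'m \<Rightarrow> 'k"
  assumes tau: "vector_field A \<tau>" and phi: "smooth_fun A \<phi>"
    and killing: "\<And>c p i j. c \<in> A \<Longrightarrow> p \<in> fst c \<Longrightarrow> lie_metric \<tau> g c p $ i $ j = \<phi> p * of_real (g c p $ i $ j)"
begin

lemma killing_matrix:
  assumes "c \<in> A" "p \<in> fst c"
  shows "dirM c (\<tau> c p) (gk g c) p + transpose (jacV c (\<tau> c) p) ** gk g c p + gk g c p ** jacV c (\<tau> c) p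
    = mat (\<phi> p) ** gk g c p"
proof -
  have "(mat (\<phi> p) ** gk g c p) $ i $ j = \<phi> p * of_real (g c p $ i $ j)" for i j
    by (simp add: matrix_matrix_mult_def mat_def if_distrib if_distribR sum.delta gk_def kmat_def cong: if_cong)
  then show ?thesis
    unfolding lie_metric_eq[OF assms, symmetric] vec_eq_iff using killing[OF assms] by simp
qed

text \<open>
  Multiply the conformal Killing equation by the inverse metric from both sides.
\<close>

lemma dirM_hk_killing:
  assumes "c \<in> A" "p \<in> fst c"
  shows "dirM c (\<tau> c p) (hk g c) p =
    hk g c p ** transpose (jacV c (\<tau> c) p) + jacV c (\<tau> c) p ** hk g c p - mat (\<phi> p) ** hk g c p"
proof -
  let ?h = "hk g c p :: 'k ^ 'n ^ 'n" and ?P = "jacV c (\<tau> c) p" and ?g = "gk g c p :: 'k ^ 'n ^ 'n"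
  have "dirM c (\<tau> c p) (gk g c) p = mat (\<phi> p) ** ?g - transpose ?P ** ?g - ?g ** ?P"
    using killing_matrix[OF assms] by (simp add: algebra_simps)
  then have "dirM c (\<tau> c p) (hk g c) p = - (?h ** (mat (\<phi> p) ** ?g - transpose ?P ** ?g - ?g ** ?P) ** ?h)"
    unfolding dirM_hk[OF assms] by simp
  also have "?h ** (mat (\<phi> p) ** ?g - transpose ?P ** ?g - ?g ** ?P) ** ?h =
     ?h ** mat (\<phi> p) ** (?g ** ?h) - ?h ** transpose ?P ** (?g ** ?h) - (?h ** ?g) ** ?P ** ?h"
    by (simp only: matrix_diff_ldistrib matrix_diff_rdistrib matrix_mul_assoc)
  also have "\<dots> = ?h ** mat (\<phi> p) - ?h ** transpose ?P - ?P ** ?h"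
    by (simp only: gk_hk[OF assms] matrix_mul_rid matrix_mul_lid)
  finally show ?thesis by (simp add: mat_commute[of _ ?h])
qed

text \<open>
  Half the trace of the conformal Killing equation.
\<close>

lemma divergence_killing:
  assumes "c \<in> A" "p \<in> fst c"
  shows "divc g c (\<tau> c) p = of_nat CARD('n) / 2 * \<phi> p"
proof -
  let ?h = "hk g c p :: 'k ^ 'n ^ 'n" and ?P = "jacV c (\<tau> c) p" and ?g = "gk g c p :: 'k ^ 'n ^ 'n"
  have "?h ** dirM c (\<tau> c p) (gk g c) p + ?h ** (transpose ?P ** ?g) + ?h ** (?g ** ?P) = ?h ** (mat (\<phi> p) ** ?g)"
    by (simp only: killing_matrix[OF assms, symmetric] matrix_add_ldistrib)
  moreover have "?h ** (?g ** ?P) = ?P"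
    by (simp only: matrix_mul_assoc gk_hk[OF assms] matrix_mul_lid)
  moreover have "?h ** (mat (\<phi> p) ** ?g) = mat (\<phi> p) ** mat 1"
    by (simp only: mat_commute[of "\<phi> p" ?g] matrix_mul_assoc gk_hk[OF assms] matrix_mul_lid matrix_mul_rid)
  ultimately have "trace (?h ** dirM c (\<tau> c p) (gk g c) p) + trace (?h ** (transpose ?P ** ?g)) + trace ?P
     = trace (mat (\<phi> p) ** (mat 1 :: 'k ^ 'n ^ 'n))"
    by (metis (no_types) trace_add)
  moreover have "trace (?h ** (transpose ?P ** ?g)) = trace ?P"
  proof -
    have "trace (?h ** (transpose ?P ** ?g)) = trace ((transpose ?P ** ?g) ** ?h)" by (rule trace_mul_sym)
    then show ?thesis by (simp only: matrix_mul_assoc[symmetric] gk_hk[OF assms] matrix_mul_rid trace_transpose)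
  qed
  ultimately have "trace (?h ** dirM c (\<tau> c p) (gk g c) p) + 2 * trace ?P = \<phi> p * of_nat CARD('n)"
    by (simp only: trace_mat_mult trace_I) (simp add: algebra_simps)
  then show ?thesis by (simp add: divc_def field_simps)
qed

text \<open>
  The inverse metric has weight \<open>-\<phi>\<close> under the Lie derivative along \<open>\<tau>\<close>.
\<close>

lemma apply_field_inv_metric:
  assumes w: "one_form A \<omega>" and e: "one_form A \<eta>"
  shows "apply_field A \<tau> (inv_metric A g \<omega> \<eta>) p =
    inv_metric A g (lie_form \<tau> \<omega>) \<eta> p + inv_metric A g \<omega> (lie_form \<tau> \<eta>) p - \<phi> p * inv_metric A g \<omega> \<eta> p"
proof -
  define c where "c = chart_at A p"
  have c: "c \<in> A" "p \<in> fst c" using chart_at by (auto simp: c_def)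
  note co = coord[OF c(1)]
  note sw = one_form_smooth[OF w c(1)] and se = one_form_smooth[OF e c(1)]
  let ?t = "\<tau> c p" and ?h = "hk g c p :: 'k ^ 'n ^ 'n" and ?P = "jacV c (\<tau> c) p"
  let ?w = "\<omega> c p" and ?e = "\<eta> c p"
  have she: "smoothV c (\<lambda>q. hk g c q *v \<eta> c q)" by (rule smoothV_mult[OF co smoothM_hk[OF c(1)] se])
  have "apply_field A \<tau> (inv_metric A g \<omega> \<eta>) p = dird c ?t (inv_metric A g \<omega> \<eta>) p"
    by (rule apply_field_eq[OF tau smooth_fun_inv_metric[OF w e] c])
  also have "\<dots> = dird c ?t (\<lambda>q. dot (\<omega> c q) (hk g c q *v \<eta> c q)) p"
    by (rule dird_cong[OF co c(2) smooth_funD[OF smooth_fun_inv_metric[OF w e] c(1)]])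
      (rule inv_metric_eq[OF w e c(1)])
  also have "\<dots> = dot (dirV c ?t (\<omega> c) p) (?h *v ?e) + dot ?w (dirV c ?t (\<lambda>q. hk g c q *v \<eta> c q) p)"
    by (rule dird_dot[OF co c(2) sw she])
  also have "dirV c ?t (\<lambda>q. hk g c q *v \<eta> c q) p = dirM c ?t (hk g c) p *v ?e + ?h *v dirV c ?t (\<eta> c) p"
    by (rule dirV_mult[OF co c(2) smoothM_hk[OF c(1)] se])
  also have "dirM c ?t (hk g c) p *v ?e = ?h *v (transpose ?P *v ?e) + ?P *v (?h *v ?e) - \<phi> p *s (?h *v ?e)"
    by (simp only: dirM_hk_killing[OF c] matrix_vector_mult_diff_rdistrib matrix_vector_mult_add_rdistrib
        matrix_vector_mul_assoc[symmetric] mat_vector)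
  also have "dirV c ?t (\<omega> c) p = lie_form \<tau> \<omega> c p - transpose ?P *v ?w"
    by (simp add: lie_form_eq)
  also have "dirV c ?t (\<eta> c) p = lie_form \<tau> \<eta> c p - transpose ?P *v ?e"
    by (simp add: lie_form_eq)
  finally have "apply_field A \<tau> (inv_metric A g \<omega> \<eta>) p =
      dot (lie_form \<tau> \<omega> c p) (?h *v ?e) + dot ?w (?h *v lie_form \<tau> \<eta> c p) - \<phi> p * dot ?w (?h *v ?e)"
    by (simp add: matrix_vector_mult_diff_distrib dot_add_right dot_add_left dot_diff_left dot_diff_right
        dot_scale_right dot_matrix[of "transpose ?P"] del: transpose_matrix_vector)
  then show ?thesis
    by (simp only: inv_metric_eq[OF w e c] inv_metric_eq[OF one_form_lie_form[OF tau w] e c]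
        inv_metric_eq[OF w one_form_lie_form[OF tau e] c])
qed

text \<open>
  Both sides have the components \<open>\<partial>\<^sub>i (\<tau>\<^sup>j \<partial>\<^sub>j f)\<close>, by the symmetry of second derivatives.
\<close>

lemma lie_form_ext_d:
  assumes f: "smooth_fun A f"
  shows "lie_form \<tau> (ext_d A f) = ext_d A (apply_field A \<tau> f)"
proof (intro ext)
  fix c p
  show "lie_form \<tau> (ext_d A f) c p = ext_d A (apply_field A \<tau> f) c p"
  proof (cases "c \<in> A \<and> p \<in> fst c")
    case False
    then have "\<tau> c p = 0" "ext_d A f c p = 0" using vector_field_zero[OF tau] by (auto simp: ext_d_def)
    then show ?thesis using False by (auto simp: lie_form_def ext_d_def vec_eq_iff)
  next
    case True
    then have c: "c \<in> A" "p \<in> fst c" by auto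
    note co = coord[OF c(1)] and sf = smooth_funD[OF f c(1)] and st = vector_field_smooth[OF tau c(1)]
    have "ext_d A (apply_field A \<tau> f) c p = dV c (apply_field A \<tau> f) p" by (rule ext_d_eq[OF c])
    also have "\<dots> = dV c (\<lambda>q. dot (\<tau> c q) (dV c f q)) p"
      unfolding dV_def vec_eq_iff vec_lambda_beta
      by (intro allI pd_cong[OF co smooth_funD[OF smooth_fun_apply_field[OF tau f] c(1)] c(2)])
        (simp add: apply_field_eq[OF tau f c(1)] dird_def dot_def)
    also have "\<dots> = transpose (jacV c (\<tau> c) p) *v dV c f p + transpose (jacV c (dV c f) p) *v \<tau> c p"
      by (rule dV_dot[OF co c(2) st smoothV_dV[OF co sf]])
    also have "transpose (jacV c (dV c f) p) *v \<tau> c p = dirV c (\<tau> c p) (dV c f) p"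
      by (simp only: jacV_dV[OF co c(2) sf] jacV_vector)
    also have "dV c f p = ext_d A f c p" by (rule ext_d_eq[OF c, symmetric])
    also have "dirV c (\<tau> c p) (dV c f) p = dirV c (\<tau> c p) (ext_d A f c) p"
      by (rule dirV_cong[OF co c(2) smoothV_dV[OF co sf]]) (rule ext_d_eq[OF c(1), symmetric])
    finally show ?thesis by (simp add: lie_form_eq add.commute)
  qed
qed

text \<open>
  The Lie derivative of \<open>grad f = h df\<close>: the inverse metric \<open>h\<close> contributes its weight, and the Lie
  derivative commutes with \<open>d\<close>.
\<close>

lemma bracket_gradient:
  assumes f: "smooth_fun A f" and c: "c \<in> A" "p \<in> fst c"
  shows "dirV c (\<tau> c p) (sharp g (ext_d A f) c) p - dirV c (sharp g (ext_d A f) c p) (\<tau> c) p =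
    sharp g (ext_d A (apply_field A \<tau> f)) c p - \<phi> p *s sharp g (ext_d A f) c p"
proof -
  note co = coord[OF c(1)] and sd = one_form_smooth[OF one_form_ext_d[OF f] c(1)]
  let ?h = "hk g c p :: 'k ^ 'n ^ 'n" and ?P = "jacV c (\<tau> c) p" and ?d = "ext_d A f c p"
  have "dirV c (\<tau> c p) (sharp g (ext_d A f) c) p = dirM c (\<tau> c p) (hk g c) p *v ?d + ?h *v dirV c (\<tau> c p) (ext_d A f c) p"
    unfolding sharp_eq by (rule dirV_mult[OF co c(2) smoothM_hk[OF c(1)] sd])
  also have "dirM c (\<tau> c p) (hk g c) p *v ?d = ?h *v (transpose ?P *v ?d) + ?P *v (?h *v ?d) - \<phi> p *s (?h *v ?d)"
    by (simp only: dirM_hk_killing[OF c] matrix_vector_mult_diff_rdistrib matrix_vector_mult_add_rdistrib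
        matrix_vector_mul_assoc[symmetric] mat_vector)
  also have "dirV c (\<tau> c p) (ext_d A f c) p = ext_d A (apply_field A \<tau> f) c p - transpose ?P *v ?d"
    unfolding lie_form_ext_d[OF f, symmetric] by (simp add: lie_form_eq)
  finally have "dirV c (\<tau> c p) (sharp g (ext_d A f) c) p =
      ?P *v (?h *v ?d) + (?h *v ext_d A (apply_field A \<tau> f) c p - \<phi> p *s (?h *v ?d))"
    by (simp add: matrix_vector_mult_diff_distrib del: transpose_matrix_vector)
  moreover have "dirV c (sharp g (ext_d A f) c p) (\<tau> c) p = ?P *v (?h *v ?d)"
    by (simp only: jacV_vector[symmetric] sharp_eq)
  ultimately show ?thesis by (simp add: sharp_eq)
qed

text \<open>
  Compute the divergence of \<open>[\<tau>, grad f]\<close> in two ways. The bracket formula contributes \<open>(d\<phi>, df)\<close> with the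
  factor \<open>n/2\<close>, coming from \<open>div \<tau> = n \<phi>/2\<close>; the product rule for \<open>\<phi> grad f\<close> contributes it with the factor \<open>1\<close>.
\<close>

lemma laplace_beltrami_conformal:
  assumes f: "smooth_fun A f"
  shows "laplace_beltrami A g (apply_field A \<tau> f) p =
    apply_field A \<tau> (laplace_beltrami A g f) p + \<phi> p * laplace_beltrami A g f p
    - (of_nat CARD('n) - 2) / 2 * inv_metric A g (ext_d A \<phi>) (ext_d A f) p"
proof -
  define c where "c = chart_at A p"
  have c: "c \<in> A" "p \<in> fst c" using chart_at by (auto simp: c_def)
  note co = coord[OF c(1)] and st = vector_field_smooth[OF tau c(1)] and sphi = smooth_funD[OF phi c(1)]
  note df = one_form_ext_d[OF f] and dtf = one_form_ext_d[OF smooth_fun_apply_field[OF tau f]]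
  let ?G = "sharp g (ext_d A f) c" and ?H = "sharp g (ext_d A (apply_field A \<tau> f)) c"
  note sG = vector_field_smooth[OF vector_field_sharp[OF df] c(1)]
    and sH = vector_field_smooth[OF vector_field_sharp[OF dtf] c(1)]
  have sphiG: "smoothV c (\<lambda>q. \<phi> q *s ?G q)"
    using sG sphi by (simp add: smoothV_def smooth_in_mult[OF co])
  let ?B = "\<lambda>q. dirV c (\<tau> c q) ?G q - dirV c (?G q) (\<tau> c) q"
  have sB: "smoothV c ?B" by (intro smoothV_diff smoothV_dirV co sG st)
  \<comment> \<open>The bracket formula, to be compared with the divergence of \<open>bracket_gradient\<close>.\<close>
  have 1: "divc g c ?B p = dird c (\<tau> c p) (divc g c ?G) p - dird c (?G p) (divc g c (\<tau> c)) p"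
    by (rule divc_bracket[OF c sG st])
  have "divc g c ?B p = divc g c (\<lambda>q. ?H q - \<phi> q *s ?G q) p"
    unfolding divc_def bracket_gradient[OF f c]
    by (subst jacV_cong[OF co c(2) sB bracket_gradient[OF f c(1)]]) simp_all
  also have "\<dots> = divc g c ?H p - divc g c (\<lambda>q. \<phi> q *s ?G q) p"
    by (rule divc_diff[OF c sH sphiG])
  also have "divc g c (\<lambda>q. \<phi> q *s ?G q) p = \<phi> p * divc g c ?G p + dird c (?G p) \<phi> p"
    by (rule divc_scale[OF c sG sphi])
  finally have 2: "divc g c ?B p = divc g c ?H p - (\<phi> p * divc g c ?G p + dird c (?G p) \<phi> p)" .
  have LB: "smooth_fun A (laplace_beltrami A g f)" by (rule smooth_fun_laplace_beltrami[OF f])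
  have 3: "dird c (\<tau> c p) (divc g c ?G) p = apply_field A \<tau> (laplace_beltrami A g f) p"
    unfolding apply_field_eq[OF tau LB c]
    by (rule dird_cong[OF co c(2) smooth_in_divc[OF c(1) sG]]) (rule laplace_beltrami_eq[OF f c(1), symmetric])
  have 4: "dird c (?G p) (divc g c (\<tau> c)) p = of_nat CARD('n) / 2 * dird c (?G p) \<phi> p"
  proof -
    have "dird c (?G p) (divc g c (\<tau> c)) p = dird c (?G p) (\<lambda>q. of_nat CARD('n) / 2 * \<phi> q) p"
      by (rule dird_cong[OF co c(2) smooth_in_divc[OF c(1) st]]) (rule divergence_killing[OF c(1)])
    also have "\<dots> = of_nat CARD('n) / 2 * dird c (?G p) \<phi> p"
      by (subst dird_mult[OF co c(2) smooth_in_const sphi]) (simp add: dird_def)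
    finally show ?thesis .
  qed
  show ?thesis
    using 1 2 unfolding 3 4 dird_sharp[OF phi df c] laplace_beltrami_eq[OF f c, symmetric]
      laplace_beltrami_eq[OF smooth_fun_apply_field[OF tau f] c, symmetric]
    by (simp add: algebra_simps diff_divide_distrib)
qed

end

section \<open>Skew polynomials\<close>

text \<open>
  An element \<open>w\<close> stands for the polynomial \<open>\<Sum>n. w n t\<^sup>n\<close> with coefficients on the left.
\<close>

definition finsup :: "'v::zero set \<Rightarrow> (nat \<Rightarrow> 'v) set" where
  "finsup N = {w. (\<forall>n. w n \<in> N) \<and> finite {n. w n \<noteq> 0}}"

definition const_poly :: "'v::zero \<Rightarrow> nat \<Rightarrow> 'v" where
  "const_poly v n = (if n = 0 then v else 0)"

definition shift :: "(nat \<Rightarrow> 'v::zero) \<Rightarrow> nat \<Rightarrow> 'v" where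
  "shift w n = (case n of 0 \<Rightarrow> 0 | Suc k \<Rightarrow> w k)"

text \<open>
  Left multiplication by \<open>t\<close> on polynomials, when \<open>[v, t] = D v\<close> for coefficients \<open>v\<close>:
  \<open>t (v t\<^sup>n) = v t\<^sup>n\<^sup>+\<^sup>1 - D v t\<^sup>n\<close>.
\<close>

definition skew_t :: "('v::ab_group_add \<Rightarrow> 'v) \<Rightarrow> (nat \<Rightarrow> 'v) \<Rightarrow> nat \<Rightarrow> 'v" where
  "skew_t D w n = shift w n - D (w n)"

definition coeff_act :: "('f \<Rightarrow> 'v \<Rightarrow> 'v) \<Rightarrow> 'f \<Rightarrow> (nat \<Rightarrow> 'v) \<Rightarrow> nat \<Rightarrow> 'v" where
  "coeff_act la f w n = la f (w n)"

text \<open>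
  The left action of \<open>\<Sum>m. a\<^sub>m t\<^sup>m\<close> on polynomials with coefficients in a module; for the ring itself this is
  the product of skew polynomials.
\<close>

definition skew_act :: "('f::zero \<Rightarrow> 'v::ab_group_add \<Rightarrow> 'v) \<Rightarrow> ('v \<Rightarrow> 'v) \<Rightarrow> (nat \<Rightarrow> 'f) \<Rightarrow> (nat \<Rightarrow> 'v) \<Rightarrow> nat \<Rightarrow> 'v" where
  "skew_act la D a w = (\<Sum>m\<in>{m. a m \<noteq> 0}. coeff_act la (a m) ((skew_t D ^^ m) w))"

lemma sum_fun_apply: "(\<Sum>i\<in>I. f i) n = (\<Sum>i\<in>I. f i n)"
  by (induction I rule: infinite_finite_induct) auto

lemma finsup_bound:
  assumes "w \<in> finsup N"
  obtains m where "\<forall>n\<ge>m. w n = 0"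
proof -
  have "finite {n. w n \<noteq> 0}" using assms by (simp add: finsup_def)
  then obtain k where "\<forall>n\<in>{n. w n \<noteq> 0}. n \<le> k" using finite_nat_set_iff_bounded_le by blast
  then have "\<forall>n\<ge>Suc k. w n = 0" by (metis (mono_tags) mem_Collect_eq not_less_eq_eq)
  then show ?thesis using that by blast
qed

lemma finsupI: "(\<And>n. w n \<in> N) \<Longrightarrow> (\<And>n. n \<ge> m \<Longrightarrow> w n = 0) \<Longrightarrow> w \<in> finsup N"
  unfolding finsup_def by (auto intro: finite_subset[of _ "{..<m}"]) (metis (mono_tags) finite_lessThan finite_subset lessThan_iff linorder_not_less mem_Collect_eq subsetI)

lemma shift_0 [simp]: "shift w 0 = 0" and shift_Suc [simp]: "shift w (Suc n) = w n"
  by (simp_all add: shift_def)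

lemma finsup_nth: "w \<in> finsup N \<Longrightarrow> w n \<in> N"
  by (simp add: finsup_def)

lemma const_poly_finsup: "0 \<in> N \<Longrightarrow> v \<in> N \<Longrightarrow> const_poly v \<in> finsup N"
  by (rule finsupI[of _ _ 1]) (auto simp: const_poly_def)

lemma shift_finsup:
  assumes "0 \<in> N" "w \<in> finsup N"
  shows "shift w \<in> finsup N"
proof -
  obtain m where m: "\<forall>n\<ge>m. w n = 0" using finsup_bound[OF assms(2)] by blast
  show ?thesis
  proof (rule finsupI[of _ _ "Suc m"])
    show "shift w n \<in> N" for n using assms finsup_nth by (cases n) auto
    show "shift w n = 0" if "n \<ge> Suc m" for n using m that by (cases n) auto
  qed
qed

lemma shift_add: "shift (w + v) = shift w + shift (v :: nat \<Rightarrow> 'v::monoid_add)"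
  by (rule ext) (simp add: shift_def split: nat.split)

lemma shift_sum: "shift (\<Sum>i\<in>I. w i) = (\<Sum>i\<in>I. shift (w i :: nat \<Rightarrow> 'v::comm_monoid_add))"
proof -
  have "shift (0 :: nat \<Rightarrow> 'v) = 0" by (rule ext) (simp add: shift_def split: nat.split)
  then show ?thesis by (induction I rule: infinite_finite_induct) (simp_all add: shift_add)
qed

lemma finsup_decomp: "w = const_poly (w 0) + shift (\<lambda>n. w (Suc n) :: 'v::monoid_add)"
  by (rule ext) (simp add: shift_def const_poly_def split: nat.split)

text \<open>
  Every polynomial of degree at most \<open>m + 1\<close> is \<open>v + w t\<close> with \<open>w\<close> of degree at most \<open>m\<close>.
\<close>

lemma finsup_induct [consumes 1, case_names zero step]:
  fixes w :: "nat \<Rightarrow> 'v::monoid_add"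
  assumes w: "w \<in> finsup N"
    and zero: "P 0"
    and step: "\<And>v w. v \<in> N \<Longrightarrow> w \<in> finsup N \<Longrightarrow> P w \<Longrightarrow> P (const_poly v + shift w)"
  shows "P w"
proof -
  have "P w" if "w \<in> finsup N" "\<forall>n\<ge>m. w n = 0" for m w
    using that
  proof (induction m arbitrary: w)
    case 0
    then have "w = 0" by (simp add: fun_eq_iff)
    then show ?case using zero by (simp only:)
  next
    case (Suc m)
    let ?w = "\<lambda>n. w (Suc n)"
    have 1: "?w \<in> finsup N" by (rule finsupI[of _ _ m]) (use Suc.prems finsup_nth in auto)
    have "P (const_poly (w 0) + shift ?w)"
      by (rule step[OF finsup_nth[OF Suc.prems(1)] 1 Suc.IH[OF 1]]) (use Suc.prems(2) in auto)
    then show ?case by (simp only: finsup_decomp[of w, symmetric])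
  qed
  then show ?thesis using w finsup_bound[OF w] by metis
qed

text \<open>
  Carriers are subsets closed under the operations of a type class. All sums then exist in the
  type, and only membership depends on the carrier.
\<close>

locale group_carrier =
  fixes N :: "'v::ab_group_add set"
  assumes zero_in: "0 \<in> N" and add_in: "x \<in> N \<Longrightarrow> y \<in> N \<Longrightarrow> x + y \<in> N" and uminus_in: "x \<in> N \<Longrightarrow> - x \<in> N"
begin

lemma diff_in: "x \<in> N \<Longrightarrow> y \<in> N \<Longrightarrow> x - y \<in> N"
  using add_in[of x "- y"] uminus_in[of y] by simp

lemma sum_in: "(\<And>i. i \<in> I \<Longrightarrow> f i \<in> N) \<Longrightarrow> (\<Sum>i\<in>I. f i) \<in> N"
  by (induction I rule: infinite_finite_induct) (auto intro: zero_in add_in)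

lemma sum_additive:
  fixes h :: "'v \<Rightarrow> 'u::ab_group_add"
  assumes h: "\<And>x y. x \<in> N \<Longrightarrow> y \<in> N \<Longrightarrow> h (x + y) = h x + h y"
    and f: "\<And>i. i \<in> I \<Longrightarrow> f i \<in> N"
  shows "h (\<Sum>i\<in>I. f i) = (\<Sum>i\<in>I. h (f i))"
proof -
  have h0: "h 0 = 0" using h[OF zero_in zero_in] by simp
  show ?thesis using f
    by (induction I rule: infinite_finite_induct) (simp_all add: h0 h sum_in)
qed

lemma additive_0:
  fixes h :: "'v \<Rightarrow> 'u::ab_group_add"
  assumes h: "\<And>x y. x \<in> N \<Longrightarrow> y \<in> N \<Longrightarrow> h (x + y) = h x + h y"
  shows "h 0 = 0"
  using h[OF zero_in zero_in] by simp

lemma additive_diff: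
  fixes h :: "'v \<Rightarrow> 'u::ab_group_add"
  assumes h: "\<And>x y. x \<in> N \<Longrightarrow> y \<in> N \<Longrightarrow> h (x + y) = h x + h y" and "x \<in> N" "y \<in> N"
  shows "h (x - y) = h x - h y"
  using h[of "x - y" y] diff_in assms by (simp add: algebra_simps)

lemma group_carrier_finsup: "group_carrier (finsup N)"
proof
  show "0 \<in> finsup N" by (rule finsupI[of _ _ 0]) (auto simp: zero_in)
  show "x + y \<in> finsup N" if xy: "x \<in> finsup N" "y \<in> finsup N" for x y
  proof -
    obtain m k where "\<forall>n\<ge>m. x n = 0" "\<forall>n\<ge>k. y n = 0" using finsup_bound[OF xy(1)] finsup_bound[OF xy(2)] by metis
    then show ?thesis by (intro finsupI[of _ _ "max m k"]) (auto simp: add_in finsup_nth xy)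
  qed
  show "- x \<in> finsup N" if x: "x \<in> finsup N" for x
  proof -
    obtain m where "\<forall>n\<ge>m. x n = 0" using finsup_bound[OF x] by metis
    then show ?thesis by (intro finsupI[of _ _ m]) (auto simp: uminus_in finsup_nth x)
  qed
qed

end

locale diff_ring = S: group_carrier S for S :: "'f::comm_ring_1 set" +
  fixes \<delta> :: "'f \<Rightarrow> 'f"
  assumes one_in: "1 \<in> S" and mult_in: "a \<in> S \<Longrightarrow> b \<in> S \<Longrightarrow> a * b \<in> S"
    and \<delta>_in: "a \<in> S \<Longrightarrow> \<delta> a \<in> S"
    and \<delta>_add: "a \<in> S \<Longrightarrow> b \<in> S \<Longrightarrow> \<delta> (a + b) = \<delta> a + \<delta> b"
    and \<delta>_mult: "a \<in> S \<Longrightarrow> b \<in> S \<Longrightarrow> \<delta> (a * b) = \<delta> a * b + a * \<delta> b"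
begin

lemma \<delta>_one: "\<delta> 1 = 0"
  using \<delta>_mult[OF one_in one_in] by simp

end

text \<open>
  The map \<open>D\<close> stands for the commutator \<open>[\<cdot>, t]\<close> on a module of coefficients.
\<close>

locale diff_module = diff_ring S \<delta> + N: group_carrier N
  for S :: "'f::comm_ring_1 set" and \<delta> and N :: "'v::ab_group_add set" +
  fixes la :: "'f \<Rightarrow> 'v \<Rightarrow> 'v" and D :: "'v \<Rightarrow> 'v"
  assumes la_in: "f \<in> S \<Longrightarrow> v \<in> N \<Longrightarrow> la f v \<in> N"
    and la_add: "f \<in> S \<Longrightarrow> v \<in> N \<Longrightarrow> w \<in> N \<Longrightarrow> la f (v + w) = la f v + la f w"
    and add_la: "f \<in> S \<Longrightarrow> h \<in> S \<Longrightarrow> v \<in> N \<Longrightarrow> la (f + h) v = la f v + la h v"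
    and one_la: "v \<in> N \<Longrightarrow> la 1 v = v"
    and mult_la: "f \<in> S \<Longrightarrow> h \<in> S \<Longrightarrow> v \<in> N \<Longrightarrow> la (f * h) v = la f (la h v)"
    and D_in: "v \<in> N \<Longrightarrow> D v \<in> N"
    and D_add: "v \<in> N \<Longrightarrow> w \<in> N \<Longrightarrow> D (v + w) = D v + D w"
    and D_la: "f \<in> S \<Longrightarrow> v \<in> N \<Longrightarrow> D (la f v) = la f (D v) + la (\<delta> f) v"
begin

abbreviation "T \<equiv> skew_t D"
abbreviation "cla \<equiv> coeff_act la"
abbreviation "act \<equiv> skew_act la D"

sublocale W: group_carrier "finsup N" by (rule N.group_carrier_finsup)

lemma la_0: "f \<in> S \<Longrightarrow> la f 0 = 0"
  using N.additive_0[of "la f"] la_add by blast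

lemma zero_la: "v \<in> N \<Longrightarrow> la 0 v = 0"
  using S.additive_0[of "\<lambda>f. la f v"] add_la by blast

lemma D_0: "D 0 = 0"
  using N.additive_0[of D] D_add by blast

lemma T_in: assumes w: "w \<in> finsup N" shows "T w \<in> finsup N"
proof -
  obtain m where "\<forall>n\<ge>m. w n = 0" using finsup_bound[OF w] by blast
  then have "(\<lambda>n. D (w n)) \<in> finsup N" by (intro finsupI[of _ _ m]) (auto simp: D_0 D_in finsup_nth[OF w])
  from W.diff_in[OF shift_finsup[OF N.zero_in w] this] show ?thesis
    by (rule back_subst[of "\<lambda>x. x \<in> finsup N"]) (simp add: fun_eq_iff skew_t_def)
qed

lemma T_pow_in: "w \<in> finsup N \<Longrightarrow> (T ^^ m) w \<in> finsup N"
  by (induction m) (auto simp: T_in)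

lemma T_add: "w \<in> finsup N \<Longrightarrow> v \<in> finsup N \<Longrightarrow> T (w + v) = T w + T v"
  by (rule ext) (simp add: skew_t_def shift_add D_add finsup_nth)

lemma T_pow_add: "w \<in> finsup N \<Longrightarrow> v \<in> finsup N \<Longrightarrow> (T ^^ m) (w + v) = (T ^^ m) w + (T ^^ m) v"
  by (induction m) (auto simp: T_add T_pow_in)

lemma T_shift: "T (shift w) = shift (T w)"
  by (rule ext) (simp add: skew_t_def shift_def D_0 split: nat.split)

lemma T_pow_shift: "(T ^^ m) (shift w) = shift ((T ^^ m) w)"
  by (induction m) (auto simp: T_shift)

lemma cla_in: assumes f: "f \<in> S" and w: "w \<in> finsup N" shows "cla f w \<in> finsup N"
proof -
  obtain m where "\<forall>n\<ge>m. w n = 0" using finsup_bound[OF w] by blast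
  then show ?thesis by (intro finsupI[of _ _ m]) (auto simp: coeff_act_def la_0 la_in f finsup_nth[OF w])
qed

lemma cla_add: "f \<in> S \<Longrightarrow> w \<in> finsup N \<Longrightarrow> v \<in> finsup N \<Longrightarrow> cla f (w + v) = cla f w + cla f v"
  and add_cla: "f \<in> S \<Longrightarrow> h \<in> S \<Longrightarrow> w \<in> finsup N \<Longrightarrow> cla (f + h) w = cla f w + cla h w"
  and one_cla: "w \<in> finsup N \<Longrightarrow> cla 1 w = w"
  and zero_cla: "w \<in> finsup N \<Longrightarrow> cla 0 w = 0"
  and mult_cla: "f \<in> S \<Longrightarrow> h \<in> S \<Longrightarrow> w \<in> finsup N \<Longrightarrow> cla (f * h) w = cla f (cla h w)"
  by (auto simp: coeff_act_def fun_eq_iff finsup_nth la_add add_la one_la zero_la mult_la)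

lemma cla_shift: "f \<in> S \<Longrightarrow> cla f (shift w) = shift (cla f w)"
  by (rule ext) (simp add: coeff_act_def shift_def la_0 split: nat.split)

lemma T_cla: "f \<in> S \<Longrightarrow> w \<in> finsup N \<Longrightarrow> T (cla f w) = cla f (T w) - cla (\<delta> f) w"
proof (rule ext)
  fix n assume f: "f \<in> S" and w: "w \<in> finsup N"
  have "la f (shift w n - D (w n)) = la f (shift w n) - la f (D (w n))"
    by (rule N.additive_diff[OF la_add[OF f]])
      (use finsup_nth[OF shift_finsup[OF N.zero_in w]] D_in finsup_nth[OF w] in auto)
  moreover have "shift (cla f w) n = la f (shift w n)"
    by (simp only: cla_shift[OF f, symmetric]) (simp add: coeff_act_def)
  ultimately show "T (cla f w) n = (cla f (T w) - cla (\<delta> f) w) n"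
    by (simp add: skew_t_def[of D "cla f w"]) (simp add: coeff_act_def D_la f finsup_nth[OF w] skew_t_def)
qed

lemma act_upto:
  assumes "a \<in> finsup S" "w \<in> finsup N" "\<forall>n\<ge>k. a n = 0"
  shows "act a w = (\<Sum>m<k. cla (a m) ((T ^^ m) w))"
  unfolding skew_act_def
  by (rule sum.mono_neutral_left) (use assms zero_cla[OF T_pow_in[OF assms(2)]] in \<open>auto simp: not_le[symmetric]\<close>)

lemma act_in:
  assumes "a \<in> finsup S" "w \<in> finsup N"
  shows "act a w \<in> finsup N"
  unfolding skew_act_def using assms by (intro W.sum_in cla_in T_pow_in) (auto simp: finsup_nth)

lemma act_add:
  assumes "a \<in> finsup S" "w \<in> finsup N" "v \<in> finsup N"
  shows "act a (w + v) = act a w + act a v"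
  unfolding skew_act_def using assms
  by (simp add: T_pow_add cla_add T_pow_in finsup_nth sum.distrib)

lemma add_act:
  assumes "a \<in> finsup S" "b \<in> finsup S" "w \<in> finsup N"
  shows "act (a + b) w = act a w + act b w"
proof -
  interpret B: group_carrier "finsup S" by (rule S.group_carrier_finsup)
  obtain m k where mk: "\<forall>n\<ge>m. a n = 0" "\<forall>n\<ge>k. b n = 0" using finsup_bound assms by metis
  let ?m = "max m k"
  have "act (a + b) w = (\<Sum>m<?m. cla ((a + b) m) ((T ^^ m) w))" by (rule act_upto) (use mk assms B.add_in in auto)
  moreover have "act a w = (\<Sum>m<?m. cla (a m) ((T ^^ m) w))" by (rule act_upto) (use mk assms in auto)
  moreover have "act b w = (\<Sum>m<?m. cla (b m) ((T ^^ m) w))" by (rule act_upto) (use mk assms in auto)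
  ultimately show ?thesis using assms by (simp add: add_cla T_pow_in finsup_nth sum.distrib)
qed

lemma act_const: "f \<in> S \<Longrightarrow> w \<in> finsup N \<Longrightarrow> act (const_poly f) w = cla f w"
  by (subst act_upto[of _ _ 1]) (auto simp: const_poly_finsup S.zero_in const_poly_def)

lemma act_shift_left:
  assumes "a \<in> finsup S" "w \<in> finsup N"
  shows "act (shift a) w = act a (T w)"
proof -
  obtain k where k: "\<forall>n\<ge>k. a n = 0" using finsup_bound assms by metis
  have "\<forall>n\<ge>Suc k. shift a n = 0" using k by (auto simp: shift_def split: nat.split)
  then have "act (shift a) w = (\<Sum>m<Suc k. cla (shift a m) ((T ^^ m) w))"
    by (intro act_upto shift_finsup assms S.zero_in)
  also have "\<dots> = (\<Sum>m<k. cla (a m) ((T ^^ m) (T w)))"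
    unfolding sum.lessThan_Suc_shift using assms by (simp add: zero_cla funpow_swap1)
  also have "\<dots> = act a (T w)" by (rule act_upto[symmetric, OF assms(1) T_in[OF assms(2)] k])
  finally show ?thesis .
qed

lemma act_shift_right:
  assumes "a \<in> finsup S" "w \<in> finsup N"
  shows "act a (shift w) = shift (act a w)"
  unfolding skew_act_def shift_sum using assms
  by (simp add: T_pow_shift cla_shift finsup_nth)

lemma act_cla:
  assumes "f \<in> S" "a \<in> finsup S" "w \<in> finsup N"
  shows "act (\<lambda>n. f * a n) w = cla f (act a w)"
proof -
  obtain k where k: "\<forall>n\<ge>k. a n = 0" using finsup_bound assms by metis
  have fa: "(\<lambda>n. f * a n) \<in> finsup S" by (rule finsupI[of _ _ k]) (use assms k in \<open>auto simp: mult_in finsup_nth\<close>)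
  have "act (\<lambda>n. f * a n) w = (\<Sum>m<k. cla (f * a m) ((T ^^ m) w))" by (rule act_upto) (use k assms fa in auto)
  also have "\<dots> = (\<Sum>m<k. cla f (cla (a m) ((T ^^ m) w)))"
    using assms by (simp add: mult_cla T_pow_in finsup_nth)
  also have "\<dots> = cla f (\<Sum>m<k. cla (a m) ((T ^^ m) w))"
  proof (rule W.sum_additive[symmetric])
    show "cla f (x + y) = cla f x + cla f y" if "x \<in> finsup N" "y \<in> finsup N" for x y
      by (rule cla_add[OF assms(1) that])
  qed (use assms in \<open>auto intro: cla_in T_pow_in finsup_nth\<close>)
  also have "(\<Sum>m<k. cla (a m) ((T ^^ m) w)) = act a w" by (rule act_upto[symmetric]) (use k assms in auto)
  finally show ?thesis .
qed

end

context diff_ring begin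

lemma diff_module_self: "diff_module S \<delta> S (*) \<delta>"
  by unfold_locales (auto simp: mult_in algebra_simps \<delta>_in \<delta>_add \<delta>_mult)

sublocale B: diff_module S \<delta> S "(*)" \<delta> by (rule diff_module_self)

abbreviation "skew_mult \<equiv> skew_act (*) \<delta>"

lemma skew_t_const: "f \<in> S \<Longrightarrow> skew_t \<delta> (const_poly f) = shift (const_poly f) - const_poly (\<delta> f)"
  by (rule ext) (simp add: skew_t_def const_poly_def B.D_0)

end

context diff_module begin

lemma zero_act: "act 0 w = 0"
  by (simp add: skew_act_def)

lemma diff_act:
  assumes "a \<in> finsup S" "b \<in> finsup S" "w \<in> finsup N"
  shows "act (a - b) w = act a w - act b w"
  by (rule group_carrier.additive_diff[OF S.group_carrier_finsup, of "\<lambda>a. act a w"])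
    (use assms add_act in auto)

lemma act_diff:
  assumes "a \<in> finsup S" "w \<in> finsup N" "v \<in> finsup N"
  shows "act a (w - v) = act a w - act a v"
  by (rule W.additive_diff[of "act a"]) (use assms act_add in auto)

text \<open>
  Both sides are \<open>t b w\<close>. The induction over \<open>b\<close> needs the relation \<open>t f = f t - \<delta> f\<close>, which \<open>T_cla\<close> provides
  on the module.
\<close>

lemma act_T:
  assumes "b \<in> finsup S" "w \<in> finsup N"
  shows "act (skew_t \<delta> b) w = T (act b w)"
  using assms
proof (induction b arbitrary: w rule: finsup_induct)
  case zero
  have "skew_t \<delta> (0 :: nat \<Rightarrow> 'f) = 0" "T 0 = 0"
    by (auto simp: skew_t_def D_0 B.D_0 shift_def fun_eq_iff split: nat.split)
  then show "act (skew_t \<delta> 0) w = T (act 0 w)" by (simp only: zero_act)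
next
  case (step f b)
  have cf: "shift b \<in> finsup S" "shift (const_poly f) \<in> finsup S" "const_poly f \<in> finsup S" "const_poly (\<delta> f) \<in> finsup S"
    using step by (auto intro: shift_finsup const_poly_finsup S.zero_in \<delta>_in)
  have 1: "act (skew_t \<delta> (shift b)) w = T (act (shift b) w)"
    using step by (simp add: B.T_shift act_shift_left B.T_in T_in)
  have 2: "act (skew_t \<delta> (const_poly f)) w = T (act (const_poly f) w)"
    using step
    by (simp add: skew_t_const diff_act cf act_shift_left act_const T_in \<delta>_in T_cla)
  show "act (skew_t \<delta> (const_poly f + shift b)) w = T (act (const_poly f + shift b) w)"
    by (simp add: B.T_add B.T_in 1 2 T_add add_act cf act_in step.prems)
qed

lemma act_act:
  assumes "a \<in> finsup S" "b \<in> finsup S" "w \<in> finsup N"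
  shows "act (skew_mult a b) w = act a (act b w)"
  using assms
proof (induction a arbitrary: b rule: finsup_induct)
  case zero
  show "act (skew_mult 0 b) w = act 0 (act b w)" by (simp add: skew_act_def)
next
  case (step f a)
  have cf: "shift a \<in> finsup S" "const_poly f \<in> finsup S"
    using step by (auto intro: shift_finsup const_poly_finsup S.zero_in)
  have fb: "act (coeff_act (*) f b) w = cla f (act b w)"
    using act_cla[OF step(1) step.prems] by (simp add: coeff_act_def[abs_def])
  show "act (skew_mult (const_poly f + shift a) b) w = act (const_poly f + shift a) (act b w)" using step
    by (simp add: B.add_act cf add_act B.act_in act_in B.act_const act_const fb B.act_shift_left act_shift_left
        B.T_in act_T B.cla_in)
qed

end

locale diff_bimodule = diff_module S \<delta> N la D
  for S :: "'f::comm_ring_1 set" and \<delta> and N :: "'v::ab_group_add set" and la D +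
  fixes ra :: "'v \<Rightarrow> 'f \<Rightarrow> 'v"
  assumes ra_in: "f \<in> S \<Longrightarrow> v \<in> N \<Longrightarrow> ra v f \<in> N"
    and ra_add: "f \<in> S \<Longrightarrow> v \<in> N \<Longrightarrow> w \<in> N \<Longrightarrow> ra (v + w) f = ra v f + ra w f"
    and add_ra: "f \<in> S \<Longrightarrow> h \<in> S \<Longrightarrow> v \<in> N \<Longrightarrow> ra v (f + h) = ra v f + ra v h"
    and one_ra: "v \<in> N \<Longrightarrow> ra v 1 = v"
    and mult_ra: "f \<in> S \<Longrightarrow> h \<in> S \<Longrightarrow> v \<in> N \<Longrightarrow> ra v (f * h) = ra (ra v f) h"
    and la_ra: "f \<in> S \<Longrightarrow> h \<in> S \<Longrightarrow> v \<in> N \<Longrightarrow> ra (la f v) h = la f (ra v h)"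
    and D_ra: "f \<in> S \<Longrightarrow> v \<in> N \<Longrightarrow> D (ra v f) = ra (D v) f + ra v (\<delta> f)"
begin

text \<open>
  The right action moves \<open>b\<close> past the power of \<open>t\<close>: \<open>(v t\<^sup>n) b = v (t\<^sup>n b)\<close>.
\<close>

definition rmul :: "(nat \<Rightarrow> 'v) \<Rightarrow> (nat \<Rightarrow> 'f) \<Rightarrow> nat \<Rightarrow> 'v" where
  "rmul w b k = (\<Sum>n\<in>{n. w n \<noteq> 0}. ra (w n) ((skew_t \<delta> ^^ n) b k))"

lemma zero_ra: "f \<in> S \<Longrightarrow> ra 0 f = 0"
  using N.additive_0[of "\<lambda>v. ra v f"] ra_add by blast

lemma ra_0: "v \<in> N \<Longrightarrow> ra v 0 = 0"
  using S.additive_0[of "ra v"] add_ra by blast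

lemma T_pow_nth: "b \<in> finsup S \<Longrightarrow> (skew_t \<delta> ^^ n) b k \<in> S"
  by (rule finsup_nth[OF B.T_pow_in])

lemma ract_upto:
  assumes "w \<in> finsup N" "b \<in> finsup S" "\<forall>n\<ge>m. w n = 0"
  shows "rmul w b k = (\<Sum>n<m. ra (w n) ((skew_t \<delta> ^^ n) b k))"
  unfolding rmul_def
  by (rule sum.mono_neutral_left) (use assms zero_ra[OF T_pow_nth[OF assms(2)]] in \<open>auto simp: not_le[symmetric]\<close>)

lemma ract_nth: "w \<in> finsup N \<Longrightarrow> b \<in> finsup S \<Longrightarrow> rmul w b k \<in> N"
  unfolding rmul_def by (intro N.sum_in ra_in T_pow_nth) (auto simp: finsup_nth)

lemma ract_in:
  assumes "w \<in> finsup N" "b \<in> finsup S"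
  shows "rmul w b \<in> finsup N"
proof -
  have "{k. rmul w b k \<noteq> 0} \<subseteq> (\<Union>n\<in>{n. w n \<noteq> 0}. {k. (skew_t \<delta> ^^ n) b k \<noteq> 0})"
  proof
    fix k assume "k \<in> {k. rmul w b k \<noteq> 0}"
    then have "(\<Sum>n\<in>{n. w n \<noteq> 0}. ra (w n) ((skew_t \<delta> ^^ n) b k)) \<noteq> 0" by (simp add: rmul_def)
    from sum.not_neutral_contains_not_neutral[OF this]
    obtain n where "w n \<noteq> 0" "ra (w n) ((skew_t \<delta> ^^ n) b k) \<noteq> 0" by blast
    then show "k \<in> (\<Union>n\<in>{n. w n \<noteq> 0}. {k. (skew_t \<delta> ^^ n) b k \<noteq> 0})"
      using ra_0[OF finsup_nth[OF assms(1)]] by auto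
  qed
  moreover have "finite \<dots>"
    using assms B.T_pow_in[OF assms(2)] by (intro finite_UN_I) (auto simp: finsup_def)
  ultimately show ?thesis using ract_nth[OF assms] finite_subset by (auto simp: finsup_def)
qed

lemma ract_add:
  assumes "w \<in> finsup N" "v \<in> finsup N" "b \<in> finsup S"
  shows "rmul (w + v) b = rmul w b + rmul v b"
proof
  fix k
  obtain m1 m2 where mk: "\<forall>n\<ge>m1. w n = 0" "\<forall>n\<ge>m2. v n = 0" using finsup_bound assms by metis
  let ?m = "max m1 m2" and ?r = "\<lambda>w n. ra (w n) ((skew_t \<delta> ^^ n) b k)"
  have "rmul (w + v) b k = sum (?r (w + v)) {..<?m}" by (rule ract_upto) (use mk assms W.add_in in auto)
  moreover have "rmul w b k = sum (?r w) {..<?m}" by (rule ract_upto) (use mk assms in auto)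
  moreover have "rmul v b k = sum (?r v) {..<?m}" by (rule ract_upto) (use mk assms in auto)
  ultimately show "rmul (w + v) b k = (rmul w b + rmul v b) k"
    using assms by (simp add: ra_add T_pow_nth finsup_nth sum.distrib)
qed

lemma add_ract:
  assumes "w \<in> finsup N" "a \<in> finsup S" "b \<in> finsup S"
  shows "rmul w (a + b) = rmul w a + rmul w b"
  by (rule ext) (use assms in \<open>simp add: rmul_def B.T_pow_add add_ra T_pow_nth finsup_nth sum.distrib\<close>)

lemma ract_const_left:
  assumes "v \<in> N" "b \<in> finsup S"
  shows "rmul (const_poly v) b k = ra v (b k)"
  by (subst ract_upto[of _ _ 1]) (auto simp: const_poly_finsup N.zero_in assms const_poly_def)

lemma ract_shift_left:
  assumes "w \<in> finsup N" "b \<in> finsup S"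
  shows "rmul (shift w) b = rmul w (skew_t \<delta> b)"
proof
  fix k
  obtain m where m: "\<forall>n\<ge>m. w n = 0" using finsup_bound assms by metis
  have "\<forall>n\<ge>Suc m. shift w n = 0" using m by (auto simp: shift_def split: nat.split)
  then have "rmul (shift w) b k = (\<Sum>n<Suc m. ra (shift w n) ((skew_t \<delta> ^^ n) b k))"
    by (intro ract_upto shift_finsup assms N.zero_in)
  also have "\<dots> = (\<Sum>n<m. ra (w n) ((skew_t \<delta> ^^ n) (skew_t \<delta> b) k))"
    unfolding sum.lessThan_Suc_shift using assms by (simp add: zero_ra finsup_nth funpow_swap1)
  also have "\<dots> = rmul w (skew_t \<delta> b) k" by (rule ract_upto[symmetric, OF assms(1) B.T_in[OF assms(2)] m])
  finally show "rmul (shift w) b k = rmul w (skew_t \<delta> b) k" .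
qed

lemma ract_shift_right:
  assumes "w \<in> finsup N" "b \<in> finsup S"
  shows "rmul w (shift b) = shift (rmul w b)"
proof
  fix k
  show "rmul w (shift b) k = shift (rmul w b) k"
    by (cases k) (use assms in \<open>simp_all add: rmul_def B.T_pow_shift ra_0 finsup_nth\<close>)
qed

lemma ract_ract:
  assumes "w \<in> finsup N" "a \<in> finsup S" "b \<in> finsup S"
  shows "rmul (rmul w a) b = rmul w (skew_mult a b)"
  using assms
proof (induction w arbitrary: a rule: finsup_induct)
  case zero
  show "rmul (rmul 0 a) b = rmul 0 (skew_mult a b)" by (rule ext) (simp add: rmul_def)
next
  case (step v w)
  have cf: "shift w \<in> finsup N" "const_poly v \<in> finsup N"
    using step by (auto intro: shift_finsup const_poly_finsup N.zero_in)
  have "rmul (rmul (const_poly v) a) b k = rmul (const_poly v) (skew_mult a b) k" for k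
  proof -
    obtain m where m: "\<forall>n\<ge>m. a n = 0" using finsup_bound[OF step.prems(1)] by blast
    have "rmul (rmul (const_poly v) a) b k =
        (\<Sum>n<m. ra (rmul (const_poly v) a n) ((skew_t \<delta> ^^ n) b k))"
      by (rule ract_upto) (use step m cf in \<open>auto simp: ract_in ract_const_left ra_0\<close>)
    also have "\<dots> = (\<Sum>n<m. ra v (a n * (skew_t \<delta> ^^ n) b k))"
      using step by (simp add: ract_const_left mult_ra finsup_nth T_pow_nth)
    also have "\<dots> = ra v (\<Sum>n<m. a n * (skew_t \<delta> ^^ n) b k)"
      by (rule S.sum_additive[symmetric]) (use step in \<open>auto simp: add_ra mult_in finsup_nth T_pow_nth\<close>)
    also have "(\<Sum>n<m. a n * (skew_t \<delta> ^^ n) b k) = skew_mult a b k"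
      using step by (simp add: B.act_upto[OF _ _ m] sum_fun_apply coeff_act_def)
    finally show ?thesis by (simp only: ract_const_left[OF step(1) B.act_in[OF step.prems]])
  qed
  then have "rmul (rmul (const_poly v) a) b = rmul (const_poly v) (skew_mult a b)" by (rule ext)
  then show "rmul (rmul (const_poly v + shift w) a) b = rmul (const_poly v + shift w) (skew_mult a b)" using step
    by (simp add: ract_add ract_in cf B.act_in ract_shift_left B.T_in B.act_T)
qed

lemma zero_ract: "rmul 0 b = 0"
  by (rule ext) (simp add: rmul_def)

lemma ract_diff_left:
  assumes "w \<in> finsup N" "v \<in> finsup N" "b \<in> finsup S"
  shows "rmul (w - v) b = rmul w b - rmul v b"
  by (rule W.additive_diff[of "\<lambda>w. rmul w b"]) (use assms ract_add in auto)

lemma ract_diff_right: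
  assumes "w \<in> finsup N" "a \<in> finsup S" "b \<in> finsup S"
  shows "rmul w (a - b) = rmul w a - rmul w b"
  by (rule B.W.additive_diff[of "rmul w"]) (use assms add_ract in auto)

lemma ract_one:
  assumes "w \<in> finsup N"
  shows "rmul w (const_poly 1) = w"
  using assms
proof (induction w rule: finsup_induct)
  case (step v w)
  have one: "const_poly 1 \<in> finsup S" by (intro const_poly_finsup S.zero_in one_in)
  have cf: "shift w \<in> finsup N" "const_poly v \<in> finsup N" "shift (const_poly 1 :: nat \<Rightarrow> 'f) \<in> finsup S"
    using step one by (auto intro: shift_finsup const_poly_finsup N.zero_in S.zero_in)
  have "skew_t \<delta> (const_poly 1) = shift (const_poly 1)"
    by (simp add: skew_t_const one_in \<delta>_one) (rule ext, simp add: const_poly_def)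
  moreover have "rmul (const_poly v) (const_poly 1) = const_poly v"
    by (rule ext) (simp add: ract_const_left step one, simp add: const_poly_def one_ra step ra_0)
  ultimately show "rmul (const_poly v + shift w) (const_poly 1) = const_poly v + shift w"
    using step by (simp add: ract_add cf one ract_shift_left ract_shift_right)
next
  case zero
  show "rmul 0 (const_poly 1) = 0" by (rule zero_ract)
qed

lemma cla_ract:
  assumes "f \<in> S" "w \<in> finsup N" "b \<in> finsup S"
  shows "rmul (cla f w) b = cla f (rmul w b)"
  using assms(2,3)
proof (induction w arbitrary: b rule: finsup_induct)
  case zero
  have "cla f 0 = 0" by (rule ext) (simp add: coeff_act_def la_0 assms(1))
  then show "rmul (cla f 0) b = cla f (rmul 0 b)" by (simp only: zero_ract)
next
  case (step v w)
  have cf: "shift w \<in> finsup N" "const_poly v \<in> finsup N"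
    using step by (auto intro: shift_finsup const_poly_finsup N.zero_in)
  have "cla f (const_poly v) = const_poly (la f v)"
    by (rule ext) (simp add: coeff_act_def const_poly_def la_0 assms(1))
  moreover have "rmul (const_poly (la f v)) b = cla f (rmul (const_poly v) b)"
    by (rule ext) (simp add: ract_const_left coeff_act_def la_in la_ra assms(1) step finsup_nth)
  ultimately show "rmul (cla f (const_poly v + shift w)) b = cla f (rmul (const_poly v + shift w) b)"
    using step assms(1)
    by (simp add: cla_add cf ract_add cla_in cla_shift ract_shift_left B.T_in ract_in shift_finsup const_poly_finsup
      N.zero_in la_in)
qed

text \<open>
  Left multiplication by \<open>t\<close> commutes with right multiplications precisely because \<open>D\<close> is a derivation for
  the right action of the coefficients.
\<close>

lemma T_ract:
  assumes "w \<in> finsup N" "b \<in> finsup S"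
  shows "rmul (T w) b = T (rmul w b)"
  using assms
proof (induction w arbitrary: b rule: finsup_induct)
  case zero
  have "T 0 = 0" by (rule ext) (simp add: skew_t_def D_0 shift_def split: nat.split)
  then show "rmul (T 0) b = T (rmul 0 b)" by (simp only: zero_ract)
next
  case (step v w)
  have cf: "shift w \<in> finsup N" "const_poly v \<in> finsup N" "shift (const_poly v) \<in> finsup N" "const_poly (D v) \<in> finsup N"
    using step by (auto intro: shift_finsup const_poly_finsup N.zero_in D_in)
  have "T (const_poly v) = shift (const_poly v) - const_poly (D v)"
    by (rule ext) (simp add: skew_t_def const_poly_def D_0)
  then have "rmul (T (const_poly v)) b k = T (rmul (const_poly v) b) k" for k
  proof (simp add: ract_diff_left cf step ract_shift_left, cases k)
    case 0
    have "ra v (skew_t \<delta> b 0) = - ra v (\<delta> (b 0))"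
      using S.additive_diff[of "ra v" 0 "\<delta> (b 0)"] step
      by (simp add: skew_t_def add_ra S.zero_in \<delta>_in finsup_nth ra_0)
    then show "rmul (const_poly v) (skew_t \<delta> b) k - rmul (const_poly (D v)) b k = T (rmul (const_poly v) b) k"
      using step 0 by (simp add: ract_const_left B.T_in D_in) (simp add: skew_t_def ract_const_left D_ra finsup_nth)
  next
    case (Suc j)
    have "ra v (skew_t \<delta> b (Suc j)) = ra v (b j) - ra v (\<delta> (b (Suc j)))"
      using S.additive_diff[of "ra v" "b j" "\<delta> (b (Suc j))"] step
      by (simp add: skew_t_def add_ra \<delta>_in finsup_nth)
    then show "rmul (const_poly v) (skew_t \<delta> b) k - rmul (const_poly (D v)) b k = T (rmul (const_poly v) b) k"
      using step Suc by (simp add: ract_const_left B.T_in D_in) (simp add: skew_t_def ract_const_left D_ra finsup_nth)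
  qed
  then have "rmul (T (const_poly v)) b = T (rmul (const_poly v) b)" by (rule ext)
  then show "rmul (T (const_poly v + shift w)) b = T (rmul (const_poly v + shift w) b)" using step
    by (simp add: T_add cf ract_add T_in T_shift ract_shift_left B.T_in ract_in shift_finsup N.zero_in)
qed

lemma act_ract:
  assumes "a \<in> finsup S" "w \<in> finsup N" "b \<in> finsup S"
  shows "rmul (act a w) b = act a (rmul w b)"
  using assms
proof (induction a arbitrary: w rule: finsup_induct)
  case zero
  show "rmul (act 0 w) b = act 0 (rmul w b)" by (simp only: zero_act zero_ract)
next
  case (step f a)
  have cf: "shift a \<in> finsup S" "const_poly f \<in> finsup S"
    using step by (auto intro: shift_finsup const_poly_finsup S.zero_in)
  show "rmul (act (const_poly f + shift a) w) b = act (const_poly f + shift a) (rmul w b)" using step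
    by (simp add: add_act cf ract_add act_in ract_in act_const act_shift_left T_in cla_in cla_ract T_ract)
qed

end

section \<open>Bimodules as records\<close>

text \<open>
  Records that share the addition of the underlying type, for which the locales of algebras and bimodules
  reduce to equations on a carrier.
\<close>

definition alg_rec :: "'a set \<Rightarrow> ('a \<Rightarrow> 'a \<Rightarrow> 'a) \<Rightarrow> 'a \<Rightarrow> ('k \<Rightarrow> 'a \<Rightarrow> 'a) \<Rightarrow> ('k, 'a::ab_group_add) module" where
  "alg_rec R m e s = \<lparr>carrier = R, mult = m, one = e, zero = 0, add = (+), smult = s\<rparr>"

definition bim_rec :: "'w set \<Rightarrow> ('k \<Rightarrow> 'w \<Rightarrow> 'w) \<Rightarrow> ('a \<Rightarrow> 'w \<Rightarrow> 'w) \<Rightarrow> ('w \<Rightarrow> 'a \<Rightarrow> 'w) \<Rightarrow>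
    ('k, 'a, 'w::ab_group_add) bimod" where
  "bim_rec N s la ra = \<lparr>carrier = N, mult = undefined, one = undefined, zero = 0, add = (+), smult = s,
     lact = la, ract = ra\<rparr>"

lemma alg_rec_simps [simp]:
  "carrier (alg_rec R m e s) = R" "mult (alg_rec R m e s) = m" "one (alg_rec R m e s) = e"
  "zero (alg_rec R m e s) = 0" "add (alg_rec R m e s) = (+)" "smult (alg_rec R m e s) = s"
  by (simp_all add: alg_rec_def)

lemma bim_rec_simps [simp]:
  "carrier (bim_rec N t la ra) = N" "zero (bim_rec N t la ra) = 0" "add (bim_rec N t la ra) = (+)"
  "smult (bim_rec N t la ra) = t" "lact (bim_rec N t la ra) = la" "ract (bim_rec N t la ra) = ra"
  by (simp_all add: bim_rec_def)

lemma scalars_simps [simp]: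
  "carrier scalars = UNIV" "mult scalars = (*)" "one scalars = 1" "zero scalars = 0" "add scalars = (+)"
  by (simp_all add: scalars_def)

lemma cring_scalars: "cring (scalars :: 'k::field ring)"
proof (intro cringI abelian_groupI comm_monoidI)
  show "\<exists>y\<in>carrier scalars. y \<oplus>\<^bsub>scalars\<^esub> x = \<zero>\<^bsub>scalars\<^esub>" for x :: 'k
    by (auto intro: exI[of _ "- x"])
qed (auto simp: algebra_simps)

lemma (in group_carrier) abelian_group_record:
  assumes "carrier G = N" "zero G = 0" "add G = (+)"
  shows "abelian_group G"
proof (rule abelian_groupI)
  show "\<exists>y\<in>carrier G. y \<oplus>\<^bsub>G\<^esub> x = \<zero>\<^bsub>G\<^esub>" if "x \<in> carrier G" for x
    using that uminus_in by (auto simp: assms intro!: bexI[of _ "- x"])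
qed (auto simp: assms zero_in add_in algebra_simps)

lemma bimodule_recI:
  fixes R :: "'a::ab_group_add set" and N :: "'w::ab_group_add set" and s :: "'k::field \<Rightarrow> 'a \<Rightarrow> 'a"
  assumes R: "group_carrier R" and N: "group_carrier N"
    and e: "e \<in> R" and m: "\<And>a b. a \<in> R \<Longrightarrow> b \<in> R \<Longrightarrow> m a b \<in> R"
    and m_add: "\<And>a b c. a \<in> R \<Longrightarrow> b \<in> R \<Longrightarrow> c \<in> R \<Longrightarrow> m a (b + c) = m a b + m a c"
    and add_m: "\<And>a b c. a \<in> R \<Longrightarrow> b \<in> R \<Longrightarrow> c \<in> R \<Longrightarrow> m (a + b) c = m a c + m b c"
    and m_assoc: "\<And>a b c. a \<in> R \<Longrightarrow> b \<in> R \<Longrightarrow> c \<in> R \<Longrightarrow> m (m a b) c = m a (m b c)"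
    and m_one: "\<And>a. a \<in> R \<Longrightarrow> m e a = a" "\<And>a. a \<in> R \<Longrightarrow> m a e = a"
    and s: "\<And>r a. a \<in> R \<Longrightarrow> s r a \<in> R"
    and s_mod: "\<And>r q a. a \<in> R \<Longrightarrow> s (r + q) a = s r a + s q a" "\<And>r a b. a \<in> R \<Longrightarrow> b \<in> R \<Longrightarrow> s r (a + b) = s r a + s r b"
      "\<And>r q a. a \<in> R \<Longrightarrow> s (r * q) a = s r (s q a)" "\<And>a. a \<in> R \<Longrightarrow> s 1 a = a"
    and s_m: "\<And>r a b. a \<in> R \<Longrightarrow> b \<in> R \<Longrightarrow> m (s r a) b = s r (m a b)" "\<And>r a b. a \<in> R \<Longrightarrow> b \<in> R \<Longrightarrow> m a (s r b) = s r (m a b)"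
    and t: "\<And>r v. v \<in> N \<Longrightarrow> t r v \<in> N"
    and t_mod: "\<And>r q v. v \<in> N \<Longrightarrow> t (r + q) v = t r v + t q v" "\<And>r v w. v \<in> N \<Longrightarrow> w \<in> N \<Longrightarrow> t r (v + w) = t r v + t r w"
      "\<And>r q v. v \<in> N \<Longrightarrow> t (r * q) v = t r (t q v)" "\<And>v. v \<in> N \<Longrightarrow> t 1 v = v"
    and la: "\<And>a v. a \<in> R \<Longrightarrow> v \<in> N \<Longrightarrow> la a v \<in> N" and ra: "\<And>a v. a \<in> R \<Longrightarrow> v \<in> N \<Longrightarrow> ra v a \<in> N"
    and la_add: "\<And>a v w. a \<in> R \<Longrightarrow> v \<in> N \<Longrightarrow> w \<in> N \<Longrightarrow> la a (v + w) = la a v + la a w"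
    and add_la: "\<And>a b v. a \<in> R \<Longrightarrow> b \<in> R \<Longrightarrow> v \<in> N \<Longrightarrow> la (a + b) v = la a v + la b v"
    and ra_add: "\<And>a v w. a \<in> R \<Longrightarrow> v \<in> N \<Longrightarrow> w \<in> N \<Longrightarrow> ra (v + w) a = ra v a + ra w a"
    and add_ra: "\<And>a b v. a \<in> R \<Longrightarrow> b \<in> R \<Longrightarrow> v \<in> N \<Longrightarrow> ra v (a + b) = ra v a + ra v b"
    and one_la: "\<And>v. v \<in> N \<Longrightarrow> la e v = v" and one_ra: "\<And>v. v \<in> N \<Longrightarrow> ra v e = v"
    and mult_la: "\<And>a b v. a \<in> R \<Longrightarrow> b \<in> R \<Longrightarrow> v \<in> N \<Longrightarrow> la (m a b) v = la a (la b v)"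
    and mult_ra: "\<And>a b v. a \<in> R \<Longrightarrow> b \<in> R \<Longrightarrow> v \<in> N \<Longrightarrow> ra v (m a b) = ra (ra v a) b"
    and la_ra: "\<And>a b v. a \<in> R \<Longrightarrow> b \<in> R \<Longrightarrow> v \<in> N \<Longrightarrow> ra (la a v) b = la a (ra v b)"
    and s_la: "\<And>r a v. a \<in> R \<Longrightarrow> v \<in> N \<Longrightarrow> la (s r a) v = t r (la a v)"
    and la_t: "\<And>r a v. a \<in> R \<Longrightarrow> v \<in> N \<Longrightarrow> la a (t r v) = t r (la a v)"
    and t_ra: "\<And>r a v. a \<in> R \<Longrightarrow> v \<in> N \<Longrightarrow> ra (t r v) a = t r (ra v a)"
    and ra_s: "\<And>r a v. a \<in> R \<Longrightarrow> v \<in> N \<Longrightarrow> ra v (s r a) = t r (ra v a)"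
  shows "bimodule scalars (alg_rec R m e s) (bim_rec N t la ra)"
proof -
  have aR: "abelian_group (alg_rec R m e s)" by (rule group_carrier.abelian_group_record[OF R]) simp_all
  have aN: "abelian_group (bim_rec N t la ra)" by (rule group_carrier.abelian_group_record[OF N]) simp_all
  have mR: "module scalars (alg_rec R m e s)"
    by (rule moduleI[OF cring_scalars aR]) (use s s_mod in auto)
  have mN: "module scalars (bim_rec N t la ra)"
    by (rule moduleI[OF cring_scalars aN]) (use t t_mod in auto)
  have ring: "ring (alg_rec R m e s)"
    by (rule ringI[OF aR]) (use e m m_add add_m m_assoc m_one in \<open>auto intro!: monoidI\<close>)
  have alg: "assoc_algebra scalars (alg_rec R m e s)"
    by (intro assoc_algebra.intro assoc_algebra_axioms.intro mR ring) (use s_m in auto)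
  show ?thesis
    by (intro bimodule.intro bimodule_axioms.intro alg mN)
      (use la ra la_add add_la ra_add add_ra one_la one_ra mult_la mult_ra la_ra s_la la_t t_ra ra_s in auto)
qed

section \<open>Ore extensions of first order differential calculi\<close>

text \<open>
  Here \<open>D\<close> stands for \<open>[\<cdot>, t]\<close> on 1-forms, \<open>e\<close> for \<open>[dt, t] + l dt\<close>, and \<open>c\<close> embeds the scalars. The last
  assumption is \<open>d\<close> applied to the relation \<open>[f, t] = \<delta> f\<close>.
\<close>

locale calculus_derivation = Om: diff_bimodule S \<delta> Om la D ra
  for S :: "'f::comm_ring_1 set" and \<delta> and Om :: "'w::ab_group_add set" and la D ra +
  fixes d :: "'f \<Rightarrow> 'w" and e :: 'w and l :: "'k::field" and c :: "'k \<Rightarrow> 'f"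
  assumes c_in: "c r \<in> S" and c_add: "c (r + q) = c r + c q" and c_mult: "c (r * q) = c r * c q" and c_one: "c 1 = 1"
    and \<delta>_c: "\<delta> (c r) = 0" and ra_c: "w \<in> Om \<Longrightarrow> ra w (c r) = la (c r) w"
    and d_in: "f \<in> S \<Longrightarrow> d f \<in> Om"
    and d_add: "f \<in> S \<Longrightarrow> h \<in> S \<Longrightarrow> d (f + h) = d f + d h"
    and d_c: "f \<in> S \<Longrightarrow> d (c r * f) = la (c r) (d f)"
    and d_mult: "f \<in> S \<Longrightarrow> h \<in> S \<Longrightarrow> d (f * h) = ra (d f) h + la f (d h)"
    and e_in: "e \<in> Om" and e_central: "f \<in> S \<Longrightarrow> ra e f = la f e"
    and d_\<delta>: "f \<in> S \<Longrightarrow> D (d f) + la (c l) (d f) = d (\<delta> f)"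
begin

abbreviation "N \<equiv> Om \<times> S"

text \<open>
  The pair \<open>(w, b)\<close> stands for \<open>w + b dt\<close>. The right action follows from \<open>dt f = f dt - l df\<close>, and the
  commutator with \<open>t\<close> from \<open>[b dt, t] = b [dt, t] + \<delta> b dt\<close>.
\<close>

definition laN :: "'f \<Rightarrow> 'w \<times> 'f \<Rightarrow> 'w \<times> 'f" where
  "laN f v = (la f (fst v), f * snd v)"

definition raN :: "'w \<times> 'f \<Rightarrow> 'f \<Rightarrow> 'w \<times> 'f" where
  "raN v f = (ra (fst v) f - la (c l * snd v) (d f), snd v * f)"

definition DN :: "'w \<times> 'f \<Rightarrow> 'w \<times> 'f" where
  "DN v = (D (fst v) + la (snd v) e, \<delta> (snd v) - c l * snd v)"

lemmas in_rules = c_in d_in e_in Om.one_in Om.mult_in Om.S.add_in Om.S.zero_in Om.S.diff_in Om.\<delta>_in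
  Om.la_in Om.ra_in Om.D_in Om.N.add_in Om.N.zero_in Om.N.diff_in

lemma la_diff: "f \<in> S \<Longrightarrow> v \<in> Om \<Longrightarrow> w \<in> Om \<Longrightarrow> la f (v - w) = la f v - la f w"
  by (rule Om.N.additive_diff[of "la f"]) (simp_all add: Om.la_add)

lemma ra_diff: "f \<in> S \<Longrightarrow> v \<in> Om \<Longrightarrow> w \<in> Om \<Longrightarrow> ra (v - w) f = ra v f - ra w f"
  by (rule Om.N.additive_diff[of "\<lambda>v. ra v f"]) (simp_all add: Om.ra_add)

lemma D_diff: "v \<in> Om \<Longrightarrow> w \<in> Om \<Longrightarrow> D (v - w) = D v - D w"
  by (rule Om.N.additive_diff[of D]) (simp_all add: Om.D_add)

lemma diff_la: "f \<in> S \<Longrightarrow> h \<in> S \<Longrightarrow> v \<in> Om \<Longrightarrow> la (f - h) v = la f v - la h v"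
  by (rule Om.S.additive_diff[of "\<lambda>f. la f v"]) (simp_all add: Om.add_la)

lemma d_0: "d 0 = 0"
  by (rule Om.S.additive_0[of d]) (rule d_add)

lemma d_one: "d 1 = 0"
  using d_mult[OF Om.one_in Om.one_in] by (simp add: Om.one_ra Om.one_la d_in Om.one_in)

lemma \<delta>_cl: "b \<in> S \<Longrightarrow> \<delta> (c l * b) = c l * \<delta> b"
  by (simp add: Om.\<delta>_mult c_in \<delta>_c)

text \<open>
  In the 1-form component, \<open>d_\<delta>\<close> turns \<open>l b d (\<delta> f)\<close> into \<open>l b D (d f) + l\<^sup>2 b df\<close>; its last term is balanced by
  the coefficient \<open>-l\<close> of \<open>dt\<close> in \<open>[dt, t]\<close>.
\<close>

lemma D_raN: "f \<in> S \<Longrightarrow> v \<in> N \<Longrightarrow> DN (raN v f) = raN (DN v) f + raN v (\<delta> f)"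
proof -
  assume f: "f \<in> S" and v: "v \<in> N"
  obtain w b where vw: "v = (w, b)" and w: "w \<in> Om" and b: "b \<in> S" using v by auto
  let ?l = "c l"
  have "D (ra w f - la (?l * b) (d f)) + la (b * f) e =
    ra (D w) f + ra w (\<delta> f) - la (?l * b) (D (d f)) - la (?l * \<delta> b) (d f) + la (b * f) e"
    by (simp add: D_diff in_rules f w b Om.D_ra Om.D_la \<delta>_cl)
  moreover have "ra (D w + la b e) f - la (?l * (\<delta> b - ?l * b)) (d f) =
    ra (D w) f + la (b * f) e - la (?l * \<delta> b) (d f) + la (?l * b) (la ?l (d f))"
    by (simp add: Om.ra_add in_rules f w b Om.la_ra e_central Om.mult_la[symmetric] right_diff_distrib diff_la
      algebra_simps)
  moreover have "la (?l * b) (d (\<delta> f)) = la (?l * b) (D (d f)) + la (?l * b) (la ?l (d f))"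
    by (simp add: d_\<delta>[OF f, symmetric] Om.la_add in_rules f b)
  moreover have "\<delta> (b * f) - ?l * (b * f) = (\<delta> b - ?l * b) * f + b * \<delta> f"
    by (simp add: Om.\<delta>_mult f b algebra_simps)
  ultimately show ?thesis
    by (simp add: DN_def raN_def vw)
qed

lemma group_N: "group_carrier N"
  by unfold_locales (auto simp: in_rules Om.N.uminus_in Om.S.uminus_in zero_prod_def)

sublocale N: diff_bimodule S \<delta> "Om \<times> S" laN DN raN
proof -
  have 1: "diff_module S \<delta> N laN DN"
    unfolding diff_module_def diff_module_axioms_def
  proof (intro conjI allI impI group_N)
    show "diff_ring S \<delta>" by unfold_locales
  qed (auto simp: laN_def DN_def in_rules Om.la_add Om.add_la Om.one_la Om.mult_la Om.D_add Om.D_la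
      Om.\<delta>_add Om.\<delta>_mult algebra_simps)
  show "diff_bimodule S \<delta> N laN DN raN"
    unfolding diff_bimodule_def diff_bimodule_axioms_def
  proof (intro conjI allI impI 1 D_raN)
    fix f h v assume f: "f \<in> S" and h: "h \<in> S" and v: "v \<in> N"
    obtain w b where vw: "v = (w, b)" and w: "w \<in> Om" and b: "b \<in> S" using v by auto
    show "raN v (f + h) = raN v f + raN v h"
      by (simp add: raN_def vw Om.add_ra d_add Om.la_add in_rules f h w b algebra_simps)
    show "raN v (f * h) = raN (raN v f) h"
      by (simp add: raN_def vw Om.mult_ra d_mult Om.la_add in_rules f h w b Om.la_ra Om.mult_la[symmetric] ra_diff algebra_simps)
    show "raN (laN f v) h = laN f (raN v h)"
      by (simp add: raN_def laN_def vw in_rules f h w b Om.la_ra la_diff Om.mult_la[symmetric] mult_ac)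
  next
    fix f v w assume "f \<in> S" "v \<in> N" "w \<in> N"
    then show "raN (v + w) f = raN v f + raN w f"
      by (auto simp: raN_def Om.ra_add in_rules distrib_left Om.add_la algebra_simps)
  next
    fix f v assume "f \<in> S" "v \<in> N"
    then show "raN v f \<in> N" by (auto simp: raN_def in_rules)
  next
    fix v assume "v \<in> N"
    then show "raN v 1 = v" by (auto simp: raN_def in_rules Om.one_ra d_one Om.la_0)
  qed
qed

definition dt :: "nat \<Rightarrow> 'w \<times> 'f" where
  "dt = const_poly (0, 1)"

text \<open>
  The differential of \<open>t\<^sup>n\<close>, from \<open>d (t\<^sup>n\<^sup>+\<^sup>1) = d (t\<^sup>n) t + t\<^sup>n dt\<close>.
\<close>

primrec d_pow :: "nat \<Rightarrow> nat \<Rightarrow> 'w \<times> 'f" where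
  "d_pow 0 = 0"
| "d_pow (Suc n) = shift (d_pow n) + (N.T ^^ n) dt"

definition dW :: "(nat \<Rightarrow> 'f) \<Rightarrow> nat \<Rightarrow> 'w \<times> 'f" where
  "dW a = (\<lambda>n. (d (a n), 0)) + (\<Sum>m\<in>{m. a m \<noteq> 0}. N.cla (a m) (d_pow m))"

abbreviation "B \<equiv> finsup S"
abbreviation "W \<equiv> finsup N"

lemma dt_in: "dt \<in> W"
  unfolding dt_def by (intro const_poly_finsup N.N.zero_in) (auto simp: in_rules)

lemma d_pow_in: "d_pow n \<in> W"
proof (induction n)
  case 0
  show "d_pow 0 \<in> W" by (simp only: d_pow.simps N.W.zero_in)
next
  case (Suc n)
  then show "d_pow (Suc n) \<in> W"
    by (simp only: d_pow.simps N.W.add_in shift_finsup[OF N.N.zero_in] N.T_pow_in[OF dt_in])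
qed

lemma const_in: "f \<in> S \<Longrightarrow> const_poly f \<in> B"
  by (intro const_poly_finsup in_rules)

lemma shift_in: "a \<in> B \<Longrightarrow> shift a \<in> B"
  by (intro shift_finsup in_rules)

lemma shift_in': "w \<in> W \<Longrightarrow> shift w \<in> W"
  by (intro shift_finsup N.N.zero_in)

lemma const_in': "w \<in> Om \<Longrightarrow> b \<in> S \<Longrightarrow> const_poly (w, b) \<in> W"
  by (intro const_poly_finsup N.N.zero_in) auto

lemma dW_upto:
  assumes "a \<in> B" "\<forall>n\<ge>k. a n = 0"
  shows "dW a = (\<lambda>n. (d (a n), 0)) + (\<Sum>m<k. N.cla (a m) (d_pow m))"
proof -
  have "(\<Sum>m\<in>{m. a m \<noteq> 0}. N.cla (a m) (d_pow m)) = (\<Sum>m<k. N.cla (a m) (d_pow m))"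
    by (rule sum.mono_neutral_left) (use assms(2) N.zero_cla[OF d_pow_in] in \<open>auto simp: not_le[symmetric]\<close>)
  then show ?thesis by (simp add: dW_def)
qed

lemma d_coeffs_in: assumes "a \<in> B" shows "(\<lambda>n. (d (a n), 0)) \<in> W"
proof -
  obtain m where "\<forall>n\<ge>m. a n = 0" using finsup_bound[OF assms] by blast
  then show ?thesis by (intro finsupI[of _ _ m]) (auto simp: in_rules finsup_nth[OF assms] d_0 zero_prod_def)
qed

lemma dW_in: "a \<in> B \<Longrightarrow> dW a \<in> W"
  unfolding dW_def by (intro N.W.add_in d_coeffs_in N.W.sum_in N.cla_in d_pow_in) (auto simp: finsup_nth)

lemma dW_add:
  assumes "a \<in> B" "b \<in> B"
  shows "dW (a + b) = dW a + dW b"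
proof -
  obtain m k where mk: "\<forall>n\<ge>m. a n = 0" "\<forall>n\<ge>k. b n = 0" using finsup_bound assms by metis
  let ?m = "max m k"
  have ab: "a + b \<in> B" using assms by (rule Om.B.W.add_in)
  have "dW (a + b) = (\<lambda>n. (d ((a + b) n), 0)) + (\<Sum>m<?m. N.cla ((a + b) m) (d_pow m))"
    by (rule dW_upto[OF ab]) (use mk in auto)
  moreover have "dW a = (\<lambda>n. (d (a n), 0)) + (\<Sum>m<?m. N.cla (a m) (d_pow m))"
    by (rule dW_upto[OF assms(1)]) (use mk in auto)
  moreover have "dW b = (\<lambda>n. (d (b n), 0)) + (\<Sum>m<?m. N.cla (b m) (d_pow m))"
    by (rule dW_upto[OF assms(2)]) (use mk in auto)
  moreover have "(\<lambda>n. (d ((a + b) n), 0 :: 'f)) = (\<lambda>n. (d (a n), 0)) + (\<lambda>n. (d (b n), 0))"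
    by (rule ext) (simp add: d_add finsup_nth[OF assms(1)] finsup_nth[OF assms(2)])
  moreover have "(\<Sum>m<?m. N.cla ((a + b) m) (d_pow m)) = (\<Sum>m<?m. N.cla (a m) (d_pow m)) + (\<Sum>m<?m. N.cla (b m) (d_pow m))"
    by (simp add: N.add_cla finsup_nth[OF assms(1)] finsup_nth[OF assms(2)] d_pow_in sum.distrib)
  ultimately show ?thesis by (simp only: add_ac)
qed

lemma dW_diff: "a \<in> B \<Longrightarrow> b \<in> B \<Longrightarrow> dW (a - b) = dW a - dW b"
  by (rule Om.B.W.additive_diff[of dW]) (simp_all only: dW_add)

lemma dW_0: "dW 0 = 0"
  by (rule Om.B.W.additive_0[of dW]) (simp only: dW_add)

lemma dW_const: assumes "f \<in> S" shows "dW (const_poly f) = const_poly (d f, 0)"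
proof -
  have "dW (const_poly f) = (\<lambda>n. (d (const_poly f n), 0)) + (\<Sum>m<1. N.cla (const_poly f m) (d_pow m))"
    by (rule dW_upto[OF const_in[OF assms]]) (simp add: const_poly_def)
  moreover have "N.cla (const_poly f 0) (d_pow 0) = 0"
    by (rule ext) (simp add: coeff_act_def const_poly_def N.la_0 assms)
  ultimately show ?thesis by (auto simp: const_poly_def d_0 fun_eq_iff zero_prod_def)
qed

lemma dW_shift:
  assumes "a \<in> B"
  shows "dW (shift a) = shift (dW a) + N.act a dt"
proof -
  obtain k where k: "\<forall>n\<ge>k. a n = 0" using finsup_bound[OF assms] by blast
  have "\<forall>n\<ge>Suc k. shift a n = 0" using k by (auto simp: shift_def split: nat.split)
  from dW_upto[OF shift_in[OF assms] this]
  have "dW (shift a) = (\<lambda>n. (d (shift a n), 0)) + (\<Sum>m<Suc k. N.cla (shift a m) (d_pow m))" .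
  also have "(\<lambda>n. (d (shift a n), 0)) = shift (\<lambda>n. (d (a n), 0 :: 'f))"
    by (rule ext) (simp add: shift_def d_0 zero_prod_def split: nat.split)
  also have "(\<Sum>m<Suc k. N.cla (shift a m) (d_pow m)) = (\<Sum>m<k. N.cla (a m) (shift (d_pow m) + (N.T ^^ m) dt))"
    unfolding sum.lessThan_Suc_shift by (simp add: N.zero_cla N.W.zero_in)
  also have "\<dots> = (\<Sum>m<k. shift (N.cla (a m) (d_pow m))) + (\<Sum>m<k. N.cla (a m) ((N.T ^^ m) dt))"
    by (simp add: N.cla_add shift_in' d_pow_in N.T_pow_in dt_in finsup_nth[OF assms] N.cla_shift sum.distrib)
  also have "(\<Sum>m<k. N.cla (a m) ((N.T ^^ m) dt)) = N.act a dt"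
    by (rule N.act_upto[symmetric, OF assms dt_in k])
  also have "shift (\<lambda>n. (d (a n), 0)) + ((\<Sum>m<k. shift (N.cla (a m) (d_pow m))) + N.act a dt) = shift (dW a) + N.act a dt"
    by (simp add: dW_upto[OF assms k] shift_add shift_sum add.assoc)
  finally show ?thesis .
qed

lemma const_simps:
  assumes "f \<in> S" "w \<in> Om" "b \<in> S"
  shows "N.cla f (const_poly (w, b)) = const_poly (la f w, f * b)"
    "N.T (const_poly (w, b)) = shift (const_poly (w, b)) - const_poly (DN (w, b))"
    "N.rmul (const_poly (w, b)) (const_poly f) = const_poly (raN (w, b) f)"
proof -
  show "N.cla f (const_poly (w, b)) = const_poly (la f w, f * b)"
    by (rule ext) (auto simp: coeff_act_def const_poly_def laN_def zero_prod_def Om.la_0 assms)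
  show "N.T (const_poly (w, b)) = shift (const_poly (w, b)) - const_poly (DN (w, b))"
    by (rule ext) (simp add: skew_t_def const_poly_def N.D_0)
  show "N.rmul (const_poly (w, b)) (const_poly f) = const_poly (raN (w, b) f)"
    by (rule ext) (use assms in \<open>auto simp: N.ract_const_left const_in const_poly_def N.ra_0\<close>)
qed

text \<open>
  Induction on the degree of \<open>a\<close>. As \<open>t f = f t - \<delta> f\<close>, the step from \<open>a\<close> to \<open>a t\<close> needs
  \<open>d (f t) - d (\<delta> f) = dt f + t df\<close>, which is \<open>d_\<delta>\<close>.
\<close>

lemma dW_mult_const:
  assumes "a \<in> B" "f \<in> S"
  shows "dW (Om.skew_mult a (const_poly f)) = N.rmul (dW a) (const_poly f) + N.act a (dW (const_poly f))"
  using assms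
proof (induction a arbitrary: f rule: finsup_induct)
  case zero
  show "dW (Om.skew_mult 0 (const_poly f)) = N.rmul (dW 0) (const_poly f) + N.act 0 (dW (const_poly f))"
    by (simp only: Om.B.zero_act dW_0 N.zero_ract N.zero_act) simp
next
  case (step h a)
  note h = \<open>h \<in> S\<close> and a = \<open>a \<in> B\<close> and f = \<open>f \<in> S\<close>
  note ins = h a f const_in shift_in shift_in' Om.\<delta>_in dW_in dt_in N.act_in Om.B.act_in N.ract_in N.T_in Om.B.T_in
  let ?f = "const_poly f" and ?f' = "const_poly (\<delta> f)"
  have 1: "dW (Om.skew_mult (const_poly h) ?f) = N.rmul (dW (const_poly h)) ?f + N.act (const_poly h) (dW ?f)"
  proof -
    have "Om.skew_mult (const_poly h) ?f = const_poly (h * f)"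
      by (simp add: Om.B.act_const ins) (rule ext, simp add: coeff_act_def const_poly_def)
    then have "dW (Om.skew_mult (const_poly h) ?f) = const_poly (d (h * f), 0)"
      by (simp add: dW_const Om.mult_in ins)
    moreover have "N.rmul (dW (const_poly h)) ?f = const_poly (ra (d h) f, 0)"
      by (simp add: dW_const const_simps in_rules ins raN_def Om.zero_la)
    moreover have "N.act (const_poly h) (dW ?f) = const_poly (la h (d f), 0)"
      by (simp add: dW_const N.act_const const_simps in_rules ins const_in')
    ultimately show ?thesis
      by (simp add: d_mult ins) (rule ext, simp add: const_poly_def)
  qed
  have tf: "skew_t \<delta> ?f = shift ?f - ?f'" by (rule Om.skew_t_const[OF f])
  \<comment> \<open>The Leibniz rule for the product \<open>t f\<close>.\<close>
  have key: "shift (dW ?f) + N.act ?f dt - dW ?f' = N.rmul dt ?f + N.T (dW ?f)"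
  proof -
    have a: "N.act ?f dt = const_poly (0, f)" "N.rmul dt ?f = const_poly (- la (c l) (d f), f)"
      unfolding dt_def by (simp_all add: N.act_const ins const_simps in_rules const_in' Om.la_0 raN_def Om.zero_ra)
    have T: "N.T (dW ?f) = shift (dW ?f) - const_poly (D (d f), 0)"
      by (simp add: dW_const ins const_simps(2)[OF f] in_rules DN_def Om.zero_la Om.N.zero_in Om.B.D_0)
    have eq: "const_poly (0, f) - const_poly (d (\<delta> f), 0) = const_poly (- la (c l) (d f), f) - const_poly (D (d f), 0)"
      unfolding d_\<delta>[OF f, symmetric] by (rule ext) (simp add: const_poly_def)
    have "shift (dW ?f) + N.act ?f dt - dW ?f' = shift (dW ?f) + (const_poly (0, f) - const_poly (d (\<delta> f), 0))"
      by (simp add: a dW_const Om.\<delta>_in f)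
    also have "\<dots> = N.rmul dt ?f + N.T (dW ?f)"
      unfolding eq a T by simp
    finally show ?thesis .
  qed
  have IH: "dW (Om.skew_mult a (const_poly k)) = N.rmul (dW a) (const_poly k) + N.act a (dW (const_poly k))"
    if "k \<in> S" for k
    by (rule step.IH[OF that])
  have 2: "dW (Om.skew_mult (shift a) ?f) = N.rmul (dW (shift a)) ?f + N.act (shift a) (dW ?f)"
  proof -
    have "dW (Om.skew_mult (shift a) ?f) = dW (shift (Om.skew_mult a ?f)) - dW (Om.skew_mult a ?f')"
      by (simp add: Om.B.act_shift_left ins tf Om.B.act_diff Om.B.act_shift_right dW_diff)
    also have "\<dots> = shift (N.rmul (dW a) ?f) - N.rmul (dW a) ?f' +
        (N.act a (shift (dW ?f)) + N.act a (N.act ?f dt) - N.act a (dW ?f'))"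
      by (simp add: dW_shift ins IH shift_add N.act_act N.act_shift_right algebra_simps)
    also have "shift (N.rmul (dW a) ?f) - N.rmul (dW a) ?f' = N.rmul (shift (dW a)) ?f"
      by (simp add: N.ract_shift_left ins tf N.ract_diff_right N.ract_shift_right)
    also have "N.act a (shift (dW ?f)) + N.act a (N.act ?f dt) - N.act a (dW ?f') =
        N.act a (shift (dW ?f) + N.act ?f dt - dW ?f')"
      by (simp add: N.act_diff N.act_add N.W.add_in ins)
    also have "\<dots> = N.act a (N.rmul dt ?f) + N.act a (N.T (dW ?f))"
      unfolding key by (simp add: N.act_add ins)
    finally have "dW (Om.skew_mult (shift a) ?f) =
        N.rmul (shift (dW a)) ?f + (N.act a (N.rmul dt ?f) + N.act a (N.T (dW ?f)))" .
    then show ?thesis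
      by (simp add: dW_shift ins N.ract_add N.act_ract N.act_shift_left algebra_simps)
  qed
  show "dW (Om.skew_mult (const_poly h + shift a) ?f) =
      N.rmul (dW (const_poly h + shift a)) ?f + N.act (const_poly h + shift a) (dW ?f)"
    by (simp add: Om.B.add_act dW_add N.ract_add N.add_act ins 1 2 algebra_simps)
qed

text \<open>
  Induction on the degree of \<open>b\<close>: right multiplication by \<open>t\<close> satisfies the Leibniz rule by the
  construction of \<open>dW\<close> (\<open>dW_shift\<close>), so the case of constant \<open>b\<close> suffices.
\<close>

lemma dW_mult:
  assumes "a \<in> B" "b \<in> B"
  shows "dW (Om.skew_mult a b) = N.rmul (dW a) b + N.act a (dW b)"
  using assms(2)
proof (induction b rule: finsup_induct)
  case zero
  have "Om.skew_mult a 0 = 0" "N.rmul (dW a) 0 = 0" "N.act a 0 = 0"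
    using Om.B.W.additive_0[of "Om.skew_mult a"] Om.B.act_add[OF assms(1)]
      Om.B.W.additive_0[of "N.rmul (dW a)"] N.add_ract[OF dW_in[OF assms(1)]]
      N.W.additive_0[of "N.act a"] N.act_add[OF assms(1)] by auto
  then show "dW (Om.skew_mult a 0) = N.rmul (dW a) 0 + N.act a (dW 0)" by (simp only: dW_0) simp
next
  case (step f b)
  note a = \<open>a \<in> B\<close> and b = \<open>b \<in> B\<close> and f = \<open>f \<in> S\<close>
  note ins = a b f const_in shift_in shift_in' dW_in dt_in N.act_in Om.B.act_in N.ract_in
  have IH: "dW (Om.skew_mult a b) = N.rmul (dW a) b + N.act a (dW b)" by (rule step.IH)
  have "dW (Om.skew_mult a (shift b)) = N.rmul (dW a) (shift b) + N.act a (dW (shift b))"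
    by (simp add: Om.B.act_shift_right dW_shift ins IH shift_add N.act_act N.act_shift_right N.ract_shift_right
        N.act_add algebra_simps)
  then show "dW (Om.skew_mult a (const_poly f + shift b)) = N.rmul (dW a) (const_poly f + shift b) + N.act a (dW (const_poly f + shift b))"
    by (simp add: Om.B.act_add dW_add N.add_ract N.act_add ins dW_mult_const algebra_simps)
qed


text \<open>
  Scalar multiplication, as multiplication of the coefficients by constants; it commutes with all other
  operations because \<open>\<delta>\<close> vanishes on constants.
\<close>

definition cW :: "'k \<Rightarrow> (nat \<Rightarrow> 'w \<times> 'f) \<Rightarrow> nat \<Rightarrow> 'w \<times> 'f" where
  "cW r = N.cla (c r)"

definition cB :: "'k \<Rightarrow> (nat \<Rightarrow> 'f) \<Rightarrow> nat \<Rightarrow> 'f" where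
  "cB r = coeff_act (*) (c r)"

abbreviation "base_algebra \<equiv> alg_rec S (*) 1 (\<lambda>r. (*) (c r))"
abbreviation "base_bimodule \<equiv> bim_rec Om (\<lambda>r. la (c r)) la ra"
abbreviation "ore_algebra \<equiv> alg_rec B Om.skew_mult (const_poly 1) cB"
abbreviation "ore_bimodule \<equiv> bim_rec W cW N.act N.rmul"
abbreviation "gen \<equiv> shift (const_poly (1 :: 'f))"
abbreviation "emb \<equiv> \<lambda>w. const_poly (w, 0 :: 'f)"

lemma bimodule_base: "bimodule scalars base_algebra base_bimodule"
proof (rule bimodule_recI)
  show "group_carrier S" "group_carrier Om" by unfold_locales
next
  fix r a v assume a: "a \<in> S" and v: "v \<in> Om"
  show "la (c r * a) v = la (c r) (la a v)"
    by (simp add: Om.mult_la c_in a v)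
  show "ra v (c r * a) = la (c r) (ra v a)"
    by (simp add: Om.mult_ra ra_c Om.la_ra c_in a v)
  show "ra (la (c r) v) a = la (c r) (ra v a)"
    by (simp add: Om.la_ra c_in a v)
  show "la a (la (c r) v) = la (c r) (la a v)"
    by (simp add: Om.mult_la[symmetric] c_in a v mult.commute)
qed (auto simp: in_rules c_add c_mult c_one algebra_simps Om.add_la Om.mult_la Om.one_la Om.la_add
    Om.ra_add Om.add_ra Om.one_ra Om.mult_ra Om.la_ra)

lemma fodc_base: "fodc scalars base_algebra base_bimodule d"
  by (intro fodc.intro bimodule_base fodc_axioms.intro) (auto simp: d_in d_add d_c d_mult)

lemma skew_mult_one:
  assumes "a \<in> B"
  shows "Om.skew_mult a (const_poly 1) = a"
  using assms
proof (induction a rule: finsup_induct)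
  case zero
  show "Om.skew_mult 0 (const_poly 1) = 0" by (rule Om.B.zero_act)
next
  case (step f a)
  have IH: "Om.skew_mult a (const_poly 1) = a" by (rule step.IH)
  have t: "skew_t \<delta> (const_poly 1) = gen"
    by (simp add: Om.skew_t_const Om.one_in Om.\<delta>_one) (rule ext, simp add: const_poly_def)
  have "coeff_act (*) f (const_poly 1) = const_poly f"
    by (rule ext) (simp add: coeff_act_def const_poly_def)
  then show "Om.skew_mult (const_poly f + shift a) (const_poly 1) = const_poly f + shift a"
    using step by (simp add: Om.B.add_act const_in shift_in in_rules Om.B.act_const Om.B.act_shift_left t
        Om.B.act_shift_right IH)
qed

lemma T_c: "w \<in> W \<Longrightarrow> N.T (cW r w) = cW r (N.T w)"
  unfolding cW_def by (simp add: N.T_cla c_in \<delta>_c N.zero_cla)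

lemma T_cB: "b \<in> B \<Longrightarrow> skew_t \<delta> (cB r b) = cB r (skew_t \<delta> b)"
  unfolding cB_def by (simp add: Om.B.T_cla c_in \<delta>_c Om.B.zero_cla)

lemma cW_in: "w \<in> W \<Longrightarrow> cW r w \<in> W"
  unfolding cW_def by (rule N.cla_in[OF c_in])

lemma cB_in: "b \<in> B \<Longrightarrow> cB r b \<in> B"
  unfolding cB_def by (rule Om.B.cla_in[OF c_in])

lemma act_c:
  assumes "a \<in> B" "w \<in> W"
  shows "N.act a (cW r w) = cW r (N.act a w)"
  using assms
proof (induction a arbitrary: w rule: finsup_induct)
  case zero
  show "N.act 0 (cW r w) = cW r (N.act 0 w)"
    unfolding N.zero_act cW_def by (rule ext) (simp add: coeff_act_def N.la_0 c_in)
next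
  case (step f a)
  have "N.cla f (cW r w) = cW r (N.cla f w)"
    unfolding cW_def using step by (simp add: N.mult_cla[symmetric] c_in mult.commute)
  moreover have "cW r (N.cla f w + N.act a (N.T w)) = cW r (N.cla f w) + cW r (N.act a (N.T w))"
    unfolding cW_def using step by (intro N.cla_add c_in N.cla_in N.act_in N.T_in)
  ultimately show "N.act (const_poly f + shift a) (cW r w) = cW r (N.act (const_poly f + shift a) w)"
    using step by (simp add: N.add_act const_in shift_in cW_in N.act_const N.act_shift_left T_c N.T_in)
qed

lemma mult_cB:
  assumes "a \<in> B" "b \<in> B"
  shows "Om.skew_mult a (cB r b) = cB r (Om.skew_mult a b)"
  using assms
proof (induction a arbitrary: b rule: finsup_induct)
  case zero
  show "Om.skew_mult 0 (cB r b) = cB r (Om.skew_mult 0 b)"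
    unfolding Om.B.zero_act cB_def by (rule ext) (simp add: coeff_act_def)
next
  case (step f a)
  have "coeff_act (*) f (cB r b) = cB r (coeff_act (*) f b)"
    unfolding cB_def by (rule ext) (simp add: coeff_act_def)
  moreover have "cB r (coeff_act (*) f b + Om.skew_mult a (skew_t \<delta> b)) =
      cB r (coeff_act (*) f b) + cB r (Om.skew_mult a (skew_t \<delta> b))"
    unfolding cB_def by (rule ext) (simp add: coeff_act_def algebra_simps)
  ultimately show "Om.skew_mult (const_poly f + shift a) (cB r b) = cB r (Om.skew_mult (const_poly f + shift a) b)"
    using step by (simp add: Om.B.add_act const_in shift_in cB_in Om.B.act_const Om.B.act_shift_left T_cB Om.B.T_in)
qed

lemma c_act:
  assumes "a \<in> B" "w \<in> W"
  shows "N.act (cB r a) w = cW r (N.act a w)"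
  using N.act_cla[OF c_in assms] by (simp add: cB_def cW_def coeff_act_def[abs_def])

lemma c_skew_mult:
  assumes "a \<in> B" "b \<in> B"
  shows "Om.skew_mult (cB r a) b = cB r (Om.skew_mult a b)"
  using Om.B.act_cla[OF c_in assms] by (simp add: cB_def coeff_act_def[abs_def])

lemma T_pow_cB: "b \<in> B \<Longrightarrow> (skew_t \<delta> ^^ n) (cB r b) = cB r ((skew_t \<delta> ^^ n) b)"
  by (induction n) (auto simp: T_cB Om.B.T_pow_in)

lemma raN_c:
  assumes "v \<in> N" "f \<in> S"
  shows "raN v (c r * f) = laN (c r) (raN v f)"
proof -
  have "d (c r) = 0" using d_c[OF Om.one_in, of r] by (simp add: d_one Om.la_0 c_in)
  then have "raN v (c r) = laN (c r) v"
    using assms by (auto simp: raN_def laN_def ra_c Om.la_0 in_rules)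
  then show ?thesis using assms N.mult_ra[OF c_in assms(2,1)] by (simp add: N.la_ra c_in)
qed

lemma rmul_c:
  assumes "w \<in> W" "b \<in> B"
  shows "N.rmul w (cB r b) = cW r (N.rmul w b)"
proof
  fix k
  have "N.rmul w (cB r b) k = (\<Sum>n\<in>{n. w n \<noteq> 0}. raN (w n) (c r * (skew_t \<delta> ^^ n) b k))"
    unfolding N.rmul_def by (simp add: T_pow_cB assms) (simp add: cB_def coeff_act_def)
  also have "\<dots> = (\<Sum>n\<in>{n. w n \<noteq> 0}. laN (c r) (raN (w n) ((skew_t \<delta> ^^ n) b k)))"
    by (intro sum.cong refl raN_c finsup_nth[OF assms(1)] N.T_pow_nth[OF assms(2)])
  also have "\<dots> = laN (c r) (\<Sum>n\<in>{n. w n \<noteq> 0}. raN (w n) ((skew_t \<delta> ^^ n) b k))"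
    by (rule N.N.sum_additive[symmetric])
      (rule N.la_add[OF c_in], assumption, assumption, rule N.ra_in[OF N.T_pow_nth[OF assms(2)] finsup_nth[OF assms(1)]])
  finally show "N.rmul w (cB r b) k = cW r (N.rmul w b) k"
    by (simp add: cW_def coeff_act_def N.rmul_def)
qed

lemma bimodule_ore: "bimodule scalars ore_algebra ore_bimodule"
proof (rule bimodule_recI)
  show "group_carrier B" "group_carrier W" by unfold_locales
  show "const_poly 1 \<in> B" by (rule const_in[OF Om.one_in])
next
  fix a assume a: "a \<in> B"
  have "coeff_act (*) 1 a = a" by (rule ext) (simp add: coeff_act_def)
  then show "Om.skew_mult (const_poly 1) a = a" "cB 1 a = a"
    by (simp_all add: Om.B.act_const a Om.one_in cB_def c_one)
  show "Om.skew_mult a (const_poly 1) = a" by (rule skew_mult_one[OF a])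
  fix r q
  show "cB (r + q) a = cB r a + cB q a" "cB (r * q) a = cB r (cB q a)"
    by (rule ext, simp add: cB_def coeff_act_def c_add c_mult algebra_simps)+
next
  fix r :: 'k and a b assume "a \<in> B" "b \<in> B"
  show "cB r (a + b) = cB r a + cB r b"
    by (rule ext) (simp add: cB_def coeff_act_def algebra_simps)
next
  fix r q :: 'k and v assume v: "v \<in> W"
  show "cW (r + q) v = cW r v + cW q v" "cW (r * q) v = cW r (cW q v)"
    by (simp_all add: cW_def c_add c_mult N.add_cla N.mult_cla c_in v)
  show "cW 1 v = v" by (simp add: cW_def c_one N.one_cla v)
next
  fix r and v w assume "v \<in> W" "w \<in> W"
  then show "cW r (v + w) = cW r v + cW r w" by (simp add: cW_def N.cla_add c_in)
next
  fix v assume v: "v \<in> W"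
  show "N.act (const_poly 1) v = v" by (simp add: N.act_const Om.one_in v N.one_cla)
next
  fix r a v assume "a \<in> B" "v \<in> W"
  then show "N.rmul (cW r v) a = cW r (N.rmul v a)" by (simp add: cW_def N.cla_ract c_in)
qed (simp_all only: cB_in cW_in Om.B.act_in N.act_in N.ract_in Om.B.act_add Om.B.add_act Om.B.act_act
    c_skew_mult mult_cB N.act_add N.add_act N.ract_add N.add_ract N.ract_one N.act_act N.ract_ract N.act_ract
    c_act act_c rmul_c)

lemma dW_c:
  assumes "a \<in> B"
  shows "dW (cB r a) = cW r (dW a)"
proof -
  have "dW (Om.skew_mult (const_poly (c r)) a) =
      N.rmul (const_poly (d (c r), 0)) a + N.act (const_poly (c r)) (dW a)"
    by (simp add: dW_mult dW_const const_in c_in assms)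
  moreover have "d (c r) = 0" using d_c[OF Om.one_in, of r] by (simp add: d_one Om.la_0 c_in)
  moreover have "const_poly (0, 0) = (0 :: nat \<Rightarrow> 'w \<times> 'f)"
    by (rule ext) (simp add: const_poly_def zero_prod_def)
  ultimately show ?thesis
    by (simp add: Om.B.act_const N.act_const c_in assms dW_in cB_def cW_def N.zero_ract)
qed

lemma emb_inj: "inj_on emb Om"
  by (rule inj_onI) (metis const_poly_def fst_conv)

lemma extension: "fodc_extension scalars base_algebra base_bimodule d ore_algebra ore_bimodule dW const_poly emb"
proof (intro fodc_extension.intro fodc_extension_axioms.intro fodc_base fodc.intro bimodule_ore fodc_axioms.intro)
  show "const_poly \<in> ring_hom base_algebra ore_algebra"
  proof (rule ring_hom_memI)
    fix f h assume f: "f \<in> carrier base_algebra" and h: "h \<in> carrier base_algebra"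
    show "const_poly (f \<otimes>\<^bsub>base_algebra\<^esub> h) = const_poly f \<otimes>\<^bsub>ore_algebra\<^esub> const_poly h"
      using f h by (simp add: Om.B.act_const const_in) (rule ext, simp add: const_poly_def coeff_act_def)
    show "const_poly (f \<oplus>\<^bsub>base_algebra\<^esub> h) = const_poly f \<oplus>\<^bsub>ore_algebra\<^esub> const_poly h"
      by simp (rule ext, simp add: const_poly_def)
  qed (simp_all add: const_in)
  show "inj_on const_poly (carrier base_algebra)" by (rule inj_onI) (metis const_poly_def)
  show "inj_on emb (carrier base_bimodule)" by (simp add: emb_inj)
  show "const_poly (r \<odot>\<^bsub>base_algebra\<^esub> f) = r \<odot>\<^bsub>ore_algebra\<^esub> const_poly f" for r f
    by simp (rule ext, simp add: const_poly_def cB_def coeff_act_def)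
  show "emb (w \<oplus>\<^bsub>base_bimodule\<^esub> v) = emb w \<oplus>\<^bsub>ore_bimodule\<^esub> emb v" for w v
    by simp (rule ext, simp add: const_poly_def)
  show "emb (r \<odot>\<^bsub>base_bimodule\<^esub> w) = r \<odot>\<^bsub>ore_bimodule\<^esub> emb w" if "w \<in> carrier base_bimodule" for r w
    using that by (simp add: cW_def const_simps c_in Om.S.zero_in)
  show "emb (lact base_bimodule f w) = lact ore_bimodule (const_poly f) (emb w)"
    if "f \<in> carrier base_algebra" "w \<in> carrier base_bimodule" for f w
    using that by (simp add: N.act_const const_in' const_simps Om.S.zero_in)
  show "emb (ract base_bimodule w f) = ract ore_bimodule (emb w) (const_poly f)"
    if "f \<in> carrier base_algebra" "w \<in> carrier base_bimodule" for f w
    using that by (simp add: const_simps Om.S.zero_in raN_def Om.zero_la d_in)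
qed (simp_all add: dW_in dW_add dW_c dW_mult dW_const const_in' Om.S.zero_in)

section \<open>Relations and normal form\<close>

lemma dW_gen: "dW gen = dt"
proof -
  have "shift (const_poly (0 :: 'w \<times> 'f)) = 0"
    by (rule ext) (simp add: const_poly_def shift_def split: nat.split)
  then show ?thesis
    by (simp add: dW_shift const_in Om.one_in dW_const d_one N.act_const dt_in N.one_cla zero_prod_def[symmetric])
qed

lemma ore_minus:
  assumes "x \<in> W" "y \<in> W"
  shows "x \<ominus>\<^bsub>ore_bimodule\<^esub> y = x - y"
proof -
  interpret abelian_group ore_bimodule
    by (rule N.W.abelian_group_record) simp_all
  have "\<ominus>\<^bsub>ore_bimodule\<^esub> y = - y"
    by (rule minus_equality) (use assms N.W.uminus_in in auto)
  then show ?thesis by (simp add: a_minus_def)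
qed

lemma comm_gen:
  assumes "w \<in> Om" "b \<in> S"
  shows "comm_wa ore_bimodule (const_poly (w, b)) gen = const_poly (DN (w, b))"
proof -
  let ?w = "const_poly (w, b)"
  have w: "?w \<in> W" by (rule const_in'[OF assms])
  have 1: "N.act gen ?w = N.T ?w"
    by (simp add: N.act_shift_left const_in Om.one_in w N.act_const N.T_in N.one_cla)
  have 2: "N.rmul ?w gen = shift ?w"
    by (simp add: N.ract_shift_right const_in Om.one_in w N.ract_one)
  have "comm_wa ore_bimodule ?w gen = shift ?w - N.T ?w"
    using w by (simp add: comm_wa_def 1 2 ore_minus shift_in' N.T_in)
  then show ?thesis by (simp add: const_simps(2)[OF Om.one_in assms])
qed

lemma comm_emb:
  assumes "w \<in> Om"
  shows "comm_wa ore_bimodule (emb w) gen = emb (D w)"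
  unfolding comm_gen[OF assms Om.S.zero_in]
  by (simp add: DN_def Om.zero_la e_in Om.B.D_0)

lemma comm_dt_gen: "comm_wa ore_bimodule dt gen = emb e \<ominus>\<^bsub>ore_bimodule\<^esub> cW l dt"
proof -
  have 1: "cW l dt = const_poly (0, c l)"
    unfolding cW_def dt_def by (simp add: const_simps in_rules Om.la_0)
  have "comm_wa ore_bimodule dt gen = const_poly (e, - c l)"
    unfolding dt_def comm_gen[OF Om.N.zero_in Om.one_in]
    by (simp add: DN_def Om.D_0 Om.one_la e_in Om.\<delta>_one)
  also have "\<dots> = emb e - const_poly (0, c l)"
    by (rule ext) (simp add: const_poly_def)
  finally show ?thesis by (simp add: 1 ore_minus const_in' in_rules)
qed

lemma comm_dt:
  assumes "f \<in> S"
  shows "comm_aw ore_bimodule (const_poly f) dt = cW l (dW (const_poly f))"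
proof -
  have 1: "N.act (const_poly f) dt = const_poly (0, f)"
    unfolding dt_def by (simp add: N.act_const assms const_in' const_simps in_rules Om.la_0)
  have 2: "N.rmul dt (const_poly f) = const_poly (- la (c l) (d f), f)"
    unfolding dt_def by (simp add: const_simps assms in_rules raN_def Om.zero_ra)
  have "cW l (dW (const_poly f)) = const_poly (la (c l) (d f), 0)"
    by (simp add: cW_def dW_const assms const_simps in_rules)
  moreover have "const_poly (0, f) - const_poly (- la (c l) (d f), f) = const_poly (la (c l) (d f), 0)"
    by (rule ext) (simp add: const_poly_def zero_prod_def)
  ultimately show ?thesis
    by (simp add: comm_aw_def 1 2 ore_minus const_in' in_rules assms Om.N.uminus_in)
qed

lemma gen_pow: "gen [^]\<^bsub>ore_algebra\<^esub> (n :: nat) = (shift ^^ n) (const_poly 1)"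
proof (induction n)
  case 0
  show ?case by (simp add: nat_pow_def)
next
  case (Suc n)
  have in_B: "(shift ^^ n) (const_poly 1) \<in> B"
    by (induction n) (auto simp: const_in Om.one_in shift_in)
  have "gen [^]\<^bsub>ore_algebra\<^esub> Suc n = Om.skew_mult (gen [^]\<^bsub>ore_algebra\<^esub> n) gen"
    by (simp add: nat_pow_def)
  also have "\<dots> = shift (Om.skew_mult ((shift ^^ n) (const_poly 1)) (const_poly 1))"
    unfolding Suc.IH by (rule Om.B.act_shift_right[OF in_B const_in[OF Om.one_in]])
  finally show ?case by (simp add: skew_mult_one in_B)
qed

lemma gen_pow_in: "(shift ^^ n) (const_poly 1) \<in> B"
  by (induction n) (auto simp: const_in Om.one_in shift_in)

lemma rmul_gen_pow:
  assumes "w \<in> W"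
  shows "N.rmul w ((shift ^^ n) (const_poly 1)) = (shift ^^ n) w"
proof (induction n)
  case (Suc n)
  have in_B: "(shift ^^ n) (const_poly 1) \<in> B"
    by (induction n) (auto simp: const_in Om.one_in shift_in)
  show ?case by (simp add: N.ract_shift_right assms in_B Suc)
qed (simp add: N.ract_one assms)

lemma shift_pow_const: "(shift ^^ n) (const_poly v) k = (if k = n then v else 0)"
  by (induction n arbitrary: k) (auto simp: const_poly_def shift_def split: nat.split)

lemma finsum_ore:
  assumes "finite I" "\<And>n. n \<in> I \<Longrightarrow> x n \<in> W"
  shows "(\<Oplus>\<^bsub>ore_bimodule\<^esub>n\<in>I. x n) = (\<Sum>n\<in>I. x n)"
proof -
  interpret abelian_group ore_bimodule
    by (rule N.W.abelian_group_record) simp_all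
  show ?thesis using assms
    by (induction I rule: finite_induct) (simp_all add: Pi_iff)
qed

text \<open>
  The summand of index \<open>n\<close> is the monomial \<open>(w n + b n dt) t\<^sup>n\<close>, so the map is the identity on coefficient
  sequences.
\<close>

lemma normal_form:
  "bij_betw (\<lambda>(w, b). \<Oplus>\<^bsub>ore_bimodule\<^esub>n\<in>{n. w n \<noteq> 0 \<or> b n \<noteq> 0}.
      ract ore_bimodule (emb (w n) \<oplus>\<^bsub>ore_bimodule\<^esub> lact ore_bimodule (const_poly (b n)) dt) (gen [^]\<^bsub>ore_algebra\<^esub> (n :: nat)))
    {(w, b). (\<forall>n. w n \<in> Om \<and> b n \<in> S) \<and> finite {n. w n \<noteq> 0 \<or> b n \<noteq> 0}} W"
  (is "bij_betw ?F ?X W")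
proof -
  have F: "?F (w, b) = (\<lambda>n. (w n, b n))" if wb: "(w, b) \<in> ?X" for w b
  proof -
    let ?I = "{n. w n \<noteq> 0 \<or> b n \<noteq> 0}"
    have I: "finite ?I" and w: "w n \<in> Om" and b: "b n \<in> S" for n using wb by auto
    have "emb (w n) + N.act (const_poly (b n)) dt = const_poly (w n, b n)" for n
    proof -
      have "N.act (const_poly (b n)) dt = const_poly (0, b n)"
        unfolding dt_def by (simp add: N.act_const b const_in' const_simps in_rules Om.la_0)
      then show ?thesis by simp (rule ext, simp add: const_poly_def zero_prod_def)
    qed
    then have "?F (w, b) = (\<Oplus>\<^bsub>ore_bimodule\<^esub>n\<in>?I. (shift ^^ n) (const_poly (w n, b n)))"
      by (simp add: gen_pow rmul_gen_pow const_in' w b)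
    also have "\<dots> = (\<Sum>n\<in>?I. (shift ^^ n) (const_poly (w n, b n)))"
    proof (rule finsum_ore[OF I])
      show "(shift ^^ n) (const_poly (w n, b n)) \<in> W" for n
        using N.ract_in[OF const_in'[OF w b], of "(shift ^^ n) (const_poly 1)" n n]
        by (metis rmul_gen_pow const_in' w b gen_pow_in)
    qed
    also have "\<dots> = (\<lambda>n. (w n, b n))"
    proof (rule ext)
      fix k
      have "(\<Sum>n\<in>?I. if k = n then (w n, b n) else 0) = (if k \<in> ?I then (w k, b k) else 0)"
        by (rule sum.delta'[OF I])
      then show "(\<Sum>n\<in>?I. (shift ^^ n) (const_poly (w n, b n))) k = (w k, b k)"
        by (simp only: sum_fun_apply shift_pow_const) (auto simp: zero_prod_def)
    qed
    finally show ?thesis .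
  qed
  have bij: "bij_betw (\<lambda>(w, b) n. (w n, b n)) ?X W"
  proof (rule bij_betw_byWitness[where f' = "\<lambda>x. (\<lambda>n. fst (x n), \<lambda>n. snd (x n))"])
    show "(\<lambda>(w, b) n. (w n, b n)) ` ?X \<subseteq> W"
      by (auto simp: finsup_def zero_prod_def)
    show "(\<lambda>x. (\<lambda>n. fst (x n), \<lambda>n. snd (x n))) ` W \<subseteq> ?X"
      by (auto simp: finsup_def zero_prod_def prod_eq_iff mem_Times_iff)
  qed auto
  have "?F x = (\<lambda>(w, b) n. (w n, b n)) x" if "x \<in> ?X" for x
    using F that by (cases x) (simp only: prod.case)
  from bij_betw_cong[of ?X ?F "\<lambda>(w, b) n. (w n, b n)" W, OF this] bij show ?thesis by (simp only:)
qed

end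

section \<open>Differential operators as algebraic data\<close>

context manifold
begin

lemma smooth_fun_const: "smooth_fun A (\<lambda>p. a)"
  by (simp add: smooth_fun_def smooth_in_const)

lemma smooth_fun_add: "smooth_fun A f \<Longrightarrow> smooth_fun A h \<Longrightarrow> smooth_fun A (\<lambda>p. f p + h p)"
  by (simp add: smooth_fun_def smooth_in_add coord)

lemma smooth_fun_diff: "smooth_fun A f \<Longrightarrow> smooth_fun A h \<Longrightarrow> smooth_fun A (\<lambda>p. f p - h p)"
  by (simp add: smooth_fun_def smooth_in_diff coord)

lemma smooth_fun_minus: "smooth_fun A f \<Longrightarrow> smooth_fun A (\<lambda>p. - f p)"
  by (simp add: smooth_fun_def smooth_in_minus coord)

lemma smooth_fun_mult:
  fixes f :: "'m \<Rightarrow> 'k::real_normed_field"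
  shows "smooth_fun A f \<Longrightarrow> smooth_fun A h \<Longrightarrow> smooth_fun A (\<lambda>p. f p * h p)"
  by (simp add: smooth_fun_def smooth_in_mult coord)

lemma one_form_0: "one_form A (\<lambda>c p. 0)"
  by (simp add: one_form_def smooth_in_const)

lemma one_form_add:
  assumes "one_form A \<omega>" "one_form A \<eta>"
  shows "one_form A (\<lambda>c p. \<omega> c p + \<eta> c p)"
proof (rule one_formI)
  show "\<omega> c p + \<eta> c p = 0" if "c \<notin> A \<or> p \<notin> fst c" for c p
    using one_form_zero[OF assms(1) that] one_form_zero[OF assms(2) that] by simp
  show "smoothV c (\<lambda>p. \<omega> c p + \<eta> c p)" if "c \<in> A" for c
    by (rule smoothV_add[OF coord[OF that] one_form_smooth[OF assms(1) that] one_form_smooth[OF assms(2) that]])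
  show "\<omega> c p + \<eta> c p = transpose (jk c d p) *v (\<omega> d p + \<eta> d p)"
    if cd: "c \<in> A" "d \<in> A" "p \<in> fst c" "p \<in> fst d" for c d p
    by (simp only: one_form_change[OF assms(1) cd] one_form_change[OF assms(2) cd] matrix_vector_right_distrib)
qed

lemma one_form_scale:
  assumes f: "smooth_fun A f" and w: "one_form A \<omega>"
  shows "one_form A (\<lambda>c p. f p *s \<omega> c p)"
proof (rule one_formI)
  show "f p *s \<omega> c p = 0" if "c \<notin> A \<or> p \<notin> fst c" for c p
    using one_form_zero[OF w that] by simp
  show "smoothV c (\<lambda>p. f p *s \<omega> c p)" if c: "c \<in> A" for c
    using one_form_smooth[OF w c] smooth_funD[OF f c]
    by (simp add: smoothV_def smooth_in_mult[OF coord[OF c]])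
  show "f p *s \<omega> c p = transpose (jk c d p) *v (f p *s \<omega> d p)"
    if cd: "c \<in> A" "d \<in> A" "p \<in> fst c" "p \<in> fst d" for c d p
    by (simp only: one_form_change[OF w cd] vector_scalar_commute)
qed

lemma apply_field_add:
  assumes "smooth_fun A f" "smooth_fun A h"
  shows "apply_field A X (\<lambda>p. f p + h p) p = apply_field A X f p + apply_field A X h p"
  using assms[THEN smooth_funD, OF chart_at(1)]
  by (simp add: apply_field_def Let_def pd_add[OF coord[OF chart_at(1)] chart_at(2)] algebra_simps sum.distrib)

lemma apply_field_mult:
  assumes "smooth_fun A f" "smooth_fun A h"
  shows "apply_field A X (\<lambda>p. f p * h p) p = apply_field A X f p * h p + f p * apply_field A X h p"
  using assms[THEN smooth_funD, OF chart_at(1)]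
  by (simp add: apply_field_def Let_def pd_mult[OF coord[OF chart_at(1)] chart_at(2)] algebra_simps
      sum.distrib sum_distrib_left)

lemma apply_field_const: "apply_field A X (\<lambda>p. a) p = 0"
  by (simp add: apply_field_def)

lemma ext_d_add:
  assumes "smooth_fun A f" "smooth_fun A h"
  shows "ext_d A (\<lambda>p. f p + h p) c p = ext_d A f c p + ext_d A h c p"
  using assms[THEN smooth_funD, of c]
  by (auto simp: ext_d_def vec_eq_iff pd_add coord)

lemma ext_d_mult:
  assumes "smooth_fun A f" "smooth_fun A h"
  shows "ext_d A (\<lambda>p. f p * h p) c p = h p *s ext_d A f c p + f p *s ext_d A h c p"
  using assms[THEN smooth_funD, of c]
  by (auto simp: ext_d_def vec_eq_iff pd_mult coord mult.commute)

lemma ext_d_const: "ext_d A (\<lambda>p. a) c p = 0"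
  by (simp add: ext_d_def vec_eq_iff)

lemma lie_form_add:
  assumes X: "vector_field A X" and w: "one_form A \<omega>" and e: "one_form A \<eta>"
  shows "lie_form X (\<lambda>c p. \<omega> c p + \<eta> c p) c p = lie_form X \<omega> c p + lie_form X \<eta> c p"
proof (cases "c \<in> A \<and> p \<in> fst c")
  case True
  then show ?thesis using one_form_smooth[OF w, of c] one_form_smooth[OF e, of c]
    by (simp add: lie_form_def vec_eq_iff smoothV_def pd_add coord algebra_simps sum.distrib)
next
  case False
  then show ?thesis
    using vector_field_zero[OF X, of c p] one_form_zero[OF w, of c p] one_form_zero[OF e, of c p]
    by (auto simp: lie_form_def vec_eq_iff)
qed

lemma lie_form_scale:
  assumes X: "vector_field A X" and f: "smooth_fun A f" and w: "one_form A \<omega>"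
  shows "lie_form X (\<lambda>c p. f p *s \<omega> c p) c p = apply_field A X f p *s \<omega> c p + f p *s lie_form X \<omega> c p"
proof (cases "c \<in> A \<and> p \<in> fst c")
  case True
  then have c: "c \<in> A" "p \<in> fst c" by auto
  show ?thesis using one_form_smooth[OF w c(1)] smooth_funD[OF f c(1)]
    by (simp add: lie_form_def vec_eq_iff smoothV_def pd_mult[OF coord[OF c(1)] c(2)] apply_field_eq[OF X f c] dird_def
        algebra_simps sum.distrib sum_distrib_left)
next
  case False
  then show ?thesis
    using vector_field_zero[OF X, of c p] one_form_zero[OF w, of c p]
    by (auto simp: lie_form_def vec_eq_iff)
qed

end

lemma inv_metric_add_left:
    "inv_metric A g (\<lambda>c p. \<omega> c p + \<omega>' c p) \<eta> p = inv_metric A g \<omega> \<eta> p + inv_metric A g \<omega>' \<eta> p"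
  and inv_metric_add_right:
    "inv_metric A g \<eta> (\<lambda>c p. \<omega> c p + \<omega>' c p) p = inv_metric A g \<eta> \<omega> p + inv_metric A g \<eta> \<omega>' p"
  and inv_metric_diff_left:
    "inv_metric A g (\<lambda>c p. \<omega> c p - \<omega>' c p) \<eta> p = inv_metric A g \<omega> \<eta> p - inv_metric A g \<omega>' \<eta> p"
  and inv_metric_scale_left: "inv_metric A g (\<lambda>c p. f p *s \<omega> c p) \<eta> p = f p * inv_metric A g \<omega> \<eta> p"
  and inv_metric_scale_right: "inv_metric A g \<eta> (\<lambda>c p. f p *s \<omega> c p) p = f p * inv_metric A g \<eta> \<omega> p"
  and inv_metric_0_left: "inv_metric A g (\<lambda>c p. 0) \<eta> p = 0"
  and inv_metric_0_right: "inv_metric A g \<eta> (\<lambda>c p. 0) p = 0"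
  by (simp_all add: inv_metric_def Let_def scaleR_conv_of_real algebra_simps sum.distrib sum_subtractf sum_distrib_left)

context riemannian
begin

lemma inv_metric_commute:
  assumes "one_form A \<omega>" "one_form A \<eta>"
  shows "inv_metric A g \<omega> \<eta> p = inv_metric A g \<eta> \<omega> p"
  using inv_metric_eq[OF assms chart_at] inv_metric_eq[OF assms(2,1) chart_at]
  by (metis dot_commute dot_matrix hk_transpose[OF chart_at])

lemma divc_add:
  assumes c: "c \<in> A" "p \<in> fst c" and u: "smoothV c u" and v: "smoothV c v"
  shows "divc g c (\<lambda>q. u q + v q) p = divc g c u p + divc g c v p"
proof -
  have "jacV c (\<lambda>q. u q + v q) p = jacV c u p + jacV c v p"
    using u v by (simp add: vec_eq_iff jacV_def smoothV_def pd_add[OF coord[OF c(1)] c(2)])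
  then show ?thesis by (simp add: divc_dlog_volume trace_add dot_add_right)
qed

lemma laplace_beltrami_add:
  assumes f: "smooth_fun A f" and h: "smooth_fun A h"
  shows "laplace_beltrami A g (\<lambda>p. f p + h p) p = laplace_beltrami A g f p + laplace_beltrami A g h p"
proof -
  note c = chart_at[of p]
  let ?c = "chart_at A p"
  note sf = vector_field_smooth[OF vector_field_sharp[OF one_form_ext_d[OF f]] c(1)]
    and sh = vector_field_smooth[OF vector_field_sharp[OF one_form_ext_d[OF h]] c(1)]
  have "sharp g (ext_d A (\<lambda>p. f p + h p)) ?c = (\<lambda>q. sharp g (ext_d A f) ?c q + sharp g (ext_d A h) ?c q)"
    by (rule ext) (simp add: sharp_eq ext_d_add[OF f h] matrix_vector_right_distrib)
  then show ?thesis
    unfolding laplace_beltrami_eq[OF smooth_fun_add[OF f h] c] laplace_beltrami_eq[OF f c] laplace_beltrami_eq[OF h c]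
    by (simp add: divc_add[OF c sf sh])
qed

lemma laplace_beltrami_mult:
  assumes f: "smooth_fun A f" and h: "smooth_fun A h"
  shows "laplace_beltrami A g (\<lambda>p. f p * h p) p =
    h p * laplace_beltrami A g f p + f p * laplace_beltrami A g h p + 2 * inv_metric A g (ext_d A f) (ext_d A h) p"
proof -
  note c = chart_at[of p]
  let ?c = "chart_at A p"
  let ?F = "sharp g (ext_d A f) ?c" and ?H = "sharp g (ext_d A h) ?c"
  note df = one_form_ext_d[OF f] and dh = one_form_ext_d[OF h]
  note sf = vector_field_smooth[OF vector_field_sharp[OF df] c(1)]
    and sh = vector_field_smooth[OF vector_field_sharp[OF dh] c(1)]
  note cf = smooth_funD[OF f c(1)] and ch = smooth_funD[OF h c(1)]
  have s: "smoothV ?c (\<lambda>q. h q *s ?F q)" "smoothV ?c (\<lambda>q. f q *s ?H q)"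
    using sf sh cf ch by (simp_all add: smoothV_def smooth_in_mult[OF coord[OF c(1)]])
  have "sharp g (ext_d A (\<lambda>p. f p * h p)) ?c = (\<lambda>q. h q *s ?F q + f q *s ?H q)"
    by (rule ext) (simp add: sharp_eq ext_d_mult[OF f h] matrix_vector_right_distrib vector_scalar_commute)
  then have "laplace_beltrami A g (\<lambda>p. f p * h p) p =
     h p * divc g ?c ?F p + dird ?c (?F p) h p + (f p * divc g ?c ?H p + dird ?c (?H p) f p)"
    unfolding laplace_beltrami_eq[OF smooth_fun_mult[OF f h] c]
    by (simp add: divc_add[OF c s] divc_scale[OF c sf ch] divc_scale[OF c sh cf])
  then show ?thesis
    unfolding dird_sharp[OF h df c] dird_sharp[OF f dh c] laplace_beltrami_eq[OF f c, symmetric]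
      laplace_beltrami_eq[OF h c, symmetric] inv_metric_commute[OF dh df]
    by simp
qed

lemma laplace_beltrami_const:
  fixes a :: "'k::real_normed_field"
  shows "laplace_beltrami A g (\<lambda>p. a) p = 0"
proof -
  have "divc g c (sharp g (ext_d A (\<lambda>p. a)) c) p = 0" for c
    by (simp add: divc_dlog_volume sharp_eq ext_d_const jacV_def trace_def dot_def)
  then show ?thesis by (simp add: laplace_beltrami_eq[OF smooth_fun_const chart_at])
qed

end

context conformal
begin

lemma apply_field_inv_metric_ext_d:
  assumes w: "one_form A \<omega>" and f: "smooth_fun A f"
  shows "apply_field A \<tau> (inv_metric A g \<omega> (ext_d A f)) p =
    inv_metric A g (lie_form \<tau> \<omega>) (ext_d A f) p + inv_metric A g \<omega> (ext_d A (apply_field A \<tau> f)) p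
    - \<phi> p * inv_metric A g \<omega> (ext_d A f) p"
  unfolding apply_field_inv_metric[OF w one_form_ext_d[OF f]] lie_form_ext_d[OF f] ..

text \<open>
  This is the identity \<open>(X*, df) = X f\<close>, with \<open>X*\<close> the 1-form dual to \<open>X\<close>.
\<close>

lemma inv_metric_flat:
  assumes X: "vector_field A X" and f: "smooth_fun A f"
  shows "inv_metric A g (flat g X) (ext_d A f) p = apply_field A X f p"
proof -
  note c = chart_at[of p]
  let ?c = "chart_at A p"
  have "inv_metric A g (flat g X) (ext_d A f) p = dot (gk g ?c p *v X ?c p) (hk g ?c p *v ext_d A f ?c p)"
    by (simp only: inv_metric_eq[OF one_form_flat[OF X] one_form_ext_d[OF f] c] flat_eq)
  also have "\<dots> = dot (X ?c p) ((gk g ?c p ** hk g ?c p) *v ext_d A f ?c p)"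
    by (simp only: dot_matrix gk_transpose[OF c] matrix_vector_mul_assoc)
  also have "\<dots> = apply_field A X f p"
    by (simp only: gk_hk[OF c] matrix_vector_mul_lid ext_d_eq[OF c] apply_field_eq[OF X f c] dird_eq_dot)
  finally show ?thesis .
qed

text \<open>
  Apply \<open>\<tau>\<close> to \<open>(X*, df) = X f\<close>: the inverse metric contributes its weight, and the Lie derivative of \<open>df\<close> is
  \<open>d (\<tau> f)\<close>.
\<close>

lemma apply_field_commutator:
  assumes X: "vector_field A X" and f: "smooth_fun A f"
  shows "apply_field A X (apply_field A \<tau> f) p = apply_field A \<tau> (apply_field A X f) p + \<phi> p * apply_field A X f p
    - inv_metric A g (lie_form \<tau> (flat g X)) (ext_d A f) p"
proof -
  have "inv_metric A g (flat g X) (ext_d A f) = apply_field A X f"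
    by (rule ext) (rule inv_metric_flat[OF X f])
  then show ?thesis
    using apply_field_inv_metric_ext_d[OF one_form_flat[OF X] f, of p]
      inv_metric_flat[OF X smooth_fun_apply_field[OF tau f], of p]
    by simp
qed

end

section \<open>The calculus on the crossed product\<close>

text \<open>
  The conformal factor is \<open>1 + \<alpha>\<close>. The derivation of functions is \<open>l \<tau>\<close>, and \<open>D\<close> is the commutator with \<open>t\<close> on
  \<open>\<omega> + a \<theta>'\<close>, which takes \<open>\<theta>'\<close> to \<open>\<alpha> l \<theta>'\<close>.
\<close>

locale conformal_calculus = conformal A g \<tau> "\<lambda>p. 1 + \<alpha> p"
  for A :: "('m::topological_space, 'n::finite) chart set" and g
    and \<tau> :: "('m, 'n, 'k::real_normed_field) field" and \<alpha> +
  fixes \<zeta> :: "('m, 'n, 'k) field" and \<beta> :: "'m \<Rightarrow> 'k" and l :: 'k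
  assumes zeta: "vector_field A \<zeta>" and beta: "smooth_fun A \<beta>"
begin

lemma alpha: "smooth_fun A \<alpha>"
  using smooth_fun_diff[OF phi smooth_fun_const[of 1]] by simp

lemma ext_d_alpha: "ext_d A (\<lambda>p. 1 + \<alpha> p) = ext_d A \<alpha>"
  by (intro ext) (simp add: ext_d_add[OF smooth_fun_const alpha] ext_d_const)

definition S :: "('m \<Rightarrow> 'k) set" where "S = {f. smooth_fun A f}"

definition \<delta> :: "('m \<Rightarrow> 'k) \<Rightarrow> 'm \<Rightarrow> 'k" where
  "\<delta> f p = l * apply_field A \<tau> f p"

definition Om :: "(('m, 'n, 'k) field \<times> ('m \<Rightarrow> 'k)) set" where
  "Om = {(\<omega>, a). one_form A \<omega> \<and> smooth_fun A a}"

definition la :: "('m \<Rightarrow> 'k) \<Rightarrow> ('m, 'n, 'k) field \<times> ('m \<Rightarrow> 'k) \<Rightarrow> ('m, 'n, 'k) field \<times> ('m \<Rightarrow> 'k)" where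
  "la f = (\<lambda>(\<omega>, a). (\<lambda>c p. f p *s \<omega> c p, \<lambda>p. f p * a p))"

definition ra :: "('m, 'n, 'k) field \<times> ('m \<Rightarrow> 'k) \<Rightarrow> ('m \<Rightarrow> 'k) \<Rightarrow> ('m, 'n, 'k) field \<times> ('m \<Rightarrow> 'k)" where
  "ra = (\<lambda>(\<omega>, a) f. (\<lambda>c p. f p *s \<omega> c p, \<lambda>p. f p * a p + l * inv_metric A g \<omega> (ext_d A f) p))"

definition \<kappa> :: "('m, 'n, 'k) field \<Rightarrow> 'm \<Rightarrow> 'k" where
  "\<kappa> \<omega> p = - l\<^sup>2 * ((of_nat CARD('n) - 2) / 4) * inv_metric A g (ext_d A \<alpha>) \<omega> p
     - l\<^sup>2 / 2 * inv_metric A g (lie_form \<tau> (flat g \<zeta>)) \<omega> p"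

definition D :: "('m, 'n, 'k) field \<times> ('m \<Rightarrow> 'k) \<Rightarrow> ('m, 'n, 'k) field \<times> ('m \<Rightarrow> 'k)" where
  "D = (\<lambda>(\<omega>, a). (\<lambda>c p. l *s (lie_form \<tau> \<omega> c p - \<omega> c p),
     \<lambda>p. \<kappa> \<omega> p + l * (\<alpha> p * a p + apply_field A \<tau> a p)))"

definition \<Delta> :: "('m \<Rightarrow> 'k) \<Rightarrow> 'm \<Rightarrow> 'k" where
  "\<Delta> f p = laplace_beltrami A g f p + apply_field A \<zeta> f p"

lemma smooth_Delta: "smooth_fun A f \<Longrightarrow> smooth_fun A (\<Delta> f)"
  unfolding \<Delta>_def[abs_def]
  by (intro smooth_fun_add smooth_fun_laplace_beltrami smooth_fun_apply_field zeta)

lemma Delta_add: "smooth_fun A f \<Longrightarrow> smooth_fun A h \<Longrightarrow> \<Delta> (\<lambda>p. f p + h p) p = \<Delta> f p + \<Delta> h p"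
  by (simp add: \<Delta>_def laplace_beltrami_add apply_field_add)

lemma Delta_mult: "smooth_fun A f \<Longrightarrow> smooth_fun A h \<Longrightarrow>
    \<Delta> (\<lambda>p. f p * h p) p = h p * \<Delta> f p + f p * \<Delta> h p + 2 * inv_metric A g (ext_d A f) (ext_d A h) p"
  by (simp add: \<Delta>_def laplace_beltrami_mult apply_field_mult algebra_simps)

lemma Delta_scale: "smooth_fun A f \<Longrightarrow> \<Delta> (\<lambda>p. r * f p) p = r * \<Delta> f p"
  by (subst Delta_mult[OF smooth_fun_const])
    (simp_all add: \<Delta>_def laplace_beltrami_const apply_field_const ext_d_const[abs_def] inv_metric_0_left)

lemma Delta_commutator:
  assumes f: "smooth_fun A f"
  shows "\<Delta> (apply_field A \<tau> f) p = apply_field A \<tau> (\<Delta> f) p + (1 + \<alpha> p) * \<Delta> f p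
    - (of_nat CARD('n) - 2) / 2 * inv_metric A g (ext_d A \<alpha>) (ext_d A f) p
    - inv_metric A g (lie_form \<tau> (flat g \<zeta>)) (ext_d A f) p"
  unfolding \<Delta>_def[abs_def] laplace_beltrami_conformal[OF f] apply_field_commutator[OF zeta f] ext_d_alpha
    apply_field_add[OF smooth_fun_laplace_beltrami[OF f] smooth_fun_apply_field[OF zeta f]]
  by (simp add: algebra_simps)

lemma calculus_d_eq: "calculus_d A g l \<zeta> f = (ext_d A f, \<lambda>p. l / 2 * \<Delta> f p)"
  by (simp add: calculus_d_def \<Delta>_def)

lemma kappa_add: "\<kappa> (\<lambda>c p. \<omega> c p + \<eta> c p) p = \<kappa> \<omega> p + \<kappa> \<eta> p"
  by (simp only: \<kappa>_def inv_metric_add_right distrib_left) simp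

lemma kappa_scale: "\<kappa> (\<lambda>c p. f p *s \<omega> c p) p = f p * \<kappa> \<omega> p"
  by (simp only: \<kappa>_def inv_metric_scale_right right_diff_distrib mult.left_commute[of _ "f p"])

lemma smooth_kappa:
  assumes "one_form A \<omega>"
  shows "smooth_fun A (\<kappa> \<omega>)"
  unfolding \<kappa>_def[abs_def]
  by (intro smooth_fun_diff smooth_fun_mult smooth_fun_const smooth_fun_inv_metric one_form_ext_d alpha
      one_form_lie_form tau one_form_flat zeta assms)

lemma D_form: "one_form A \<omega> \<Longrightarrow> one_form A (\<lambda>c p. l *s (lie_form \<tau> \<omega> c p - \<omega> c p))"
proof -
  assume w: "one_form A \<omega>"
  have "one_form A (\<lambda>c p. l *s (lie_form \<tau> \<omega> c p + (-1) *s \<omega> c p))"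
    by (intro one_form_scale one_form_add smooth_fun_const one_form_lie_form tau w)
  then show ?thesis by simp
qed

lemma D_module: "diff_module S \<delta> Om la D"
proof (unfold_locales)
  show "0 \<in> S" "1 \<in> S" by (simp_all add: S_def zero_fun_def one_fun_def smooth_fun_const)
  show "0 \<in> Om" by (simp add: Om_def zero_prod_def zero_fun_def smooth_fun_const one_form_0)
next
  fix f h :: "'m \<Rightarrow> 'k" assume "f \<in> S" "h \<in> S"
  then have f: "smooth_fun A f" and h: "smooth_fun A h" by (simp_all add: S_def)
  show "f + h \<in> S" "f * h \<in> S"
    using f h by (simp_all add: S_def plus_fun_def times_fun_def smooth_fun_add smooth_fun_mult)
  show "\<delta> (f + h) = \<delta> f + \<delta> h" "\<delta> (f * h) = \<delta> f * h + f * \<delta> h"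
    using f h by (auto simp: \<delta>_def fun_eq_iff plus_fun_def times_fun_def apply_field_add apply_field_mult algebra_simps)
next
  fix f :: "'m \<Rightarrow> 'k" assume "f \<in> S"
  then have f: "smooth_fun A f" by (simp add: S_def)
  show "- f \<in> S" using f by (simp add: S_def fun_Compl_def smooth_fun_minus)
  show "\<delta> f \<in> S"
    using f by (simp add: S_def \<delta>_def[abs_def] smooth_fun_mult smooth_fun_const smooth_fun_apply_field[OF tau])
next
  fix v assume "v \<in> Om"
  then obtain \<omega> a where v: "v = (\<omega>, a)" and w: "one_form A \<omega>" and a: "smooth_fun A a" by (auto simp: Om_def)
  have "one_form A (\<lambda>c p. (-1) *s \<omega> c p)" by (rule one_form_scale[OF smooth_fun_const w])
  then show "- v \<in> Om" using a by (simp add: Om_def v fun_Compl_def smooth_fun_minus)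
  show "la 1 v = v" by (simp add: la_def v)
  show "D v \<in> Om"
    using D_form[OF w] smooth_fun_add[OF smooth_kappa[OF w]
        smooth_fun_mult[OF smooth_fun_const smooth_fun_add[OF smooth_fun_mult[OF alpha a] smooth_fun_apply_field[OF tau a]]]]
    by (simp add: D_def Om_def v)
next
  fix v u assume "v \<in> Om" "u \<in> Om"
  then obtain \<omega> a \<eta> b where v: "v = (\<omega>, a)" "u = (\<eta>, b)" and w: "one_form A \<omega>" "one_form A \<eta>"
    and a: "smooth_fun A a" "smooth_fun A b" by (auto simp: Om_def)
  show "v + u \<in> Om" using w a by (simp add: v Om_def plus_fun_def one_form_add smooth_fun_add)
  show "D (v + u) = D v + D u"
    by (simp add: v D_def fun_eq_iff plus_fun_def kappa_add lie_form_add[OF tau w] apply_field_add[OF a])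
      (simp add: vec_eq_iff algebra_simps)
  show "la f (v + u) = la f v + la f u" for f
    by (auto simp: v la_def fun_eq_iff vec_eq_iff algebra_simps)
next
  fix f v assume "f \<in> S" "v \<in> Om"
  then obtain \<omega> a where v: "v = (\<omega>, a)" and w: "one_form A \<omega>" and a: "smooth_fun A a" and f: "smooth_fun A f"
    by (auto simp: Om_def S_def)
  show "la f v \<in> Om" by (simp add: la_def v Om_def one_form_scale[OF f w] smooth_fun_mult[OF f a])
  show "D (la f v) = la f (D v) + la (\<delta> f) v"
    by (simp add: v D_def la_def fun_eq_iff plus_fun_def kappa_scale lie_form_scale[OF tau f w]
        apply_field_mult[OF f a] \<delta>_def) (simp add: vec_eq_iff algebra_simps)
  show "la (f + h) v = la f v + la h v" "la (f * h) v = la f (la h v)" for h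
    by (auto simp: v la_def fun_eq_iff vec_eq_iff algebra_simps)
qed

text \<open>
  Among the bimodule axioms the Leibniz rule for \<open>D (v f)\<close> is the one that uses the geometry: its
  \<open>\<theta>'\<close>-component is the formula for \<open>\<tau> (\<omega>, df)\<close> that expresses the weight of the inverse metric.
\<close>

lemma D_bimodule: "diff_bimodule S \<delta> Om la D ra"
  unfolding diff_bimodule_def diff_bimodule_axioms_def
proof (intro conjI allI impI D_module)
  fix f v assume "f \<in> S" "v \<in> Om"
  then obtain \<omega> a where v: "v = (\<omega>, a)" and w: "one_form A \<omega>" and a: "smooth_fun A a" and f: "smooth_fun A f"
    by (auto simp: Om_def S_def)
  have wf: "smooth_fun A (inv_metric A g \<omega> (ext_d A f))"
    by (rule smooth_fun_inv_metric[OF w one_form_ext_d[OF f]])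
  show "ra v f \<in> Om"
    by (simp add: ra_def v Om_def one_form_scale[OF f w] smooth_fun_add smooth_fun_mult[OF f a]
        smooth_fun_mult[OF smooth_fun_const wf])
  have dl: "inv_metric A g \<omega> (ext_d A (\<delta> f)) p = l * inv_metric A g \<omega> (ext_d A (apply_field A \<tau> f)) p" for p
  proof -
    have "ext_d A (\<delta> f) = (\<lambda>c p. l *s ext_d A (apply_field A \<tau> f) c p)"
      by (intro ext) (simp add: \<delta>_def[abs_def] ext_d_mult[OF smooth_fun_const smooth_fun_apply_field[OF tau f]] ext_d_const)
    then show ?thesis by (simp add: inv_metric_scale_right)
  qed
  have tf: "apply_field A \<tau> (\<lambda>p. f p * a p + l * inv_metric A g \<omega> (ext_d A f) p) p =
      apply_field A \<tau> f p * a p + f p * apply_field A \<tau> a p + l * apply_field A \<tau> (inv_metric A g \<omega> (ext_d A f)) p" for p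
    by (simp add: apply_field_add smooth_fun_mult f a smooth_fun_const wf apply_field_mult apply_field_const)
  show "D (ra v f) = ra (D v) f + ra v (\<delta> f)"
    by (simp add: v D_def ra_def fun_eq_iff plus_fun_def kappa_scale lie_form_scale[OF tau f w] tf dl
        apply_field_inv_metric_ext_d[OF w f] inv_metric_scale_left inv_metric_diff_left)
      (simp add: \<delta>_def vec_eq_iff algebra_simps)
next
  fix f h v assume "f \<in> S" "h \<in> S" "v \<in> Om"
  then obtain \<omega> a where v: "v = (\<omega>, a)" and w: "one_form A \<omega>" and a: "smooth_fun A a"
    and f: "smooth_fun A f" and h: "smooth_fun A h"
    by (auto simp: Om_def S_def)
  have e: "ext_d A (f + h) = (\<lambda>c p. ext_d A f c p + ext_d A h c p)"
      "ext_d A (f * h) = (\<lambda>c p. h p *s ext_d A f c p + f p *s ext_d A h c p)"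
    by (auto simp: fun_eq_iff plus_fun_def times_fun_def ext_d_add[OF f h] ext_d_mult[OF f h])
  show "ra v (f + h) = ra v f + ra v h"
    by (auto simp: ra_def v e inv_metric_add_right fun_eq_iff vec_eq_iff algebra_simps)
  show "ra v (f * h) = ra (ra v f) h"
    by (auto simp: ra_def v e inv_metric_add_right inv_metric_scale_right inv_metric_scale_left
        fun_eq_iff vec_eq_iff algebra_simps)
  show "ra (la f v) h = la f (ra v h)"
    by (auto simp: ra_def la_def v inv_metric_scale_left fun_eq_iff vec_eq_iff algebra_simps)
next
  fix v assume "v \<in> Om"
  then show "ra v 1 = v"
    by (cases v) (auto simp: ra_def one_fun_def ext_d_const[abs_def] inv_metric_0_right)
next
  fix f v u assume "f \<in> S" "v \<in> Om" "u \<in> Om"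
  then show "ra (v + u) f = ra v f + ra u f"
    by (cases v; cases u) (auto simp: ra_def plus_fun_def inv_metric_add_left fun_eq_iff vec_eq_iff algebra_simps)
qed

definition e :: "('m, 'n, 'k) field \<times> ('m \<Rightarrow> 'k)" where
  "e = (\<lambda>c p. 0, \<lambda>p. \<beta> p * l)"

text \<open>
  The Leibniz rule of the differential is the product rule \<open>Delta_mult\<close> of the second order operator \<open>\<Delta>\<close>. The
  compatibility with \<open>D\<close> is \<open>lie_form_ext_d\<close> in the form component and \<open>l\<^sup>2/2\<close> times \<open>Delta_commutator\<close> in
  the \<open>\<theta>'\<close>-component.
\<close>

lemma calculus_derivation: "calculus_derivation S \<delta> Om la D ra (calculus_d A g l \<zeta>) e l (\<lambda>r p. r)"
  unfolding calculus_derivation_def calculus_derivation_axioms_def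
proof (intro conjI allI impI D_bimodule)
  show "(\<lambda>p. r) \<in> S" for r by (simp add: S_def smooth_fun_const)
  show "\<delta> (\<lambda>p. r) = 0" for r by (simp add: \<delta>_def fun_eq_iff apply_field_const)
  show "e \<in> Om" by (simp add: e_def Om_def one_form_0 smooth_fun_mult beta smooth_fun_const)
  show "ra e f = la f e" for f
    by (auto simp: ra_def la_def e_def fun_eq_iff inv_metric_0_left)
  show "ra w (\<lambda>p. r) = la (\<lambda>p. r) w" for r w
    by (auto simp: ra_def la_def fun_eq_iff ext_d_const[abs_def] inv_metric_0_right split: prod.split)
next
  fix f assume "f \<in> S"
  then have f: "smooth_fun A f" by (simp add: S_def)
  note tf = smooth_fun_apply_field[OF tau f]
  show "calculus_d A g l \<zeta> f \<in> Om"
    unfolding calculus_d_eq Om_def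
    using one_form_ext_d[OF f] smooth_fun_mult[OF smooth_fun_const smooth_Delta[OF f]] by blast
  show "calculus_d A g l \<zeta> ((\<lambda>p. r) * f) = la (\<lambda>p. r) (calculus_d A g l \<zeta> f)" for r
    by (auto simp: calculus_d_eq la_def times_fun_def fun_eq_iff Delta_scale[OF f]
        ext_d_mult[OF smooth_fun_const f] ext_d_const)
  have \<delta>f: "calculus_d A g l \<zeta> (\<delta> f) = (\<lambda>c p. l *s ext_d A (apply_field A \<tau> f) c p, \<lambda>p. l / 2 * (l * \<Delta> (apply_field A \<tau> f) p))"
    by (auto simp: calculus_d_eq fun_eq_iff \<delta>_def[abs_def] Delta_scale[OF tf] ext_d_mult[OF smooth_fun_const tf] ext_d_const)
  have \<tau>\<Delta>: "apply_field A \<tau> (\<lambda>p. l / 2 * \<Delta> f p) p = l / 2 * apply_field A \<tau> (\<Delta> f) p" for p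
    unfolding apply_field_mult[OF smooth_fun_const smooth_Delta[OF f]] apply_field_const by simp
  then have \<tau>\<Delta>': "apply_field A \<tau> (\<lambda>p. l * \<Delta> f p / 2) p = l / 2 * apply_field A \<tau> (\<Delta> f) p" for p
    by simp
  show "D (calculus_d A g l \<zeta> f) + la (\<lambda>p. l) (calculus_d A g l \<zeta> f) = calculus_d A g l \<zeta> (\<delta> f)"
    unfolding \<delta>f
    by (auto simp: calculus_d_eq D_def la_def lie_form_ext_d[OF f] fun_eq_iff vec_eq_iff \<kappa>_def \<tau>\<Delta>'
        Delta_commutator[OF f] field_simps power2_eq_square)
next
  fix f h assume "f \<in> S" "h \<in> S"
  then have f: "smooth_fun A f" and h: "smooth_fun A h" by (simp_all add: S_def)
  show "calculus_d A g l \<zeta> (f + h) = calculus_d A g l \<zeta> f + calculus_d A g l \<zeta> h"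
    by (auto simp: calculus_d_eq plus_fun_def fun_eq_iff Delta_add[OF f h] ext_d_add[OF f h] algebra_simps)
  show "calculus_d A g l \<zeta> (f * h) = ra (calculus_d A g l \<zeta> f) h + la f (calculus_d A g l \<zeta> h)"
    by (auto simp: calculus_d_eq times_fun_def plus_fun_def ra_def la_def fun_eq_iff Delta_mult[OF f h]
        ext_d_mult[OF f h] algebra_simps)
qed (auto simp: fun_eq_iff)

end

theorem theorem3p1:
  fixes A :: "('m::{t2_space, second_countable_topology}, 'n::finite) chart set"
    and g :: "('m, 'n) metric"
    and \<zeta> \<tau> :: "('m, 'n, 'k::real_normed_field) field"
    and \<alpha> \<beta> :: "'m \<Rightarrow> 'k"
    and l :: 'k
  assumes "smooth_atlas A"
    and "riemannian_metric A g"
    and "vector_field A \<zeta>"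
    and "smooth_fun A \<beta>"
    and "conformal_killing A g \<tau>"
    and "\<alpha> = (\<lambda>p. 2 / of_nat CARD('n) * divergence A g \<tau> p - 1)"
  shows "\<exists>(W :: ('k, nat \<Rightarrow> 'm \<Rightarrow> 'k, nat \<Rightarrow> (('m, 'n, 'k) field \<times> ('m \<Rightarrow> 'k)) \<times> ('m \<Rightarrow> 'k)) bimod) d j.
    let CM = function_algebra A; \<Omega> = calculus A g l; B = crossed_product A \<tau> l; t = gen_t; dt = d t in
    fodc_extension scalars CM \<Omega> (calculus_d A g l \<zeta>) B W d incl j \<and>
    bij_betw
      (\<lambda>(w, b :: nat \<Rightarrow> 'm \<Rightarrow> 'k). \<Oplus>\<^bsub>W\<^esub>n\<in>{n. w n \<noteq> \<zero>\<^bsub>\<Omega>\<^esub> \<or> b n \<noteq> \<zero>\<^bsub>CM\<^esub>}.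
         ract W (j (w n) \<oplus>\<^bsub>W\<^esub> lact W (incl (b n)) dt) (t [^]\<^bsub>B\<^esub> n))
      {(w, b :: nat \<Rightarrow> 'm \<Rightarrow> 'k). (\<forall>n. w n \<in> carrier \<Omega> \<and> b n \<in> carrier CM) \<and>
         finite {n. w n \<noteq> \<zero>\<^bsub>\<Omega>\<^esub> \<or> b n \<noteq> \<zero>\<^bsub>CM\<^esub>}}
      (carrier W) \<and>
    (\<forall>\<omega>. one_form A \<omega> \<longrightarrow>
       comm_wa W (j (\<omega>, \<lambda>p. 0)) t =
         j (\<lambda>c p. l *s (lie_form \<tau> \<omega> c p - \<omega> c p),
            \<lambda>p. - l\<^sup>2 * ((of_nat CARD('n) - 2) / 4) * inv_metric A g (ext_d A \<alpha>) \<omega> p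
                 - l\<^sup>2 / 2 * inv_metric A g (lie_form \<tau> (flat g \<zeta>)) \<omega> p)) \<and>
    comm_wa W (j (\<lambda>c p. 0, \<lambda>p. 1)) t = j (\<lambda>c p. 0, \<lambda>p. \<alpha> p * l) \<and>
    (\<forall>f. smooth_fun A f \<longrightarrow> comm_aw W (incl f) dt = l \<odot>\<^bsub>W\<^esub> d (incl f)) \<and>
    comm_wa W dt t = j (\<lambda>c p. 0, \<lambda>p. \<beta> p * l) \<ominus>\<^bsub>W\<^esub> l \<odot>\<^bsub>W\<^esub> dt"
proof -
  interpret riemannian A g by unfold_locales (rule assms)+
  obtain \<phi> where tau: "vector_field A \<tau>" and phi: "smooth_fun A \<phi>"
    and killing: "\<And>c p i j. c \<in> A \<Longrightarrow> p \<in> fst c \<Longrightarrow> lie_metric \<tau> g c p $ i $ j = \<phi> p * of_real (g c p $ i $ j)"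
    using assms(5) unfolding conformal_killing_def by blast
  have "divergence A g \<tau> p = of_nat CARD('n) / 2 * \<phi> p" for p
  proof -
    interpret conformal A g \<tau> \<phi> by unfold_locales (use tau phi killing in auto)
    show ?thesis unfolding divergence_eq[OF tau chart_at] by (rule divergence_killing[OF chart_at])
  qed
  then have phi_eq: "\<phi> = (\<lambda>p. 1 + \<alpha> p)" unfolding assms(6) by (simp only:) simp
  interpret C: conformal_calculus A g \<tau> \<alpha> \<zeta> \<beta> l
    by unfold_locales (use tau phi killing assms(3,4) in \<open>auto simp: phi_eq\<close>)
  interpret O: calculus_derivation C.S C.\<delta> C.Om C.la C.D C.ra "calculus_d A g l \<zeta>" C.e l "\<lambda>r p. r"
    by (rule C.calculus_derivation)
  \<comment> \<open>The concrete records are instances of the general construction: \<open>left_t\<close> is left multiplication by \<open>t\<close> for \<open>\<delta> = l \<tau>\<close>.\<close>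
  have CM: "function_algebra A = O.base_algebra"
    by (simp add: function_algebra_def alg_rec_def C.S_def times_fun_def plus_fun_def zero_fun_def one_fun_def fun_eq_iff)
  have Om: "calculus A g l = O.base_bimodule"
    by (simp add: calculus_def bim_rec_def C.Om_def C.la_def C.ra_def fun_eq_iff zero_prod_def zero_fun_def plus_fun_def)
  have left: "left_t A \<tau> l = skew_t C.\<delta>"
    by (auto simp: fun_eq_iff left_t_def skew_t_def shift_def C.\<delta>_def split: nat.split)
  have B: "crossed_product A \<tau> l = O.ore_algebra"
    by (simp add: crossed_product_def alg_rec_def finsup_def C.S_def zero_fun_def[symmetric] left plus_fun_def
        skew_act_def coeff_act_def times_fun_def sum_fun_apply O.cB_def const_poly_def fun_eq_iff one_fun_def)
  have incl: "incl = (const_poly :: ('m \<Rightarrow> 'k) \<Rightarrow> _)"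
    by (simp add: fun_eq_iff incl_def const_poly_def zero_fun_def)
  have gen: "gen_t = (O.gen :: nat \<Rightarrow> 'm \<Rightarrow> 'k)"
    by (auto simp: fun_eq_iff gen_t_def shift_def const_poly_def split: nat.split)
  have emb_comm: "comm_wa O.ore_bimodule (O.emb w) O.gen = O.emb (C.D w)" if "w \<in> C.Om" for w
    by (rule O.comm_emb[OF that])
  show ?thesis
    unfolding Let_def CM Om B incl gen
  proof (intro exI[of _ O.ore_bimodule] exI[of _ O.dW] exI[of _ O.emb] conjI allI impI)
    show "fodc_extension scalars O.base_algebra O.base_bimodule (calculus_d A g l \<zeta>) O.ore_algebra O.ore_bimodule
        O.dW const_poly O.emb"
      by (rule O.extension)
  next
    show "bij_betw (\<lambda>(w, b :: nat \<Rightarrow> 'm \<Rightarrow> 'k).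
          \<Oplus>\<^bsub>O.ore_bimodule\<^esub>n\<in>{n. w n \<noteq> \<zero>\<^bsub>O.base_bimodule\<^esub> \<or> b n \<noteq> \<zero>\<^bsub>O.base_algebra\<^esub>}.
         ract O.ore_bimodule (O.emb (w n) \<oplus>\<^bsub>O.ore_bimodule\<^esub> lact O.ore_bimodule (const_poly (b n)) (O.dW O.gen))
           (O.gen [^]\<^bsub>O.ore_algebra\<^esub> n))
      {(w, b :: nat \<Rightarrow> 'm \<Rightarrow> 'k). (\<forall>n. w n \<in> carrier O.base_bimodule \<and> b n \<in> carrier O.base_algebra) \<and>
         finite {n. w n \<noteq> \<zero>\<^bsub>O.base_bimodule\<^esub> \<or> b n \<noteq> \<zero>\<^bsub>O.base_algebra\<^esub>}}
      (carrier O.ore_bimodule)"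
      unfolding O.dW_gen alg_rec_simps(1,4) bim_rec_simps(1,2) by (rule O.normal_form)
  next
    fix \<omega> :: "('m, 'n, 'k) field" assume w: "one_form A \<omega>"
    have "C.D (\<omega>, \<lambda>p. 0) = (\<lambda>c p. l *s (lie_form \<tau> \<omega> c p - \<omega> c p), C.\<kappa> \<omega>)"
      by (simp add: C.D_def apply_field_const)
    moreover have "(\<omega>, \<lambda>p. 0) \<in> C.Om" by (simp add: C.Om_def w smooth_fun_const)
    ultimately show "comm_wa O.ore_bimodule (O.emb (\<omega>, \<lambda>p. 0)) O.gen =
         O.emb (\<lambda>c p. l *s (lie_form \<tau> \<omega> c p - \<omega> c p),
            \<lambda>p. - l\<^sup>2 * ((of_nat CARD('n) - 2) / 4) * inv_metric A g (ext_d A \<alpha>) \<omega> p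
                 - l\<^sup>2 / 2 * inv_metric A g (lie_form \<tau> (flat g \<zeta>)) \<omega> p)"
      unfolding C.\<kappa>_def[abs_def] by (simp only: emb_comm)
  next
    have "lie_form \<tau> (\<lambda>c p. 0) c p = 0" for c p by (simp add: lie_form_def vec_eq_iff)
    then have "C.D (\<lambda>c p. 0, \<lambda>p. 1) = (\<lambda>c p. 0, \<lambda>p. \<alpha> p * l)"
      by (simp add: C.D_def C.\<kappa>_def inv_metric_0_right apply_field_const fun_eq_iff)
    moreover have "(\<lambda>c p. 0, \<lambda>p. 1) \<in> C.Om" by (simp add: C.Om_def one_form_0 smooth_fun_const)
    ultimately show "comm_wa O.ore_bimodule (O.emb (\<lambda>c p. 0, \<lambda>p. 1)) O.gen = O.emb (\<lambda>c p. 0, \<lambda>p. \<alpha> p * l)"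
      by (simp only: emb_comm)
  next
    fix f :: "'m \<Rightarrow> 'k" assume "smooth_fun A f"
    then have "f \<in> C.S" by (simp add: C.S_def)
    from O.comm_dt[OF this]
    show "comm_aw O.ore_bimodule (const_poly f) (O.dW O.gen) = l \<odot>\<^bsub>O.ore_bimodule\<^esub> O.dW (const_poly f)"
      by (simp only: O.dW_gen bim_rec_simps)
  next
    show "comm_wa O.ore_bimodule (O.dW O.gen) O.gen =
        O.emb (\<lambda>c p. 0, \<lambda>p. \<beta> p * l) \<ominus>\<^bsub>O.ore_bimodule\<^esub> l \<odot>\<^bsub>O.ore_bimodule\<^esub> O.dW O.gen"
      unfolding O.dW_gen bim_rec_simps(4) C.e_def[symmetric] by (rule O.comm_dt_gen)
  qed
qed

end
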